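(* Let $n\ge3$, let $m\ge1$ be an integer, let $0<\alpha\le2$, and set $s:=m+\frac{\alpha}{2}$; assume $\frac n2\le s<+\infty$. Let $-\infty<\sigma<n$, $0<q<+\infty$, and let $p$ satisfy $0<p<+\infty$ if $0<\alpha<2$, and $1\le p<+\infty$ if $\alpha=2$. Suppose that $u$ is a nonnegative classical solution of $$(-\Delta)^{s}u(x)=\left(\frac{1}{|x|^{\sigma}}\ast|u|^{p}\right)u^{q}(x)\qquad\text{in }\mathbb{R}^{n}.$$ Then $u\equiv0$ in $\mathbb{R}^{n}$.
   Context: Convolution: $\left(\frac{1}{|x|^{\sigma}}\ast|u|^{p}\right)(x)=\int_{\mathbb{R}^n}\frac{|u(z)|^p}{|x-z|^{\sigma}}\,dz$. Fractional Laplacian: for $0<\alpha<2$, $$(-\Delta)^{\frac{\alpha}{2}}u(x)=C_{\alpha,n}\lim_{\epsilon\to0}\int_{|y-x|\ge\epsilon}\frac{u(x)-u(y)}{|x-y|^{n+\alpha}}\,dy,\qquad C_{\alpha,n}=\left(\int_{\mathbb{R}^{n}}\frac{1-\cos(2\pi\zeta_{1})}{|\zeta|^{n+\alpha}}d\zeta\right)^{-1},$$ defined for $u\in C^{[\alpha],\{\alpha\}+\epsilon}_{loc}(\mathbb{R}^n)\cap\mathcal{L}_{\alpha}(\mathbb{R}^{n})$ with some (arbitrarily small) $\epsilon>0$, where $[\alpha]$ is the integer part of $\alpha$, $\{\alpha\}=\alpha-[\alpha]$, and $\mathcal{L}_{\alpha}(\mathbb{R}^{n})=\{u:\mathbb{R}^n\to\mathbb{R}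 \mid \int_{\mathbb{R}^{n}}\frac{|u(x)|}{1+|x|^{n+\alpha}}dx<\infty\}$. For $\alpha=2$, $(-\Delta)^{\alpha/2}=-\Delta$. Moreover $(-\Delta)^{m+\frac{\alpha}{2}}u:=(-\Delta)^{m}(-\Delta)^{\frac{\alpha}{2}}u$. Classical solution: $u$ is a classical solution if $u\in C^{2m+2}(\mathbb{R}^n)$ when $\alpha=2$, respectively $u\in C^{2m+[\alpha],\{\alpha\}+\epsilon}_{loc}(\mathbb{R}^n)\cap\mathcal{L}_\alpha(\mathbb{R}^n)$ for some (arbitrarily small) $\epsilon>0$ when $0<\alpha<2$ (this guarantees $(-\Delta)^{\frac{\alpha}{2}}u\in C^{2m}(\mathbb{R}^n)$), and $u$ satisfies the equation pointwise at every $x\in\mathbb{R}^n$, with the convolution finite at every point. *)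

theory Defs
  imports "HOL-Analysis.Analysis"
begin

definition partial_derivative :: "'n::finite \<Rightarrow> (real^'n \<Rightarrow> real) \<Rightarrow> real^'n \<Rightarrow> real" where
  "partial_derivative i f x = deriv (\<lambda>t. f (x + t *\<^sub>R axis i 1)) 0"

definition has_partial_derivatives :: "(real^'n::finite \<Rightarrow> real) \<Rightarrow> bool" where
  "has_partial_derivatives f \<longleftrightarrow>
     (\<forall>i x. (\<lambda>t. f (x + t *\<^sub>R axis i 1)) differentiable (at 0))"

definition iterated_partial :: "'n::finite list \<Rightarrow> (real^'n \<Rightarrow> real) \<Rightarrow> real^'n \<Rightarrow> real" where
  "iterated_partial is f = foldr partial_derivative is f"

text \<open>\<open>C^k\<close> on the whole space: every iterated partial derivative of order at most \<open>k\<close> exists and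
  is continuous.  A list of indices records the successive directions of differentiation.\<close>

definition C_k :: "nat \<Rightarrow> (real^'n::finite \<Rightarrow> real) set" where
  "C_k k = {f. (\<forall>is. length is < k \<longrightarrow> has_partial_derivatives (iterated_partial is f)) \<and>
               (\<forall>is. length is \<le> k \<longrightarrow> continuous_on UNIV (iterated_partial is f))}"

definition locally_Hoelder :: "real \<Rightarrow> (real^'n::finite \<Rightarrow> real) \<Rightarrow> bool" where
  "locally_Hoelder \<gamma> f \<longleftrightarrow>
     (\<forall>K. compact K \<longrightarrow> (\<exists>C. \<forall>x\<in>K. \<forall>y\<in>K. \<bar>f x - f y\<bar> \<le> C * dist x y powr \<gamma>))"

definition C_Hoelder_loc :: "nat \<Rightarrow> real \<Rightarrow> (real^'n::finite \<Rightarrow> real) set" where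
  "C_Hoelder_loc k \<gamma> =
     {f \<in> C_k k. \<forall>is. length is = k \<longrightarrow> locally_Hoelder \<gamma> (iterated_partial is f)}"

definition L_space :: "real \<Rightarrow> (real^'n::finite \<Rightarrow> real) set" where
  "L_space \<alpha> =
     {u. integrable lborel (\<lambda>x. \<bar>u x\<bar> / (1 + norm x powr (real CARD('n) + \<alpha>)))}"

definition laplacian :: "(real^'n::finite \<Rightarrow> real) \<Rightarrow> real^'n \<Rightarrow> real" where
  "laplacian f x = (\<Sum>i\<in>UNIV. partial_derivative i (partial_derivative i f) x)"

definition neg_laplacian :: "(real^'n::finite \<Rightarrow> real) \<Rightarrow> real^'n \<Rightarrow> real" where
  "neg_laplacian f = (\<lambda>x. - laplacian f x)"

text \<open>The index type is not ordered, so the first coordinate \<open>\<zeta>\<^sub>1\<close> in the normalising constant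
  is replaced by an arbitrary fixed coordinate; the integral is the same for every coordinate, because
  Lebesgue measure and the norm are invariant under permuting the coordinates.
  The second argument only carries the dimension.\<close>

definition frac_const :: "real \<Rightarrow> 'n::finite itself \<Rightarrow> real" where
  "frac_const \<alpha> _ =
     inverse (LINT \<zeta>|lborel. (1 - cos (2 * pi * (\<zeta>::real^'n) $ (SOME i. True)))
                               / norm \<zeta> powr (real CARD('n) + \<alpha>))"

definition frac_laplacian :: "real \<Rightarrow> (real^'n::finite \<Rightarrow> real) \<Rightarrow> real^'n \<Rightarrow> real" where
  "frac_laplacian \<alpha> u =
     (if \<alpha> = 2 then neg_laplacian u
      else (\<lambda>x. frac_const \<alpha> TYPE('n) *
             Lim (at_right 0) (\<lambda>\<epsilon>. LINT y:{y. norm (y - x) \<ge> \<epsilon>}|lborel.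
               (u x - u y) / norm (x - y) powr (real CARD('n) + \<alpha>))))"

text \<open>\<open>(-\<Delta>)^(m + \<alpha>/2)\<close>: the fractional operator is applied first, then \<open>m\<close> times \<open>-\<Delta>\<close>.\<close>

definition higher_frac_laplacian :: "nat \<Rightarrow> real \<Rightarrow> (real^'n::finite \<Rightarrow> real) \<Rightarrow> real^'n \<Rightarrow> real" where
  "higher_frac_laplacian m \<alpha> u = (neg_laplacian ^^ m) (frac_laplacian \<alpha> u)"

definition convolution_integrand ::
    "real \<Rightarrow> real \<Rightarrow> (real^'n::finite \<Rightarrow> real) \<Rightarrow> real^'n \<Rightarrow> real^'n \<Rightarrow> real" where
  "convolution_integrand \<sigma> p u x z = \<bar>u z\<bar> powr p / norm (x - z) powr \<sigma>"

definition riesz_convolution ::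
    "real \<Rightarrow> real \<Rightarrow> (real^'n::finite \<Rightarrow> real) \<Rightarrow> real^'n \<Rightarrow> real" where
  "riesz_convolution \<sigma> p u x = (LINT z|lborel. convolution_integrand \<sigma> p u x z)"

text \<open>The Hoelder exponent \<open>{\<alpha>} + \<epsilon>\<close> is kept at most 1, where Hoelder classes have their usual
  meaning; as \<open>\<epsilon> > 0\<close> may be arbitrarily small, this is no restriction.\<close>

definition solution_space :: "nat \<Rightarrow> real \<Rightarrow> (real^'n::finite \<Rightarrow> real) set" where
  "solution_space m \<alpha> =
     (if \<alpha> = 2 then C_k (2 * m + 2)
      else {u \<in> L_space \<alpha>. \<exists>\<epsilon>>0. frac \<alpha> + \<epsilon> \<le> 1 \<and>
              u \<in> C_Hoelder_loc (2 * m + nat \<lfloor>\<alpha>\<rfloor>) (frac \<alpha> + \<epsilon>)})"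

text \<open>Real powers with \<open>powr\<close>: as \<open>p, q > 0\<close>, the convention \<open>0 powr a = 0\<close> is the intended one.
  In the convolution kernel the point \<open>z = x\<close> has measure zero.  Finiteness of the convolution is
  integrability of its nonnegative integrand.\<close>

definition classical_solution ::
    "nat \<Rightarrow> real \<Rightarrow> real \<Rightarrow> real \<Rightarrow> real \<Rightarrow> (real^'n::finite \<Rightarrow> real) \<Rightarrow> bool" where
  "classical_solution m \<alpha> \<sigma> p q u \<longleftrightarrow>
     u \<in> solution_space m \<alpha> \<and>
     (\<forall>x. integrable lborel (convolution_integrand \<sigma> p u x)) \<and>
     (\<forall>x. higher_frac_laplacian m \<alpha> u x = riesz_convolution \<sigma> p u x * u x powr q)"

end

theory Submission
  imports Defs "HOL-Probability.Distributions" "HOL-Computational_Algebra.Polynomial" "HOL-Real_Asymp.Real_Asymp"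
begin

text \<open>Only \<open>u \<ge> 0\<close>, the growth of \<open>u\<close> and \<open>f = (-\<Delta>)^s u \<ge> 0\<close> matter; the claim is \<open>f = 0\<close>.
  Let \<open>n\<close> be the dimension and \<open>H\<^sub>t\<close> the heat kernel.
  The functions \<open>A\<^sub>j(t) = \<integral> u (-\<Delta>)^(j + \<alpha>/2) H\<^sub>t\<close> satisfy \<open>A\<^sub>j' = - A\<^sub>j\<^sub>+\<^sub>1\<close> and tend to \<open>0\<close> as \<open>t\<close>
  grows (for \<open>\<alpha> < 2\<close> because \<open>u\<close> is in \<open>L_space \<alpha>\<close>, for \<open>\<alpha> = 2\<close> because the convolution is finite and
  \<open>p \<ge> 1\<close>).  If \<open>f \<noteq> 0\<close>, then \<open>A\<^sub>m(t) \<ge> \<integral> f H\<^sub>t \<ge> c t^(-n/2)\<close>, and integrating downwards in \<open>j\<close>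
  (to \<open>j = -1\<close> if \<open>\<alpha> = 2\<close>) diverges unless \<open>n = 2m + 1\<close> and \<open>1 \<le> \<alpha> < 2\<close>, when it leaves \<open>A\<^sub>0(t) \<ge> c t^(-1/2)\<close>.
  By subordination \<open>A\<^sub>0\<close> is the one-sided fractional derivative of order \<open>\<alpha>/2\<close> of the nonnegative function
  \<open>U(t) = \<integral> u H\<^sub>t\<close>, and comparison with \<open>ln (R/t)\<close> on \<open>[1, R]\<close> forces \<open>U(1) \<ge> c ln R\<close> for all \<open>R\<close>.\<close>

subsection \<open>Integrals depending on a parameter\<close>

text \<open>The growth of \<open>f\<close> and of the derivatives of \<open>u\<close> is unknown, so
  \<open>f\<close> cannot simply be integrated against a heat kernel. All derivatives are therefore
  put on test functions: nonnegative, compactly supported, and converging to the heat kernel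
  together with their derivatives under one Gaussian bound. Of \<open>f\<close> only a lower bound
  on a small ball enters. The fractional operator reduces Gaussian decay to decay of order
  \<open>n + \<alpha>\<close>, which is precisely the weight against which membership in
  \<open>L_space \<alpha>\<close> makes \<open>u\<close> integrable; parabolic scaling then converts
  decay in space into decay in time. Each whole Laplacian costs one integration in \<open>t\<close>,
  but the last step has order \<open>\<alpha>/2 < 1\<close> and is no integration, so a comparison
  argument replaces it. A logarithm is the right barrier there: for
  \<open>\<alpha>/2 \<ge> 1/2\<close> and \<open>t \<ge> 1\<close> the power
  \<open>t powr (- \<alpha>/2)\<close> stays below the available \<open>t powr (- 1/2)\<close>,
  while \<open>ln R\<close> is unbounded. Integrals over space are reduced to Gaussian ones by
  writing powers of the norm as mixtures of heat kernels.\<close>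

lemma has_real_derivative_integral_dominated:
  fixes F F' :: "real \<Rightarrow> 'a \<Rightarrow> real"
  assumes d: "d > 0"
    and int: "\<And>t. \<bar>t - t0\<bar> < d \<Longrightarrow> integrable M (F t)"
    and deriv: "\<And>t x. \<bar>t - t0\<bar> < d \<Longrightarrow> x \<in> space M \<Longrightarrow> ((\<lambda>t. F t x) has_real_derivative F' t x) (at t)"
    and bound: "\<And>t x. \<bar>t - t0\<bar> < d \<Longrightarrow> x \<in> space M \<Longrightarrow> \<bar>F' t x\<bar> \<le> g x"
    and g: "integrable M g"
    and meas: "F' t0 \<in> borel_measurable M"
  shows "((\<lambda>t. \<integral>x. F t x \<partial>M) has_real_derivative (\<integral>x. F' t0 x \<partial>M)) (at t0)"
proof -
  have "(\<lambda>h. ((\<integral>x. F (t0 + h) x \<partial>M) - (\<integral>x. F t0 x \<partial>M)) / h) \<midarrow>0\<rightarrow> (\<integral>x. F' t0 x \<partial>M)"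
    unfolding tendsto_at_iff_sequentially
  proof (intro allI impI)
    fix h :: "nat \<Rightarrow> real" assume h: "\<forall>i. h i \<in> UNIV - {0}" "h \<longlonglongrightarrow> 0"
    from h(2) d have "\<forall>\<^sub>F i in sequentially. \<bar>h i\<bar> < d"
      by (auto simp: tendsto_iff dist_real_def)
    then obtain N where N: "\<And>i. i \<ge> N \<Longrightarrow> \<bar>h i\<bar> < d"
      by (auto simp: eventually_sequentially)
    let ?q = "\<lambda>i x. (F (t0 + h (i + N)) x - F t0 x) / h (i + N)"
    have "(\<lambda>i. \<integral>x. ?q i x \<partial>M) \<longlonglongrightarrow> (\<integral>x. F' t0 x \<partial>M)"
    proof (rule integral_dominated_convergence[where w = g])
      show "?q i \<in> borel_measurable M" for i
      proof -
        have "integrable M (F t0)" "integrable M (F (t0 + h (i + N)))"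
          using int[of t0] int[of "t0 + h (i + N)"] N[of "i + N"] d by auto
        then have "integrable M (?q i)" by (intro integrable_divide_zero integrable_diff impI) auto
        then show ?thesis by (rule borel_measurable_integrable)
      qed
      show "AE x in M. (\<lambda>i. ?q i x) \<longlonglongrightarrow> F' t0 x"
      proof (rule AE_I2)
        fix x assume x: "x \<in> space M"
        have "(\<lambda>k. (F (t0 + k) x - F t0 x) / k) \<midarrow>0\<rightarrow> F' t0 x"
          using deriv[of t0 x] x d by (simp add: DERIV_def)
        moreover have "(\<lambda>i. h (i + N)) \<longlonglongrightarrow> 0" using h(2) by (rule LIMSEQ_ignore_initial_segment)
        ultimately show "(\<lambda>i. ?q i x) \<longlonglongrightarrow> F' t0 x"
          using h(1) unfolding tendsto_at_iff_sequentially
          by (elim allE[where x="\<lambda>i. h (i + N)"]) (auto simp: o_def)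
      qed
      show "AE x in M. norm (?q i x) \<le> g x" for i
      proof (rule AE_I2)
        fix x assume x: "x \<in> space M"
        have hne: "h (i+N) \<noteq> 0" using h by auto
        have hd: "\<bar>h (i+N)\<bar> < d" using N by auto
        \<comment> \<open>The mean value inequality turns the bound on the derivative into one on
          the difference quotients.\<close>
        have "\<bar>F (t0 + h (i+N)) x - F t0 x\<bar> \<le> g x * \<bar>t0 + h (i+N) - t0\<bar>"
        proof (rule field_differentiable_bound[of "ball t0 d" _ "\<lambda>t. F' t x" "g x", simplified real_norm_def])
          show "convex (ball t0 d)" by simp
          show "((\<lambda>t. F t x) has_field_derivative F' z x) (at z within ball t0 d)" if "z \<in> ball t0 d" for z
            using deriv[of z x] that x
            by (auto intro: DERIV_subset simp: dist_real_def abs_minus_commute)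
          show "\<bar>F' z x\<bar> \<le> g x" if "z \<in> ball t0 d" for z
            using bound[of z x] that x by (auto simp: dist_real_def abs_minus_commute)
          show "t0 + h (i+N) \<in> ball t0 d" "t0 \<in> ball t0 d"
            using hd d by (auto simp: dist_real_def)
        qed
        then show "norm (?q i x) \<le> g x" using hne by (simp add: field_simps)
      qed
    qed (use g meas in auto)
    moreover have "(\<integral>x. ?q i x \<partial>M) = ((\<integral>x. F (t0 + h (i+N)) x \<partial>M) - (\<integral>x. F t0 x \<partial>M)) / h (i+N)"
      for i
      using int[of t0] int[of "t0 + h (i + N)"] N[of "i + N"] d by simp
    ultimately have "(\<lambda>i. ((\<integral>x. F (t0 + h (i+N)) x \<partial>M) - (\<integral>x. F t0 x \<partial>M)) / h (i+N)) \<longlonglongrightarrow> (\<integral>x. F' t0 x \<partial>M)"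
      by (simp only:)
    then show "((\<lambda>h. ((\<integral>x. F (t0 + h) x \<partial>M) - (\<integral>x. F t0 x \<partial>M)) / h) \<circ> h) \<longlonglongrightarrow> (\<integral>x. F' t0 x \<partial>M)"
      unfolding o_def by (rule LIMSEQ_offset)
  qed
  then show ?thesis unfolding DERIV_def .
qed

lemma continuous_on_integral_dominated:
  fixes F :: "'b::metric_space \<Rightarrow> 'a \<Rightarrow> real"
  assumes meas: "\<And>x. F x \<in> borel_measurable M"
    and cont: "\<And>y. y \<in> space M \<Longrightarrow> continuous_on UNIV (\<lambda>x. F x y)"
    and dom: "\<And>x0. \<exists>d>0. \<exists>g. integrable M g \<and> (\<forall>x\<in>ball x0 d. \<forall>y\<in>space M. \<bar>F x y\<bar> \<le> g y)"
  shows "continuous_on UNIV (\<lambda>x. \<integral>y. F x y \<partial>M)"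
  unfolding continuous_on_sequentially
proof (intro allI ballI impI)
  fix X :: "nat \<Rightarrow> 'b" and x0 assume X: "(\<forall>n. X n \<in> UNIV) \<and> X \<longlonglongrightarrow> x0"
  obtain d g where d: "d > 0" and g: "integrable M g" and b: "\<forall>x\<in>ball x0 d. \<forall>y\<in>space M. \<bar>F x y\<bar> \<le> g y"
    using dom[of x0] by blast
  have "\<forall>\<^sub>F i in sequentially. dist (X i) x0 < d" using X d by (auto simp: tendsto_iff)
  then obtain N where N: "\<And>i. i \<ge> N \<Longrightarrow> dist (X i) x0 < d" by (auto simp: eventually_sequentially)
  have "(\<lambda>i. \<integral>y. F (X (i+N)) y \<partial>M) \<longlonglongrightarrow> (\<integral>y. F x0 y \<partial>M)"
  proof (rule integral_dominated_convergence[where w = g])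
    show "AE y in M. (\<lambda>i. F (X (i+N)) y) \<longlonglongrightarrow> F x0 y"
    proof (rule AE_I2)
      fix y assume y: "y \<in> space M"
      have "(\<lambda>i. X (i+N)) \<longlonglongrightarrow> x0" using X by (intro LIMSEQ_ignore_initial_segment) auto
      then show "(\<lambda>i. F (X (i+N)) y) \<longlonglongrightarrow> F x0 y"
        using cont[OF y] by (auto simp: continuous_on_sequentially o_def)
    qed
    show "AE y in M. norm (F (X (i+N)) y) \<le> g y" for i
      using b N[of "i+N"] by (intro AE_I2) (auto simp: dist_commute)
  qed (use g meas in auto)
  then show "((\<lambda>x. \<integral>y. F x y \<partial>M) \<circ> X) \<longlonglongrightarrow> (\<integral>y. F x0 y \<partial>M)"
    unfolding o_def by (rule LIMSEQ_offset)
qed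

text \<open>Matching values and slopes at the seam allow gluing. Two constructions rest on it: a
  power continued by its Taylor polynomial, and an exponential remainder continued by zero.\<close>

lemma DERIV_If_le:
  fixes f g :: "real \<Rightarrow> real"
  assumes f: "\<And>x. x \<le> c \<Longrightarrow> (f has_real_derivative f' x) (at x)"
    and g: "\<And>x. x \<ge> c \<Longrightarrow> (g has_real_derivative g' x) (at x)"
    and eq: "f c = g c" "f' c = g' c"
  shows "((\<lambda>x. if x \<le> c then f x else g x) has_real_derivative (if x \<le> c then f' x else g' x)) (at x)"
proof -
  have "((\<lambda>x. if x \<in> {..c} then f x else g x) has_vector_derivative (if x \<in> {..c} then f' x else g' x)) (at x within UNIV)"
  proof (rule has_vector_derivative_If_within_closures[of x "{..c}" "{c<..}"])
    show "x \<in> {..c} \<union> closure {..c} \<inter> closure {c<..} \<Longrightarrow> (f has_vector_derivative f' x) (at x within {..c} \<union> closure {..c} \<inter> closure {c<..})"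
      by (rule has_vector_derivative_at_within[OF f[unfolded has_real_derivative_iff_has_vector_derivative]]) auto
    show "x \<in> {c<..} \<union> closure {..c} \<inter> closure {c<..} \<Longrightarrow> (g has_vector_derivative g' x) (at x within {c<..} \<union> closure {..c} \<inter> closure {c<..})"
      by (rule has_vector_derivative_at_within[OF g[unfolded has_real_derivative_iff_has_vector_derivative]]) auto
  qed (use eq in auto)
  then show ?thesis by (simp add: has_real_derivative_iff_has_vector_derivative)
qed

subsection \<open>Functions of class \<open>C^k\<close>\<close>

lemma partial_derivative_eqI:
  "((\<lambda>t. f (x + t *\<^sub>R axis i 1)) has_real_derivative D) (at 0) \<Longrightarrow> partial_derivative i f x = D"
  unfolding partial_derivative_def by (rule DERIV_imp_deriv)

lemma has_partial_derivatives_DERIV: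
  assumes "has_partial_derivatives f"
  shows "((\<lambda>t. f (x + t *\<^sub>R axis i 1)) has_real_derivative partial_derivative i f (x + t *\<^sub>R axis i 1)) (at t)"
proof -
  have "(\<lambda>s. f (x + t *\<^sub>R axis i 1 + s *\<^sub>R axis i 1)) differentiable (at 0)"
    using assms unfolding has_partial_derivatives_def by blast
  then have "((\<lambda>s. f (x + t *\<^sub>R axis i 1 + s *\<^sub>R axis i 1)) has_real_derivative
      partial_derivative i f (x + t *\<^sub>R axis i 1)) (at 0)"
    unfolding partial_derivative_def by (metis DERIV_deriv_iff_real_differentiable)
  then have "((\<lambda>s. f (x + (s + t) *\<^sub>R axis i 1)) has_real_derivative
      partial_derivative i f (x + t *\<^sub>R axis i 1)) (at 0)"
    by (simp add: algebra_simps)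
  then show ?thesis
    using DERIV_shift[of "\<lambda>s. f (x + s *\<^sub>R axis i 1)" "partial_derivative i f (x + t *\<^sub>R axis i 1)" 0 t] by simp
qed

lemma has_partial_derivativesI:
  "(\<And>i x. ((\<lambda>t. f (x + t *\<^sub>R axis i 1)) has_real_derivative D i x) (at 0)) \<Longrightarrow> has_partial_derivatives f"
  unfolding has_partial_derivatives_def by (meson real_differentiable_def)

lemma iterated_partial_Cons: "iterated_partial (i # is) f = partial_derivative i (iterated_partial is f)"
  by (simp add: iterated_partial_def)

lemma iterated_partial_Nil [simp]: "iterated_partial [] f = f"
  by (simp add: iterated_partial_def)

lemma iterated_partial_snoc: "iterated_partial (is @ [i]) f = iterated_partial is (partial_derivative i f)"
  by (simp add: iterated_partial_def)

lemma C_k_0: "f \<in> C_k 0 \<longleftrightarrow> continuous_on UNIV f"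
  by (simp add: C_k_def)

text \<open>The last entry of an index list is the derivative taken first, so lists are split at
  their end and the remaining ones apply to \<open>partial_derivative i f\<close>.\<close>

lemma C_k_Suc:
  "f \<in> C_k (Suc k) \<longleftrightarrow> continuous_on UNIV f \<and> has_partial_derivatives f \<and> (\<forall>i. partial_derivative i f \<in> C_k k)"
proof (intro iffI conjI allI)
  assume f: "f \<in> C_k (Suc k)"
  show "continuous_on UNIV f" using f by (auto simp: C_k_def dest: spec[of _ "[]"])
  show "has_partial_derivatives f" using f by (auto simp: C_k_def dest: spec[of _ "[]"])
  show "partial_derivative i f \<in> C_k k" for i
    using f by (auto simp: C_k_def iterated_partial_snoc[symmetric])
next
  assume R: "continuous_on UNIV f \<and> has_partial_derivatives f \<and> (\<forall>i. partial_derivative i f \<in> C_k k)"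
  show "f \<in> C_k (Suc k)"
    unfolding C_k_def
  proof (intro CollectI conjI allI impI)
    fix "is" :: "'a list" assume "length is < Suc k"
    then show "has_partial_derivatives (iterated_partial is f)"
      using R by (cases "is" rule: rev_cases) (auto simp: iterated_partial_snoc C_k_def)
  next
    fix "is" :: "'a list" assume "length is \<le> Suc k"
    then show "continuous_on UNIV (iterated_partial is f)"
      using R by (cases "is" rule: rev_cases) (auto simp: iterated_partial_snoc C_k_def)
  qed
qed

text \<open>Regularity by closure: a family of continuous functions in which each partial derivative
  is again a member, at the price of one order. For the integral operators below the family consists
  of integrals of the same shape, with the derivative moved onto one factor.\<close>

lemma C_k_coinduct:
  assumes "P k f"
    and "\<And>k f. P k f \<Longrightarrow> continuous_on UNIV f"
    and "\<And>k f. P (Suc k) f \<Longrightarrow> has_partial_derivatives f \<and> (\<forall>i. P k (partial_derivative i f))"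
  shows "f \<in> C_k k"
  using assms(1)
proof (induction k arbitrary: f)
  case 0 then show ?case using assms(2) by (auto simp: C_k_0)
next
  case (Suc k) then show ?case using assms(2,3) by (auto simp: C_k_Suc)
qed

lemma C_k_mono: "f \<in> C_k k \<Longrightarrow> j \<le> k \<Longrightarrow> f \<in> C_k j"
  unfolding C_k_def by auto

lemma C_k_continuous: "f \<in> C_k k \<Longrightarrow> continuous_on UNIV f"
  using C_k_mono[of f k 0] by (simp add: C_k_0)

lemma C_k_DERIV:
  assumes "f \<in> C_k (Suc k)"
  shows "((\<lambda>t. f (x + t *\<^sub>R axis i 1)) has_real_derivative partial_derivative i f (x + t *\<^sub>R axis i 1)) (at t)"
    and "((\<lambda>t. f (x + t *\<^sub>R axis i 1)) has_real_derivative partial_derivative i f x) (at 0)"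
  using has_partial_derivatives_DERIV[of f x i t] has_partial_derivatives_DERIV[of f x i 0] assms
  by (auto simp: C_k_Suc)

lemma partial_derivative_add:
  assumes "f \<in> C_k (Suc 0)" "g \<in> C_k (Suc 0)"
  shows "partial_derivative i (\<lambda>x. f x + g x) = (\<lambda>x. partial_derivative i f x + partial_derivative i g x)"
  by (rule ext, rule partial_derivative_eqI, intro DERIV_add C_k_DERIV(2)[OF assms(1)] C_k_DERIV(2)[OF assms(2)])

lemma partial_derivative_cmult:
  assumes "f \<in> C_k (Suc 0)"
  shows "partial_derivative i (\<lambda>x. c * f x) = (\<lambda>x. c * partial_derivative i f x)"
  by (rule ext, rule partial_derivative_eqI, intro DERIV_cmult C_k_DERIV(2)[OF assms(1)])

lemma C_k_add: "f \<in> C_k k \<Longrightarrow> g \<in> C_k k \<Longrightarrow> (\<lambda>x. f x + g x) \<in> C_k k"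
proof (induction k arbitrary: f g)
  case 0 then show ?case by (auto simp: C_k_0 intro!: continuous_intros)
next
  case (Suc k)
  have 1: "f \<in> C_k (Suc 0)" "g \<in> C_k (Suc 0)" using Suc.prems by (auto intro: C_k_mono)
  have "has_partial_derivatives (\<lambda>x. f x + g x)"
    by (rule has_partial_derivativesI, rule DERIV_add[OF C_k_DERIV(2)[OF 1(1)] C_k_DERIV(2)[OF 1(2)]])
  with Suc 1 show ?case by (auto simp: C_k_Suc partial_derivative_add intro: continuous_on_add)
qed

lemma C_k_cmult: "f \<in> C_k k \<Longrightarrow> (\<lambda>x. c * f x) \<in> C_k k"
proof (induction k arbitrary: f)
  case 0 then show ?case by (auto simp: C_k_0 intro!: continuous_intros)
next
  case (Suc k)
  have 1: "f \<in> C_k (Suc 0)" using Suc.prems by (auto intro: C_k_mono)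
  have "has_partial_derivatives (\<lambda>x. c * f x)"
    by (rule has_partial_derivativesI, rule DERIV_cmult[OF C_k_DERIV(2)[OF 1]])
  with Suc 1 show ?case by (auto simp: C_k_Suc partial_derivative_cmult intro: continuous_on_mult_left)
qed

lemma C_k_sum: "(\<And>i. i \<in> I \<Longrightarrow> f i \<in> C_k k) \<Longrightarrow> (\<lambda>x. \<Sum>i\<in>I. f i x) \<in> C_k k"
proof (induction I rule: infinite_finite_induct)
  case (insert i I) then show ?case by (auto intro: C_k_add)
next
  case empty
  show ?case by (rule C_k_coinduct[where P="\<lambda>k f. f = (\<lambda>x. 0)"])
    (auto simp: fun_eq_iff intro!: partial_derivative_eqI has_partial_derivativesI[where D="\<lambda>_ _. 0"])
next
  case (infinite I)
  show ?case by (rule C_k_coinduct[where P="\<lambda>k f. f = (\<lambda>x. 0)"])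
    (auto simp: infinite fun_eq_iff intro!: partial_derivative_eqI has_partial_derivativesI[where D="\<lambda>_ _. 0"])
qed

lemma neg_laplacian_C_k: "f \<in> C_k (k + 2) \<Longrightarrow> neg_laplacian f \<in> C_k k"
  using C_k_cmult[OF C_k_sum[of UNIV "\<lambda>i. partial_derivative i (partial_derivative i f)" k], of "-1"]
  by (auto simp: neg_laplacian_def laplacian_def C_k_Suc)

lemma neg_laplacian_power_C_k: "f \<in> C_k (k + 2 * m) \<Longrightarrow> (neg_laplacian ^^ m) f \<in> C_k k"
proof (induction m arbitrary: k)
  case (Suc m)
  then have "(neg_laplacian ^^ m) f \<in> C_k (k + 2)" by (simp add: algebra_simps)
  then show ?case by (simp add: neg_laplacian_C_k)
qed simp

text \<open>Move from \<open>x\<close> to \<open>x + h\<close> along the coordinate directions one at a time.\<close>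

lemma C_1_has_derivative:
  fixes f :: "real^'n::finite \<Rightarrow> real"
  assumes f: "f \<in> C_k (Suc 0)"
  shows "(f has_derivative (\<lambda>h. \<Sum>i\<in>UNIV. partial_derivative i f x * h $ i)) (at x)"
  unfolding has_derivative_at_alt
proof (intro conjI allI impI)
  show "bounded_linear (\<lambda>h. \<Sum>i\<in>UNIV. partial_derivative i f x * h $ i)"
    by (intro bounded_linear_sum bounded_linear_mult_const bounded_linear_const_mult bounded_linear_vec_nth)
next
  fix e :: real assume e: "e > 0"
  define n where "n = real CARD('n)"
  have n: "n > 0" by (simp add: n_def)
  have cont: "isCont (partial_derivative i f) x" for i
    using f by (auto simp: C_k_Suc C_k_0 continuous_on_eq_continuous_at)
  have "\<exists>d>0. \<forall>z. dist z x < d \<longrightarrow> \<bar>partial_derivative i f z - partial_derivative i f x\<bar> < e / n" for i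
    using cont[of i] e n unfolding continuous_at_eps_delta by (metis divide_pos_pos dist_real_def)
  then obtain d where d: "\<And>i. d i > 0"
    "\<And>i z. dist z x < d i \<Longrightarrow> \<bar>partial_derivative i f z - partial_derivative i f x\<bar> < e / n" by metis
  define d0 where "d0 = Min (range d)"
  have d0: "d0 > 0" "\<And>i. d0 \<le> d i" using d(1) by (auto simp: d0_def)
  show "\<exists>d>0. \<forall>y. norm (y - x) < d \<longrightarrow>
     norm (f y - f x - (\<Sum>i\<in>UNIV. partial_derivative i f x * (y - x) $ i)) \<le> e * norm (y - x)"
  proof (intro exI[of _ d0] conjI allI impI)
    fix y assume y: "norm (y - x) < d0"
    define h where "h = y - x"
    define r where "r S = (\<chi> j. if j \<in> S then h $ j else 0)" for S
    have "\<bar>f (x + r S) - f x - (\<Sum>i\<in>S. partial_derivative i f x * h $ i)\<bar> \<le> (\<Sum>i\<in>S. e / n * norm h)" for S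
    proof (induction S rule: infinite_finite_induct)
      case (insert i S)
      have eq: "r (insert i S) = r S + (h $ i) *\<^sub>R axis i 1"
        using insert.hyps by (auto simp: r_def vec_eq_iff axis_def)
      have "\<bar>f (x + r S + (h $ i) *\<^sub>R axis i 1) - partial_derivative i f x * (h $ i) - (f (x + r S + 0 *\<^sub>R axis i 1) - partial_derivative i f x * 0)\<bar>
          \<le> e / n * \<bar>h $ i - 0\<bar>"
      proof (rule field_differentiable_bound[of "closed_segment 0 (h $ i)" "\<lambda>t. f (x + r S + t *\<^sub>R axis i 1) - partial_derivative i f x * t"
           "\<lambda>t. partial_derivative i f (x + r S + t *\<^sub>R axis i 1) - partial_derivative i f x" "e/n" "h $ i" 0, unfolded real_norm_def])
        fix t assume t: "t \<in> closed_segment 0 (h $ i)"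
        \<comment> \<open>The path does not leave the ball of radius \<open>norm h\<close> about
          \<open>x\<close>, since each coordinate of its displacement is at most that of
          \<open>h\<close> in absolute value.\<close>
        have "norm (r S + t *\<^sub>R axis i 1) \<le> norm h"
        proof (rule norm_le_componentwise_cart)
          fix j
          have "\<bar>t\<bar> \<le> \<bar>h $ i\<bar>" using t by (auto simp: closed_segment_eq_real_ivl split: if_splits)
          then show "norm ((r S + t *\<^sub>R axis i 1) $ j) \<le> norm (h $ j)"
            using insert.hyps by (auto simp: r_def axis_def)
        qed
        then have "dist (x + r S + t *\<^sub>R axis i 1) x < d i"
          using y d0(2)[of i] by (simp add: dist_norm h_def[symmetric] add.assoc)
        then show "\<bar>partial_derivative i f (x + r S + t *\<^sub>R axis i 1) - partial_derivative i f x\<bar> \<le> e / n"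
          using d(2) by force
        show "((\<lambda>t. f (x + r S + t *\<^sub>R axis i 1) - partial_derivative i f x * t) has_field_derivative
             partial_derivative i f (x + r S + t *\<^sub>R axis i 1) - partial_derivative i f x) (at t within closed_segment 0 (h $ i))"
          by (rule DERIV_subset[OF _ subset_UNIV]) (auto intro!: derivative_eq_intros C_k_DERIV(1)[OF f])
      qed auto
      also have "\<dots> \<le> e / n * norm h"
        using e n component_le_norm_cart[of h i] by (intro mult_left_mono) auto
      finally have "\<bar>f (x + r (insert i S)) - partial_derivative i f x * (h $ i) - f (x + r S)\<bar> \<le> e / n * norm h"
        unfolding eq by (simp add: add.assoc)
      moreover have "(\<Sum>j\<in>insert i S. e / n * norm h) = e / n * norm h + (\<Sum>j\<in>S. e / n * norm h)"
        "(\<Sum>j\<in>insert i S. partial_derivative j f x * h $ j) =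
          partial_derivative i f x * h $ i + (\<Sum>j\<in>S. partial_derivative j f x * h $ j)"
        by (rule sum.insert[OF insert.hyps])+
      ultimately show ?case using insert.IH by linarith
    qed (auto simp: r_def zero_vec_def[symmetric])
    from this[of UNIV] have "\<bar>f (x + r UNIV) - f x - (\<Sum>i\<in>UNIV. partial_derivative i f x * h $ i)\<bar> \<le> e * norm h"
      using n by (simp add: n_def)
    moreover have "x + r UNIV = y" by (simp add: r_def h_def vec_eq_iff)
    ultimately show "norm (f y - f x - (\<Sum>i\<in>UNIV. partial_derivative i f x * (y - x) $ i)) \<le> e * norm (y - x)"
      by (simp add: h_def)
  qed (use d0 in auto)
qed

lemma C_1_DERIV_line:
  assumes f: "f \<in> C_k (Suc 0)"
  shows "((\<lambda>s. f (x + s *\<^sub>R y)) has_real_derivative (\<Sum>i\<in>UNIV. partial_derivative i f (x + s *\<^sub>R y) * y $ i)) (at s)"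
proof -
  have "((\<lambda>s. x + s *\<^sub>R y) has_derivative (\<lambda>t. t *\<^sub>R y)) (at s)"
    by (auto intro!: derivative_eq_intros)
  note has_derivative_compose[OF this C_1_has_derivative[OF f]]
  moreover have "(\<lambda>t. \<Sum>i\<in>UNIV. partial_derivative i f (x + s *\<^sub>R y) * (t *\<^sub>R y) $ i) =
      (*) (\<Sum>i\<in>UNIV. partial_derivative i f (x + s *\<^sub>R y) * y $ i)"
    by (rule ext) (simp add: sum_distrib_right mult.assoc, simp add: mult.commute)
  ultimately show ?thesis
    by (simp add: has_field_derivative_def)
qed

subsection \<open>Second differences\<close>

text \<open>The centred second difference with the sign of the negative Laplacian. The first-order
  terms cancel, which is what makes it integrable against the singular kernel.\<close>

definition sdiff :: "(real^'n::finite \<Rightarrow> real) \<Rightarrow> real^'n \<Rightarrow> real^'n \<Rightarrow> real" where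
  "sdiff w x y = 2 * w x - w (x + y) - w (x - y)"

lemma C_1_diff_bound:
  fixes f :: "real^'n::finite \<Rightarrow> real"
  assumes f: "f \<in> C_k (Suc 0)"
    and B: "\<And>i z. z \<in> closed_segment a b \<Longrightarrow> \<bar>partial_derivative i f z\<bar> \<le> B"
  shows "\<bar>f b - f a\<bar> \<le> real CARD('n) * B * norm (b - a)"
proof -
  let ?D = "\<lambda>s. \<Sum>i\<in>UNIV. partial_derivative i f (a + s *\<^sub>R (b - a)) * (b - a) $ i"
  have "\<bar>f (a + 1 *\<^sub>R (b - a)) - f (a + 0 *\<^sub>R (b - a))\<bar> \<le> real CARD('n) * B * norm (b - a) * \<bar>1 - 0\<bar>"
  proof (rule field_differentiable_bound[where S = "{0..1}" and f' = ?D, unfolded real_norm_def])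
    fix s :: real assume s: "s \<in> {0..1}"
    show "((\<lambda>s. f (a + s *\<^sub>R (b - a))) has_field_derivative ?D s) (at s within {0..1})"
      by (rule DERIV_subset[OF C_1_DERIV_line[OF f] subset_UNIV])
    have "a + s *\<^sub>R (b - a) \<in> closed_segment a b"
      using s by (auto simp: in_segment algebra_simps intro!: exI[of _ s])
    then have b: "\<bar>partial_derivative i f (a + s *\<^sub>R (b - a))\<bar> \<le> B" for i by (rule B)
    have "\<bar>?D s\<bar> \<le> (\<Sum>i\<in>(UNIV::'n set). B * norm (b - a))"
      by (rule order_trans[OF sum_abs], rule sum_mono, unfold abs_mult, rule mult_mono)
        (use b component_le_norm_cart[of "b - a"] in \<open>auto intro: order_trans[OF abs_ge_zero b]\<close>)
    then show "\<bar>?D s\<bar> \<le> real CARD('n) * B * norm (b - a)" by (simp add: mult.assoc)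
  qed auto
  then show ?thesis by simp
qed

text \<open>Along \<open>s\<close>, the derivative of
  \<open>f (x + s *\<^sub>R y) + f (x - s *\<^sub>R y)\<close> sees the partial derivatives only
  through their differences at reflected points. Lipschitz or Hoelder continuity of the gradient
  thus gains a power of \<open>norm y\<close> over the first-order bound.\<close>

lemma sdiff_C1_bound:
  fixes f :: "real^'n::finite \<Rightarrow> real"
  assumes f: "f \<in> C_k (Suc 0)"
    and B: "\<And>i s. 0 \<le> s \<Longrightarrow> s \<le> 1 \<Longrightarrow> \<bar>partial_derivative i f (x + s *\<^sub>R y) - partial_derivative i f (x - s *\<^sub>R y)\<bar> \<le> B"
  shows "\<bar>sdiff f x y\<bar> \<le> real CARD('n) * B * norm y"
proof -
  let ?d = "\<lambda>s i. partial_derivative i f (x + s *\<^sub>R y)"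
  have D: "((\<lambda>s. f (x + s *\<^sub>R y) + f (x + (- s) *\<^sub>R y)) has_field_derivative
     (\<Sum>i\<in>UNIV. ?d s i * y $ i) + (\<Sum>i\<in>UNIV. ?d (- s) i * y $ i) * (- 1)) (at s within {0..1})" for s
  proof (rule DERIV_subset[OF _ subset_UNIV], rule DERIV_add[OF C_1_DERIV_line[OF f]])
    show "((\<lambda>s. f (x + (- s) *\<^sub>R y)) has_real_derivative (\<Sum>i\<in>UNIV. ?d (- s) i * y $ i) * (- 1)) (at s)"
      using DERIV_chain[OF C_1_DERIV_line[OF f, of x y "- s"] DERIV_minus[OF DERIV_ident, of s UNIV]]
      by (simp add: o_def)
  qed
  have "\<bar>(f (x + 1 *\<^sub>R y) + f (x + (- 1) *\<^sub>R y)) - (f (x + 0 *\<^sub>R y) + f (x + (- 0) *\<^sub>R y))\<bar>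
      \<le> real CARD('n) * B * norm y * \<bar>1 - 0\<bar>"
  proof (rule field_differentiable_bound[OF _ D, unfolded real_norm_def])
    fix s :: real assume s: "s \<in> {0..1}"
    have eq: "(\<Sum>i\<in>UNIV. ?d s i * y $ i) + (\<Sum>i\<in>UNIV. ?d (- s) i * y $ i) * (- 1)
        = (\<Sum>i\<in>UNIV. (?d s i - ?d (- s) i) * y $ i)"
      by (simp add: sum_subtractf left_diff_distrib)
    have b: "\<bar>?d s i - ?d (- s) i\<bar> \<le> B" for i using B[of s i] s by simp
    have "\<bar>\<Sum>i\<in>UNIV. (?d s i - ?d (- s) i) * y $ i\<bar> \<le> (\<Sum>i\<in>(UNIV::'n set). B * norm y)"
      by (rule order_trans[OF sum_abs], rule sum_mono, unfold abs_mult, rule mult_mono)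
        (use b component_le_norm_cart[of y] in \<open>auto intro: order_trans[OF abs_ge_zero b]\<close>)
    then show "\<bar>(\<Sum>i\<in>UNIV. ?d s i * y $ i) + (\<Sum>i\<in>UNIV. ?d (- s) i * y $ i) * (- 1)\<bar> \<le> real CARD('n) * B * norm y"
      unfolding eq by (simp add: mult.assoc)
  qed auto
  then show ?thesis by (simp add: sdiff_def abs_minus_commute algebra_simps)
qed

text \<open>The mean value inequality for the gradient is inserted into
  \<open>sdiff_C1_bound\<close>; reflected points lie at most \<open>2 * norm y\<close> apart, hence
  the factor 2.\<close>

lemma sdiff_C2_bound:
  fixes f :: "real^'n::finite \<Rightarrow> real"
  assumes f: "f \<in> C_k (Suc (Suc 0))"
    and B: "\<And>i j z. norm (z - x) \<le> norm y \<Longrightarrow> \<bar>partial_derivative i (partial_derivative j f) z\<bar> \<le> B"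
  shows "\<bar>sdiff f x y\<bar> \<le> 2 * (real CARD('n))\<^sup>2 * B * (norm y)\<^sup>2"
proof -
  have B0: "B \<ge> 0" using B[of x] abs_ge_zero order_trans by (metis cancel_comm_monoid_add_class.diff_cancel norm_ge_zero norm_zero)
  have f1: "f \<in> C_k (Suc 0)" and df: "partial_derivative j f \<in> C_k (Suc 0)" for j
    using f C_k_mono[OF f] by (auto simp: C_k_Suc C_k_0)
  have "\<bar>sdiff f x y\<bar> \<le> real CARD('n) * (real CARD('n) * B * (2 * norm y)) * norm y"
  proof (rule sdiff_C1_bound[OF f1])
    fix j and s :: real assume s: "0 \<le> s" "s \<le> 1"
    have ns: "norm (s *\<^sub>R y) \<le> norm y" using s by (simp add: mult_left_le_one_le)
    have "\<bar>partial_derivative j f (x + s *\<^sub>R y) - partial_derivative j f (x - s *\<^sub>R y)\<bar>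
        \<le> real CARD('n) * B * norm (x + s *\<^sub>R y - (x - s *\<^sub>R y))"
    proof (rule C_1_diff_bound[OF df])
      fix i z assume "z \<in> closed_segment (x - s *\<^sub>R y) (x + s *\<^sub>R y)"
      moreover have "closed_segment (x - s *\<^sub>R y) (x + s *\<^sub>R y) \<subseteq> cball x (norm y)"
        using ns by (intro closed_segment_subset) (auto simp: dist_norm)
      ultimately show "\<bar>partial_derivative i (partial_derivative j f) z\<bar> \<le> B"
        by (intro B) (auto simp: dist_norm norm_minus_commute)
    qed
    also have "x + s *\<^sub>R y - (x - s *\<^sub>R y) = 2 *\<^sub>R (s *\<^sub>R y)"
      unfolding scaleR_2 by simp
    also have "real CARD('n) * B * norm (2 *\<^sub>R (s *\<^sub>R y)) \<le> real CARD('n) * B * (2 * norm y)"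
      using ns B0 by (intro mult_left_mono) auto
    finally show "\<bar>partial_derivative j f (x + s *\<^sub>R y) - partial_derivative j f (x - s *\<^sub>R y)\<bar> \<le> real CARD('n) * B * (2 * norm y)" .
  qed
  then show ?thesis by (simp add: power2_eq_square algebra_simps)
qed

lemma continuous_sdiff:
  assumes "continuous_on UNIV w" "continuous_on UNIV f" "continuous_on UNIV g"
  shows "continuous_on UNIV (\<lambda>z. sdiff w (f z) (g z))"
  unfolding sdiff_def
  by (intro continuous_intros continuous_on_compose2[OF assms(1)] assms(2,3)) auto

lemma sdiff_measurable [measurable]:
  assumes [measurable]: "w \<in> borel_measurable borel" "f \<in> borel_measurable M" "g \<in> borel_measurable M"
  shows "(\<lambda>z. sdiff w (f z) (g z)) \<in> borel_measurable M"
  unfolding sdiff_def by measurable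

subsection \<open>Invariance of Lebesgue measure\<close>

lemma lborel_distr_affine:
  fixes a :: "'a::euclidean_space"
  assumes "\<bar>c\<bar> = 1"
  shows "distr lborel borel (\<lambda>x. a + c *\<^sub>R x) = lborel"
  using lborel_affine[of c a] assms by (auto simp: density_1)

lemma
  fixes f :: "'a::euclidean_space \<Rightarrow> real"
  assumes f: "f \<in> borel_measurable borel" and c: "\<bar>c\<bar> = 1"
  shows integral_lborel_affine: "(\<integral>x. f (a + c *\<^sub>R x) \<partial>lborel) = (\<integral>x. f x \<partial>lborel)"
    and integrable_lborel_affine: "integrable lborel (\<lambda>x. f (a + c *\<^sub>R x)) \<longleftrightarrow> integrable lborel f"
proof -
  have "(\<integral>x. f x \<partial>lborel) = (\<integral>x. f x \<partial>distr lborel borel (\<lambda>x. a + c *\<^sub>R x))"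
    by (simp add: lborel_distr_affine[OF c])
  also have "\<dots> = (\<integral>x. f (a + c *\<^sub>R x) \<partial>lborel)" using f by (subst integral_distr) auto
  finally show "(\<integral>x. f (a + c *\<^sub>R x) \<partial>lborel) = (\<integral>x. f x \<partial>lborel)" by simp
  have "integrable lborel f \<longleftrightarrow> integrable (distr lborel borel (\<lambda>x. a + c *\<^sub>R x)) f"
    by (simp add: lborel_distr_affine[OF c])
  also have "\<dots> \<longleftrightarrow> integrable lborel (\<lambda>x. f (a + c *\<^sub>R x))" using f by (subst integrable_distr_eq) auto
  finally show "integrable lborel (\<lambda>x. f (a + c *\<^sub>R x)) \<longleftrightarrow> integrable lborel f" by simp
qed

lemma
  fixes f :: "'a::euclidean_space \<Rightarrow> real"
  assumes f: "f \<in> borel_measurable borel"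
  shows integral_lborel_add: "(\<integral>x. f (x + a) \<partial>lborel) = (\<integral>x. f x \<partial>lborel)"
    and integral_lborel_sub: "(\<integral>x. f (a - x) \<partial>lborel) = (\<integral>x. f x \<partial>lborel)"
    and integrable_lborel_add: "integrable lborel (\<lambda>x. f (x + a)) \<longleftrightarrow> integrable lborel f"
    and integrable_lborel_sub: "integrable lborel (\<lambda>x. f (a - x)) \<longleftrightarrow> integrable lborel f"
  using integral_lborel_affine[OF f, of 1 a] integral_lborel_affine[OF f, of "-1" a]
    integrable_lborel_affine[OF f, of 1 a] integrable_lborel_affine[OF f, of "-1" a]
  by (simp_all add: add.commute)

lemma
  fixes f :: "'a::euclidean_space \<Rightarrow> real"
  assumes f: "f \<in> borel_measurable borel" and c: "c > 0"
  shows integral_lborel_scale: "(\<integral>x. f (c *\<^sub>R x) \<partial>lborel) = (\<integral>x. f x \<partial>lborel) / c ^ DIM('a)"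
    and integrable_lborel_scale: "integrable lborel (\<lambda>x. f (c *\<^sub>R x)) \<longleftrightarrow> integrable lborel f"
proof -
  have [measurable]: "f \<in> borel_measurable borel" by fact
  have L: "lborel = density (distr lborel borel (\<lambda>x::'a. c *\<^sub>R x)) (\<lambda>_. ennreal (c ^ DIM('a)))"
    using lborel_affine[of c "0::'a"] c by simp
  have "(\<integral>x. f x \<partial>lborel) = c ^ DIM('a) * (\<integral>x. f (c *\<^sub>R x) \<partial>lborel)"
    by (subst L, subst integral_density) (use c in \<open>auto simp: integral_distr\<close>)
  then show "(\<integral>x. f (c *\<^sub>R x) \<partial>lborel) = (\<integral>x. f x \<partial>lborel) / c ^ DIM('a)"
    using c by (simp add: field_simps)
  have "integrable lborel f \<longleftrightarrow> integrable lborel (\<lambda>x. c ^ DIM('a) * f (c *\<^sub>R x))"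
    by (subst L, subst integrable_density) (use c in \<open>auto simp: integrable_distr_eq\<close>)
  then show "integrable lborel (\<lambda>x. f (c *\<^sub>R x)) \<longleftrightarrow> integrable lborel f"
    using c by (simp add: integrable_mult_right_iff)
qed

text \<open>An integrable majorant of the inner \<open>L^1\<close> norms gives integrability on the
  product. This is the form in which all exchanges of integrals below are justified.\<close>

lemma lborel_Fubini_dominated:
  fixes f :: "'a::euclidean_space \<Rightarrow> 'b::euclidean_space \<Rightarrow> real"
  assumes meas: "(\<lambda>(x, y). f x y) \<in> borel_measurable (lborel \<Otimes>\<^sub>M lborel)"
    and int: "\<And>x. integrable lborel (f x)"
    and dom: "\<And>x. (\<integral>y. \<bar>f x y\<bar> \<partial>lborel) \<le> g x" and g: "integrable lborel g"
  shows "(\<integral>x. (\<integral>y. f x y \<partial>lborel) \<partial>lborel) = (\<integral>y. (\<integral>x. f x y \<partial>lborel) \<partial>lborel)"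
    and "integrable lborel (\<lambda>x. \<integral>y. f x y \<partial>lborel)"
    and "AE y in lborel. integrable lborel (\<lambda>x. f x y)"
    and "integrable lborel (\<lambda>y. \<integral>x. f x y \<partial>lborel)"
proof -
  have m: "(\<lambda>x. \<integral>y. \<bar>f x y\<bar> \<partial>lborel) \<in> borel_measurable lborel"
    by (rule lborel.borel_measurable_lebesgue_integral) (use meas in measurable)
  have "integrable (lborel \<Otimes>\<^sub>M lborel) (\<lambda>(x, y). f x y)"
  proof (rule lborel_pair.Fubini_integrable[OF meas])
    show "integrable lborel (\<lambda>x. \<integral>y. norm (case (x, y) of (x, y) \<Rightarrow> f x y) \<partial>lborel)"
      by (rule Bochner_Integration.integrable_bound[OF g])
        (use m dom in \<open>auto intro!: AE_I2 order_trans[OF dom]\<close>)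
  qed (use int in auto)
  from lborel_pair.Fubini_integral[OF this] lborel_pair.integrable_fst[OF this]
    lborel_pair.AE_integrable_snd[OF this] lborel_pair.integrable_snd[OF this]
  show "(\<integral>x. (\<integral>y. f x y \<partial>lborel) \<partial>lborel) = (\<integral>y. (\<integral>x. f x y \<partial>lborel) \<partial>lborel)"
    and "integrable lborel (\<lambda>x. \<integral>y. f x y \<partial>lborel)"
    and "AE y in lborel. integrable lborel (\<lambda>x. f x y)"
    and "integrable lborel (\<lambda>y. \<integral>x. f x y \<partial>lborel)" by auto
qed

subsection \<open>Gaussian integrals\<close>

lemma integrable_exp_neg_square:
  fixes l :: real assumes l: "l > 0"
  shows "integrable lborel (\<lambda>t::real. exp (- l * t\<^sup>2))"
proof -
  \<comment> \<open>The standard deviation for which the centred normal density is a multiple of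
    \<open>exp (- l * t^2)\<close>.\<close>
  define s where "s = sqrt (1 / (2 * l))"
  have s: "2 * s\<^sup>2 = 1 / l" using l by (simp add: s_def)
  have "s > 0" using l by (simp add: s_def)
  then have "integrable lborel (\<lambda>t. sqrt (2 * pi * s\<^sup>2) * normal_density 0 s t)" by simp
  moreover have "sqrt (2 * pi * s\<^sup>2) > 0" using l by (simp add: s_def)
  ultimately show ?thesis
    using l s \<open>s > 0\<close> by (simp add: normal_density_def mult.commute)
qed

lemma integrable_gaussian:
  fixes l :: real assumes l: "l > 0"
  shows "integrable lborel (\<lambda>x::real^'n::finite. exp (- l * (norm x)\<^sup>2))"
proof (rule integrableI_nonneg)
  have "- l * (norm x)\<^sup>2 = (\<Sum>b\<in>Basis. - l * (x \<bullet> b)\<^sup>2)" for x :: "real^'n"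
    unfolding power2_norm_eq_inner sum_distrib_left[symmetric] by (subst euclidean_inner) (simp add: power2_eq_square)
  then have "ennreal (exp (- l * (norm x)\<^sup>2)) = (\<Prod>b\<in>Basis. ennreal (exp (- l * (x \<bullet> b)\<^sup>2)))" for x :: "real^'n"
    by (subst prod_ennreal) (simp_all add: exp_sum)
  then have "(\<integral>\<^sup>+x. ennreal (exp (- l * (norm (x::real^'n))\<^sup>2)) \<partial>lborel)
      = (\<Prod>b\<in>(Basis::(real^'n) set). \<integral>\<^sup>+t. ennreal (exp (- l * t\<^sup>2)) \<partial>lborel)"
    by (simp only:) (rule nn_integral_lborel_prod; simp)
  also have "\<dots> < \<infinity>"
    using integrable_exp_neg_square[OF l]
    by (auto simp: nn_integral_eq_integral ennreal_power)
  finally show "(\<integral>\<^sup>+x. ennreal (exp (- l * (norm (x::real^'n))\<^sup>2)) \<partial>lborel) < \<infinity>" .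
qed auto

text \<open>The constant comes from \<open>ln (1 + r) \<le> r\<close> and completing the square in
  \<open>\<bar>b\<bar> * r - l * r^2\<close>.\<close>

lemma powr_mult_gaussian_bound:
  fixes l b :: real assumes "l > 0"
  shows "\<exists>C>0. \<forall>r\<ge>0. (1 + r) powr b * exp (- l * r\<^sup>2) \<le> C"
proof (intro exI[of _ "exp (b\<^sup>2 / (4 * l))"] conjI allI impI)
  fix r :: real assume r: "r \<ge> 0"
  have "b * ln (1 + r) \<le> \<bar>b\<bar> * r"
    using r ln_add_one_self_le_self[of r] by (smt (verit, best) ln_ge_zero mult_mono mult_right_mono abs_ge_self)
  moreover have "\<bar>b\<bar> * r - l * r\<^sup>2 \<le> b\<^sup>2 / (4 * l)"
  proof -
    have "0 \<le> (2 * l * r - \<bar>b\<bar>)\<^sup>2" by simp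
    then have "4 * l * (\<bar>b\<bar> * r - l * r\<^sup>2) \<le> b\<^sup>2" by (simp add: power2_eq_square algebra_simps)
    then show ?thesis using assms by (simp add: field_simps)
  qed
  ultimately show "(1 + r) powr b * exp (- l * r\<^sup>2) \<le> exp (b\<^sup>2 / (4 * l))"
    using r by (simp add: powr_def exp_add[symmetric])
qed auto

text \<open>Half of the Gaussian exponent absorbs the polynomial weight, the other half remains
  integrable.\<close>

lemma integrable_powr_mult_gaussian:
  fixes l b :: real assumes l: "l > 0"
  shows "integrable lborel (\<lambda>x::real^'n::finite. (1 + norm x) powr b * exp (- l * (norm x)\<^sup>2))"
proof -
  obtain C where C: "C > 0" "\<And>r. r \<ge> 0 \<Longrightarrow> (1 + r) powr b * exp (- (l/2) * r\<^sup>2) \<le> C"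
    using powr_mult_gaussian_bound[of "l/2" b] l by auto
  show ?thesis
  proof (rule Bochner_Integration.integrable_bound)
    show "integrable lborel (\<lambda>x::real^'n. C * exp (- (l/2) * (norm x)\<^sup>2))"
      using integrable_gaussian[of "l/2"] l by (intro integrable_mult_right) auto
    have "(1 + norm x) powr b * exp (- l * (norm x)\<^sup>2) \<le> C * exp (- (l/2) * (norm x)\<^sup>2)" for x :: "real^'n"
    proof -
      have "exp (- l * (norm x)\<^sup>2) = exp (- (l/2) * (norm x)\<^sup>2) * exp (- (l/2) * (norm x)\<^sup>2)"
        by (simp add: exp_add[symmetric] field_simps)
      then show ?thesis using mult_right_mono[OF C(2)[of "norm x"], of "exp (- (l/2) * (norm x)\<^sup>2)"]
        by (simp add: mult.assoc)
    qed
    then show "AE x in lborel. norm ((1 + norm (x::real^'n)) powr b * exp (- l * (norm x)\<^sup>2)) \<le> norm (C * exp (- (l/2) * (norm x)\<^sup>2))"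
      using C by (intro AE_I2) (auto simp: abs_mult)
  qed measurable
qed

lemma integrable_norm_square_mult_gaussian:
  fixes l :: real assumes l: "l > 0"
  shows "integrable lborel (\<lambda>x::real^'n::finite. (norm x)\<^sup>2 * exp (- l * (norm x)\<^sup>2))"
proof (rule Bochner_Integration.integrable_bound[OF integrable_powr_mult_gaussian[OF l, of 2]])
  have "(norm x)\<^sup>2 \<le> (1 + norm x) powr 2" for x :: "real^'n"
    by (subst powr_numeral) (auto intro: power_mono)
  then show "AE x in lborel. norm ((norm (x::real^'n))\<^sup>2 * exp (- l * (norm x)\<^sup>2)) \<le> norm ((1 + norm x) powr 2 * exp (- l * (norm x)\<^sup>2))"
    by (intro AE_I2) (auto simp: abs_mult intro!: mult_right_mono)
qed measurable

section \<open>Power integrals on the half-line and the subordination integral\<close>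

lemma integrable_powr_tail:
  fixes a :: real assumes "a > 0"
  shows "integrable lborel (\<lambda>t. indicator {1<..} t * t powr (- 1 - a))"
proof -
  have "((\<lambda>t. t powr (- 1 - a)) has_integral - (1 powr (- 1 - a + 1)) / (- 1 - a + 1)) {1..}"
    using assms by (intro has_integral_powr_to_inf) auto
  then have "(\<lambda>t. t powr (- 1 - a)) absolutely_integrable_on {1..}"
    by (intro nonnegative_absolutely_integrable_1) (auto simp: integrable_on_def)
  then have "set_integrable lebesgue {1<..} (\<lambda>t. t powr (- 1 - a))"
    by (rule set_integrable_subset) auto
  then show ?thesis unfolding set_integrable_def by (simp add: integrable_completion)
qed

lemma integrable_powr_head:
  fixes a :: real assumes "a < 1"
  shows "integrable lborel (\<lambda>t. indicator {0<..1} t * t powr (- a))"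
proof -
  have "(\<lambda>t. t powr (- a)) integrable_on {0..1}"
    using assms by (intro integrable_on_powr_from_0) auto
  then have "(\<lambda>t. t powr (- a)) absolutely_integrable_on {0..1}"
    by (intro nonnegative_absolutely_integrable_1) auto
  then have "set_integrable lebesgue {0<..1} (\<lambda>t. t powr (- a))"
    by (rule set_integrable_subset) auto
  then show ?thesis unfolding set_integrable_def by (simp add: integrable_completion)
qed

text \<open>The time integral that remains in \<open>integrable_min_riesz_ker\<close>, where
  \<open>a = \<alpha> / 2\<close>.\<close>

lemma integrable_min_powr:
  fixes a :: real assumes "0 < a" "a < 1"
  shows "integrable lborel (\<lambda>t. indicator {0<..} t * (min 1 t * t powr (- 1 - a)))"
proof (rule Bochner_Integration.integrable_bound[OF Bochner_Integration.integrable_add[OF integrable_powr_head[OF assms(2)] integrable_powr_tail[OF assms(1)]]])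
  show "AE t in lborel. norm (indicator {0<..} t * (min 1 t * t powr (- 1 - a)))
      \<le> norm (indicator {0<..1} t * t powr - a + indicator {1<..} t * t powr (- 1 - a))"
  proof (intro AE_I2)
    fix t :: real
    have "t * t powr (- 1 - a) = t powr (- a)" if "t > 0"
      using that by (simp add: powr_mult_base[symmetric] powr_diff powr_minus field_simps)
    then show "norm (indicator {0<..} t * (min 1 t * t powr (- 1 - a)))
      \<le> norm (indicator {0<..1} t * t powr - a + indicator {1<..} t * t powr (- 1 - a))"
      by (auto simp: indicator_def min_def)
  qed
qed measurable

text \<open>For \<open>b > 0\<close> this is \<open>4 powr b * Gamma b\<close>, by the substitution
  \<open>1 / (4 * t)\<close>.\<close>

definition subord_const :: "real \<Rightarrow> real" where
  "subord_const b = (\<integral>t. indicator {0<..} t * (t powr (- 1 - b) * exp (- 1 / (4 * t))) \<partial>lborel)"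

lemma integrable_subord:
  fixes b :: real
  assumes b: "b > 0"
  shows "integrable lborel (\<lambda>t. indicator {0<..} t * (t powr (- 1 - b) * exp (- 1 / (4 * t))))"
proof -
  obtain C where C: "C > 0" "\<And>r. r \<ge> 0 \<Longrightarrow> (1 + r) powr (2 * (1 + b)) * exp (- (1/4) * r\<^sup>2) \<le> C"
    using powr_mult_gaussian_bound[of "1/4" "2 * (1 + b)"] by auto
  have *: "t powr (- 1 - b) * exp (- 1 / (4 * t)) \<le> C" if t: "t > 0" for t
  proof -
    \<comment> \<open>In this variable \<open>exp (- 1 / (4 * t))\<close> is a Gaussian and
      \<open>t powr (- 1 - b)\<close> a power of \<open>r\<close>, so the integrand is bounded near
      \<open>t = 0\<close>.\<close>
    define r where "r = 1 / sqrt t"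
    have r: "r > 0" "r\<^sup>2 = 1 / t" using t by (auto simp: r_def power_divide)
    have "t powr (- 1 - b) = (r\<^sup>2) powr (1 + b)"
      unfolding r(2) using t powr_minus_divide[of t "1 + b"] by (simp add: powr_divide algebra_simps)
    also have "\<dots> = r powr (2 * (1 + b))" using r(1)
      by (simp add: powr_numeral[symmetric] powr_powr del: powr_numeral)
    also have "\<dots> \<le> (1 + r) powr (2 * (1 + b))" using r b by (intro powr_mono2) auto
    finally have "t powr (- 1 - b) * exp (- 1 / (4 * t)) \<le> (1 + r) powr (2 * (1 + b)) * exp (- (1/4) * r\<^sup>2)"
      using r(2) by (intro mult_mono) auto
    then show ?thesis using C(2)[of r] r(1) by linarith
  qed
  show ?thesis
  proof (rule Bochner_Integration.integrable_bound)
    show "integrable lborel (\<lambda>t::real. C * indicator {0<..1} t + indicator {1<..} t * t powr (- 1 - b))"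
      using b by (intro Bochner_Integration.integrable_add integrable_powr_tail integrable_mult_right) auto
    show "AE t in lborel. norm (indicator {0<..} t * (t powr (- 1 - b) * exp (- 1 / (4 * t))))
       \<le> norm (C * indicator {0<..1} t + indicator {1<..} t * t powr (- 1 - b))"
    proof (intro AE_I2)
      fix t :: real
      have "t powr (- 1 - b) * exp (- 1 / (4 * t)) \<le> t powr (- 1 - b)" if "t > 0"
        using that by (simp add: mult_left_le)
      then show "norm (indicator {0<..} t * (t powr (- 1 - b) * exp (- 1 / (4 * t))))
       \<le> norm (C * indicator {0<..1} t + indicator {1<..} t * t powr (- 1 - b))"
        using *[of t] C(1) by (auto simp: indicator_def)
    qed
  qed measurable
qed

lemma subord_const_pos: "b > 0 \<Longrightarrow> subord_const b > 0"
proof -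
  assume b: "b > 0"
  have "subord_const b \<ge> 0" unfolding subord_const_def by (intro integral_nonneg_AE AE_I2) (auto simp: indicator_def)
  moreover have "subord_const b \<noteq> 0"
  proof
    assume "subord_const b = 0"
    then have "AE t in lborel. indicator {0<..} t * (t powr (- 1 - b) * exp (- 1 / (4 * t))) = (0::real)"
      unfolding subord_const_def using integrable_subord[OF b]
      by (subst (asm) integral_nonneg_eq_0_iff_AE) (auto simp: indicator_def)
    then have "AE t::real in lborel. t \<notin> {0<..<1}"
      by eventually_elim (auto simp: indicator_def)
    then have "emeasure lborel {0<..<1::real} = 0"
      by (subst (asm) AE_iff_measurable[of "{0<..<1}"]) auto
    then show False by simp
  qed
  ultimately show ?thesis by simp
qed

text \<open>By homogeneity: the dilation of \<open>t\<close> by \<open>c = 1 / r^2\<close> reduces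
  the integral to the one for \<open>r = 1\<close>.\<close>

lemma subordination:
  fixes r b :: real
  assumes r: "r > 0" and b: "b > 0"
  shows "(\<integral>t. indicator {0<..} t * (t powr (- 1 - b) * exp (- r\<^sup>2 / (4 * t))) \<partial>lborel) = subord_const b * r powr (- 2 * b)"
    and "integrable lborel (\<lambda>t. indicator {0<..} t * (t powr (- 1 - b) * exp (- r\<^sup>2 / (4 * t))))"
proof -
  let ?f = "\<lambda>t. indicator {0<..} t * (t powr (- 1 - b) * exp (- 1 / (4 * t)))"
  define c where "c = 1 / r\<^sup>2"
  have c: "c > 0" using r by (simp add: c_def)
  have rp: "r powr (- 2 * b) * c powr (- 1 - b) * c = 1"
  proof -
    have "c = r powr (-2)" using r by (simp add: c_def powr_minus powr_numeral divide_inverse)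
    then have "r powr (- 2 * b) * c powr (- 1 - b) * c = r powr (- 2 * b) * r powr ((-2) * (- 1 - b)) * r powr (-2)"
      by (simp only: powr_powr)
    also have "\<dots> = r powr (- 2 * b + (-2) * (- 1 - b) + (-2))" by (simp only: powr_add)
    also have "- 2 * b + (-2) * (- 1 - b) + (-2) = 0" by simp
    finally show ?thesis using r by simp
  qed
  have eq: "indicator {0<..} t * (t powr (- 1 - b) * exp (- r\<^sup>2 / (4 * t))) = r powr (- 2 * b) * c * ?f (0 + c * t)" for t
  proof (cases "t > 0")
    case True
    have "(c * t) powr (- 1 - b) = c powr (- 1 - b) * t powr (- 1 - b)" using c True by (simp add: powr_mult)
    moreover have "- 1 / (4 * (c * t)) = - r\<^sup>2 / (4 * t)" using r by (simp add: c_def)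
    moreover have "0 < c * t" using c True by simp
    ultimately show ?thesis using True rp by (simp add: mult_ac)
  next
    case False
    then have "\<not> 0 < c * t" using c by (simp add: zero_less_mult_iff)
    then show ?thesis using False by simp
  qed
  have "subord_const b = \<bar>c\<bar> *\<^sub>R (\<integral>t. ?f (0 + c * t) \<partial>lborel)"
    unfolding subord_const_def using c by (intro lborel_integral_real_affine) auto
  then show "(\<integral>t. indicator {0<..} t * (t powr (- 1 - b) * exp (- r\<^sup>2 / (4 * t))) \<partial>lborel) = subord_const b * r powr (- 2 * b)"
    unfolding eq using c by (subst integral_mult_right_zero) simp
  show "integrable lborel (\<lambda>t. indicator {0<..} t * (t powr (- 1 - b) * exp (- r\<^sup>2 / (4 * t))))"
    unfolding eq using c lborel_integrable_real_affine[OF integrable_subord[OF b], of c 0]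
    by (intro integrable_mult_right) auto
qed

section \<open>The kernel of the fractional Laplacian and the heat kernel\<close>

definition riesz_ker :: "real \<Rightarrow> real^'n::finite \<Rightarrow> real" where
  "riesz_ker \<alpha> y = norm y powr (- (real CARD('n) + \<alpha>))"

lemma riesz_ker_nonneg [simp]: "riesz_ker \<alpha> y \<ge> 0"
  by (simp add: riesz_ker_def)

lemma riesz_ker_minus [simp]: "riesz_ker \<alpha> (- y) = riesz_ker \<alpha> y"
  by (simp add: riesz_ker_def)

lemma riesz_ker_measurable [measurable]: "riesz_ker \<alpha> \<in> borel_measurable borel"
  unfolding riesz_ker_def by measurable

text \<open>The Gauss-Weierstrass kernel without the factor \<open>(4 * pi) powr (- n / 2)\<close>;
  its total mass \<open>heat_mass\<close> therefore appears in the semigroup law.\<close>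

definition heat :: "real \<Rightarrow> real^'n::finite \<Rightarrow> real" where
  "heat t x = t powr (- (real CARD('n) / 2)) * exp (- (norm x)\<^sup>2 / (4 * t))"

definition heat_mass :: "'n::finite itself \<Rightarrow> real" where
  "heat_mass _ = (\<integral>x. exp (- (norm (x::real^'n))\<^sup>2 / 4) \<partial>lborel)"

lemma heat_nonneg [simp]: "heat t x \<ge> 0"
  by (simp add: heat_def)

lemma heat_measurable [measurable]:
  "(\<lambda>(t, x). heat t x) \<in> borel_measurable (borel \<Otimes>\<^sub>M borel)" "heat t \<in> borel_measurable borel"
  unfolding heat_def by measurable

lemma heat_scale: "t > 0 \<Longrightarrow> heat t (x::real^'n::finite) = t powr (- (real CARD('n) / 2)) * heat 1 ((1 / sqrt t) *\<^sub>R x)"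
  by (simp add: heat_def power_mult_distrib power_divide)

lemma integrable_heat_1: "integrable lborel (heat 1 :: real^'n::finite \<Rightarrow> real)"
  using integrable_gaussian[of "1/4", where 'n='n] by (simp add: heat_def[abs_def])

lemma powr_half_card: "t > 0 \<Longrightarrow> t powr (- (real n / 2)) = (1 / sqrt t) ^ n"
  by (simp add: powr_half_sqrt[symmetric] powr_minus powr_powr powr_realpow[symmetric] powr_divide field_simps)

lemma
  assumes t: "t > 0"
  shows integrable_heat: "integrable lborel (heat t :: real^'n::finite \<Rightarrow> real)"
    and integral_heat: "(\<integral>x. heat t (x::real^'n) \<partial>lborel) = heat_mass TYPE('n)"
proof -
  have "integrable lborel (\<lambda>x::real^'n. heat 1 ((1 / sqrt t) *\<^sub>R x))"
    using integrable_heat_1 t by (subst integrable_lborel_scale) auto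
  then show "integrable lborel (heat t :: real^'n \<Rightarrow> real)"
    using t by (simp add: heat_scale[OF t, abs_def])
  show "(\<integral>x. heat t (x::real^'n) \<partial>lborel) = heat_mass TYPE('n)"
    unfolding heat_scale[OF t] using t
    by (subst integral_mult_right_zero, subst integral_lborel_scale)
      (auto simp: powr_half_card heat_mass_def heat_def[abs_def])
qed

lemma heat_mass_pos: "heat_mass TYPE('n::finite) > 0"
proof -
  have "heat_mass TYPE('n) \<ge> 0" unfolding heat_mass_def by simp
  moreover have "heat_mass TYPE('n) \<noteq> 0"
  proof
    assume "heat_mass TYPE('n) = 0"
    then have "AE x in lborel. exp (- (norm (x::real^'n))\<^sup>2 / 4) = 0"
      unfolding heat_mass_def using integrable_heat_1[where 'n='n]
      by (subst (asm) integral_nonneg_eq_0_iff_AE) (auto simp: heat_def[abs_def])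
    then have "AE x in (lborel :: (real^'n) measure). False" by simp
    then have "emeasure (lborel :: (real^'n) measure) UNIV = 0"
      by (subst (asm) AE_iff_measurable[of UNIV]) auto
    then show False by simp
  qed
  ultimately show ?thesis by simp
qed

text \<open>Completing the square.\<close>

lemma heat_conv:
  assumes t: "t > 0" and s: "s > 0"
  shows "(\<integral>y. heat t (x + y) * heat s y \<partial>lborel) = heat_mass TYPE('n) * heat (t + s) (x::real^'n::finite)"
    and "integrable lborel (\<lambda>y::real^'n. heat t (x + y) * heat s y)"
proof -
  let ?\<nu> = "real CARD('n) / 2"
  \<comment> \<open>Reciprocal times add: \<open>1 / r = 1 / t + 1 / s\<close> is the parameter of a
    product of two Gaussians in \<open>y\<close>.\<close>
  define r where "r = t * s / (t + s)"
  have r: "r > 0" using t s by (simp add: r_def)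
  have eq: "heat t (x + y) * heat s y = heat (t + s) x * heat r (y + (s / (t + s)) *\<^sub>R x)" for y
  proof -
    have pw: "t powr (- ?\<nu>) * s powr (- ?\<nu>) = (t + s) powr (- ?\<nu>) * r powr (- ?\<nu>)"
      using t s by (subst (1 2) powr_mult[symmetric]) (auto simp: r_def)
    have "(norm (x + y))\<^sup>2 / (4 * t) + (norm y)\<^sup>2 / (4 * s)
      = (norm x)\<^sup>2 / (4 * (t + s)) + (norm (y + (s / (t + s)) *\<^sub>R x))\<^sup>2 / (4 * r)"
    proof -
      have ts: "t \<noteq> 0" "s \<noteq> 0" "t + s \<noteq> 0" using t s by auto
      have "(norm (y + k *\<^sub>R x))\<^sup>2 = y \<bullet> y + 2 * k * (x \<bullet> y) + k\<^sup>2 * (x \<bullet> x)" for k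
        unfolding power2_norm_eq_inner by (simp add: inner_simps power2_eq_square inner_commute algebra_simps)
      then have "(norm (y + (s / (t + s)) *\<^sub>R x))\<^sup>2 / (4 * r) =
          (y \<bullet> y + 2 * (s / (t + s)) * (x \<bullet> y) + (s / (t + s))\<^sup>2 * (x \<bullet> x)) * (t + s) / (4 * t * s)"
        by (simp add: r_def mult.assoc)
      moreover have "(norm (x + y))\<^sup>2 / (4 * t) = (x \<bullet> x + 2 * (x \<bullet> y) + y \<bullet> y) / (4 * t)"
        by (simp add: power2_norm_eq_inner inner_simps inner_commute)
      moreover have "(xx + 2 * xy + yy) / (4 * t) + yy / (4 * s) =
         xx / (4 * (t + s)) + (yy + 2 * (s / (t + s)) * xy + (s / (t + s))\<^sup>2 * xx) * (t + s) / (4 * t * s)" for xx xy yy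
        using ts by (simp add: divide_simps power2_eq_square) algebra
      ultimately show ?thesis by (simp only: power2_norm_eq_inner[of x] power2_norm_eq_inner[of y])
    qed
    then have "exp (- (norm (x + y))\<^sup>2 / (4 * t)) * exp (- (norm y)\<^sup>2 / (4 * s)) =
       exp (- (norm x)\<^sup>2 / (4 * (t + s))) * exp (- (norm (y + (s / (t + s)) *\<^sub>R x))\<^sup>2 / (4 * r))"
      unfolding exp_add[symmetric] by simp
    then have "(t powr (- ?\<nu>) * s powr (- ?\<nu>)) * (exp (- (norm (x + y))\<^sup>2 / (4 * t)) * exp (- (norm y)\<^sup>2 / (4 * s))) =
        ((t + s) powr (- ?\<nu>) * r powr (- ?\<nu>)) * (exp (- (norm x)\<^sup>2 / (4 * (t + s))) * exp (- (norm (y + (s / (t + s)) *\<^sub>R x))\<^sup>2 / (4 * r)))"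
      unfolding pw by simp
    then show ?thesis unfolding heat_def by (simp only: mult_ac)
  qed
  show "(\<integral>y. heat t (x + y) * heat s y \<partial>lborel) = heat_mass TYPE('n) * heat (t + s) (x::real^'n::finite)"
    unfolding eq using integral_heat[OF r, where 'n='n]
    by (subst integral_mult_right_zero, subst integral_lborel_add) auto
  show "integrable lborel (\<lambda>y::real^'n. heat t (x + y) * heat s y)"
    unfolding eq using integrable_heat[OF r, where 'n='n]
    by (intro integrable_mult_right, subst integrable_lborel_add) auto
qed

text \<open>The kernel is a mixture of heat kernels. The factor \<open>t powr (- n / 2)\<close> of
  \<open>heat\<close> joins the time weight and raises the exponent of \<open>subordination\<close>
  from \<open>\<alpha> / 2\<close> to \<open>\<alpha> / 2 + n / 2\<close>.\<close>

lemma heat_subordination: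
  fixes y :: "real^'n::finite"
  assumes \<alpha>: "\<alpha> > 0" and y: "y \<noteq> 0"
  shows "(\<integral>t. indicator {0<..} t * (t powr (- 1 - \<alpha> / 2) * heat t y) \<partial>lborel)
      = subord_const (\<alpha> / 2 + real CARD('n) / 2) * riesz_ker \<alpha> y"
    and "integrable lborel (\<lambda>t. indicator {0<..} t * (t powr (- 1 - \<alpha> / 2) * heat t y))"
proof -
  let ?b = "\<alpha> / 2 + real CARD('n) / 2"
  have b: "?b > 0" using \<alpha> by (simp add: add_pos_nonneg)
  have eq: "indicator {0<..} t * (t powr (- 1 - \<alpha> / 2) * heat t y) =
      indicator {0<..} t * (t powr (- 1 - ?b) * exp (- (norm y)\<^sup>2 / (4 * t)))" for t
    by (auto simp: indicator_def heat_def powr_add[symmetric] algebra_simps)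
  have k: "- 2 * ?b = - (real CARD('n) + \<alpha>)" by simp
  show "(\<integral>t. indicator {0<..} t * (t powr (- 1 - \<alpha> / 2) * heat t y) \<partial>lborel)
      = subord_const ?b * riesz_ker \<alpha> y"
    unfolding eq riesz_ker_def k[symmetric] by (rule subordination(1)) (use y b in auto)
  show "integrable lborel (\<lambda>t. indicator {0<..} t * (t powr (- 1 - \<alpha> / 2) * heat t y))"
    unfolding eq using subordination(2)[OF _ b, of "norm y"] y by simp
qed

text \<open>Polar coordinates are avoided: the kernel is written as a mixture of heat kernels and
  the spatial integral is done first. It is of order \<open>min 1 t\<close>, and this is integrable
  against \<open>t powr (- 1 - \<alpha> / 2)\<close> exactly because
  \<open>0 < \<alpha> < 2\<close>.\<close>

lemma integrable_min_riesz_ker: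
  assumes \<alpha>: "0 < \<alpha>" "\<alpha> < 2"
  shows "integrable lborel (\<lambda>y::real^'n::finite. min 1 ((norm y)\<^sup>2) * riesz_ker \<alpha> y)"
proof -
  let ?c = "subord_const (\<alpha> / 2 + real CARD('n) / 2)"
  have c: "?c > 0" using \<alpha> by (intro subord_const_pos) (simp add: add_pos_nonneg)
  define c3 where "c3 = (\<integral>y. (norm (y::real^'n))\<^sup>2 * heat 1 y \<partial>lborel)"
  define C where "C = max c3 (heat_mass TYPE('n))"
  have i3: "integrable lborel (\<lambda>y::real^'n. (norm y)\<^sup>2 * heat 1 y)"
    using integrable_norm_square_mult_gaussian[of "1/4", where 'n='n] by (simp add: heat_def)
  have i3t: "integrable lborel (\<lambda>y::real^'n. (norm y)\<^sup>2 * heat t y)"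
    and c3t: "(\<integral>y. (norm (y::real^'n))\<^sup>2 * heat t y \<partial>lborel) = t * c3" if t: "t > 0" for t
  proof -
    let ?g = "\<lambda>y::real^'n. (norm y)\<^sup>2 * heat 1 y"
    have eq: "(norm y)\<^sup>2 * heat t y = t * t powr (- (real CARD('n) / 2)) * ?g ((1 / sqrt t) *\<^sub>R y)" for y
      using t by (simp add: heat_scale[OF t, of y] power_mult_distrib power_divide)
    show "integrable lborel (\<lambda>y::real^'n. (norm y)\<^sup>2 * heat t y)"
      unfolding eq using i3 t by (intro integrable_mult_right, subst integrable_lborel_scale[of ?g]) auto
    show "(\<integral>y. (norm (y::real^'n))\<^sup>2 * heat t y \<partial>lborel) = t * c3"
      unfolding eq using t
      by (subst integral_mult_right_zero, subst integral_lborel_scale[of ?g]) (auto simp: powr_half_card c3_def)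
  qed
  let ?f = "\<lambda>t (y::real^'n). indicator {0<..} t * (t powr (- 1 - \<alpha> / 2) * (min 1 ((norm y)\<^sup>2) * heat t y))"
  have im: "integrable lborel (\<lambda>y::real^'n. min 1 ((norm y)\<^sup>2) * heat t y)" if t: "t > 0" for t
    by (rule Bochner_Integration.integrable_bound[OF integrable_heat[OF t]]) (auto simp: abs_mult mult_left_le_one_le)
  \<comment> \<open>The total mass bounds the integral for large \<open>t\<close>; for small
    \<open>t\<close> the second moment, which is proportional to \<open>t\<close>, is
    better.\<close>
  have bd: "(\<integral>y. min 1 ((norm (y::real^'n))\<^sup>2) * heat t y \<partial>lborel) \<le> C * min 1 t" if t: "t > 0" for t
  proof -
    have "(\<integral>y. min 1 ((norm (y::real^'n))\<^sup>2) * heat t y \<partial>lborel) \<le> (\<integral>y. heat t (y::real^'n) \<partial>lborel)"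
      using im[OF t] integrable_heat[OF t] by (intro integral_mono) (auto simp: mult_left_le_one_le)
    moreover have "(\<integral>y. min 1 ((norm (y::real^'n))\<^sup>2) * heat t y \<partial>lborel) \<le> (\<integral>y. (norm (y::real^'n))\<^sup>2 * heat t y \<partial>lborel)"
      using im[OF t] i3t[OF t] by (intro integral_mono) (auto intro: mult_right_mono)
    moreover have "t * c3 \<le> C * t" "heat_mass TYPE('n) \<le> C" using t by (auto simp: C_def mult.commute)
    ultimately show ?thesis using c3t[OF t] integral_heat[OF t, where 'n='n] by (auto simp: min_def)
  qed
  have fint: "integrable lborel (?f t)" for t
    using im[of t] by (cases "t > 0") auto
  have dom: "(\<integral>y. \<bar>?f t y\<bar> \<partial>lborel) \<le> C * (indicator {0<..} t * (min 1 t * t powr (- 1 - \<alpha> / 2)))" for t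
  proof (cases "t > 0")
    case True
    have "(\<integral>y. \<bar>?f t y\<bar> \<partial>lborel) = t powr (- 1 - \<alpha> / 2) * (\<integral>y. min 1 ((norm (y::real^'n))\<^sup>2) * heat t y \<partial>lborel)"
      using True by (simp add: abs_mult)
    also have "\<dots> \<le> t powr (- 1 - \<alpha> / 2) * (C * min 1 t)" using bd[OF True] by (intro mult_left_mono) auto
    finally show ?thesis using True by (simp add: mult_ac)
  qed auto
  have "integrable lborel (\<lambda>y. \<integral>t. ?f t y \<partial>lborel)"
  proof (rule lborel_Fubini_dominated(4)[OF _ fint dom])
    show "(\<lambda>(x, y). ?f x y) \<in> borel_measurable (lborel \<Otimes>\<^sub>M lborel)" by measurable
    show "integrable lborel (\<lambda>t. C * (indicator {0<..} t * (min 1 t * t powr (- 1 - \<alpha> / 2))))"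
      using \<alpha> by (intro integrable_mult_right integrable_min_powr) auto
  qed
  moreover have "(\<integral>t. ?f t y \<partial>lborel) = ?c * (min 1 ((norm y)\<^sup>2) * riesz_ker \<alpha> y)" for y
  proof (cases "y = 0")
    case False
    have "(\<integral>t. ?f t y \<partial>lborel) = (\<integral>t. min 1 ((norm y)\<^sup>2) * (indicator {0<..} t * (t powr (- 1 - \<alpha> / 2) * heat t y)) \<partial>lborel)"
      by (intro Bochner_Integration.integral_cong) (simp_all only: mult_ac)
    also have "\<dots> = min 1 ((norm y)\<^sup>2) * (?c * riesz_ker \<alpha> y)"
      by (subst integral_mult_right_zero) (simp only: heat_subordination(1)[OF \<alpha>(1) False])
    finally show ?thesis by (simp only: mult_ac)
  qed simp
  ultimately have "integrable lborel (\<lambda>y::real^'n. ?c * (min 1 ((norm y)\<^sup>2) * riesz_ker \<alpha> y))" by simp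
  then show ?thesis using c by (simp add: integrable_mult_right_iff)
qed

subsection \<open>The fractional Laplacian through second differences\<close>

text \<open>Both come from submultiplicativity of \<open>1 + norm\<close>, applied to
  \<open>x = (x + y) - y\<close> and to \<open>x + y\<close>. The first form moves the decay from
  \<open>y\<close> to \<open>x\<close> at the price of growth at \<open>x + y\<close> (for
  Gaussians, which absorb it); the second moves it to \<open>x + y\<close> at the price of growth at
  \<open>x\<close> (for \<open>u\<close>, with \<open>x\<close> bounded).\<close>

lemma Peetre:
  fixes x y :: "'a::real_normed_vector" assumes "b \<ge> 0"
  shows "(1 + norm y) powr (- b) \<le> (1 + norm x) powr (- b) * (1 + norm (x + y)) powr b"
    and "(1 + norm y) powr (- b) \<le> (1 + norm x) powr b * (1 + norm (x + y)) powr (- b)"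
proof -
  have p: "1 + norm z > 0" for z :: 'a by (simp add: add_pos_nonneg)
  have s: "(1 + norm x) powr b \<le> (1 + norm (x + y)) powr b * (1 + norm y) powr b"
  proof -
    have "norm x \<le> norm (x + y) + norm y" using norm_triangle_ineq4[of "x + y" y] by simp
    then have "1 + norm x \<le> (1 + norm (x + y)) * (1 + norm y)"
      by (simp add: algebra_simps) (smt (verit) mult_nonneg_nonneg norm_ge_zero)
    from powr_mono2[OF assms _ this] show ?thesis by (simp add: powr_mult add_nonneg_nonneg)
  qed
  have t: "(1 + norm (x + y)) powr b \<le> (1 + norm x) powr b * (1 + norm y) powr b"
  proof -
    have "1 + norm (x + y) \<le> (1 + norm x) * (1 + norm y)" using norm_triangle_ineq[of x y]
      by (simp add: algebra_simps) (smt (verit) mult_nonneg_nonneg norm_ge_zero)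
    from powr_mono2[OF assms _ this] show ?thesis by (simp add: powr_mult add_nonneg_nonneg)
  qed
  have q: "(1 + norm z) powr b > 0" for z :: 'a using p[of z] by simp
  show "(1 + norm y) powr (- b) \<le> (1 + norm x) powr (- b) * (1 + norm (x + y)) powr b"
    using s q[of x] q[of y] by (simp add: powr_minus field_simps)
  show "(1 + norm y) powr (- b) \<le> (1 + norm x) powr b * (1 + norm (x + y)) powr (- b)"
    using t q[of "x+y"] q[of y] by (simp add: powr_minus field_simps)
qed

lemma riesz_ker_le_weight:
  fixes y :: "real^'n::finite"
  assumes "norm y > 1" "\<alpha> > 0"
  shows "riesz_ker \<alpha> y \<le> 2 powr (real CARD('n) + \<alpha>) * (1 + norm y) powr (- (real CARD('n) + \<alpha>))"
proof -
  let ?b = "real CARD('n) + \<alpha>"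
  have "(1 + norm y) powr ?b \<le> (2 * norm y) powr ?b" using assms by (intro powr_mono2) auto
  also have "\<dots> = 2 powr ?b * norm y powr ?b" by (simp add: powr_mult)
  finally have 1: "(1 + norm y) powr ?b \<le> 2 powr ?b * norm y powr ?b" .
  have "(1 + norm y) powr ?b > 0" "norm y powr ?b > 0" using assms by auto
  with 1 show ?thesis unfolding riesz_ker_def powr_minus by (simp add: field_simps)
qed

abbreviation min_ker :: "real \<Rightarrow> real^'n::finite \<Rightarrow> real" where
  "min_ker \<alpha> y \<equiv> min 1 ((norm y)\<^sup>2) * riesz_ker \<alpha> y"

lemma min_ker_nonneg: "min_ker \<alpha> y \<ge> 0" by simp

text \<open>Outside the unit ball the weight lies below a kernel \<open>riesz_ker e\<close>, whose
  integrability away from the origin is known.\<close>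

lemma integrable_weight:
  assumes "b > real CARD('n)"
  shows "integrable lborel (\<lambda>x::real^'n::finite. (1 + norm x) powr (- b))"
proof -
  \<comment> \<open>The cap at 1 keeps the order \<open>e\<close> within the range
    \<open>0 < e < 2\<close> of \<open>integrable_min_riesz_ker\<close>.\<close>
  define e where "e = min (b - real CARD('n)) 1"
  have e: "0 < e" "e < 2" "real CARD('n) + e \<le> b" using assms by (auto simp: e_def)
  show ?thesis
  proof (rule Bochner_Integration.integrable_bound)
    show "integrable lborel (\<lambda>x::real^'n. min_ker e x + indicator (cball 0 1) x)"
      using integrable_min_riesz_ker[OF e(1,2), where 'n='n] by (intro Bochner_Integration.integrable_add) (auto simp: integrable_indicator_iff emeasure_bounded_finite[of "cball 0 1", simplified])
    show "AE x in lborel. norm ((1 + norm (x::real^'n)) powr (- b)) \<le> norm (min_ker e x + indicator (cball 0 1) x)"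
    proof (rule AE_I2)
      fix x :: "real^'n"
      have 1: "(1 + norm x) powr (- b) \<le> (1 + norm x) powr (- (real CARD('n) + e))"
        using e by (intro powr_mono) auto
      show "norm ((1 + norm x) powr (- b)) \<le> norm (min_ker e x + indicator (cball 0 1) x)"
      proof (cases "norm x \<le> 1")
        case True
        have "(1 + norm x) powr (- b) \<le> (1 + norm x) powr 0" using assms by (intro powr_mono) auto
        also have "\<dots> \<le> 1" by (simp add: add_nonneg_eq_0_iff)
        finally have "(1 + norm x) powr (- b) \<le> 1" .
        moreover have "min_ker e x \<ge> 0" by (rule min_ker_nonneg)
        moreover have "indicator (cball 0 1) x = (1::real)" using True by simp
        ultimately show ?thesis unfolding real_norm_def using powr_ge_zero[of "1 + norm x" "- b"] by linarith
      next
        case False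
        have "(1 + norm x) powr (- (real CARD('n) + e)) \<le> norm x powr (- (real CARD('n) + e))"
          using False e by (intro powr_mono2') auto
        moreover have "min 1 ((norm x)\<^sup>2) = 1" using False by (auto simp: min_def power_le_one_iff)
        ultimately show ?thesis using 1 False by (simp add: riesz_ker_def)
      qed
    qed
  qed measurable
qed

text \<open>The fractional Laplacian up to the factor \<open>frac_const / 2\<close>, as an
  absolutely convergent integral without a principal value. It is applied both to \<open>u\<close>
  and to test functions.\<close>

definition frac_form :: "real \<Rightarrow> (real^'n::finite \<Rightarrow> real) \<Rightarrow> real^'n \<Rightarrow> real" where
  "frac_form \<alpha> w x = (\<integral>y. sdiff w x y * riesz_ker \<alpha> y \<partial>lborel)"

text \<open>The two properties from which all estimates of \<open>frac_form\<close> on test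
  functions follow: Gaussian decay, and a quadratic bound on short second differences with the same
  decay. No derivative occurs in it, so it passes easily to multiples and dilations and can be
  stated uniformly along a sequence or a time interval.\<close>

definition gauss_bd :: "real \<Rightarrow> real \<Rightarrow> (real^'n::finite \<Rightarrow> real) \<Rightarrow> bool" where
  "gauss_bd l A \<psi> \<longleftrightarrow> 0 \<le> A \<and> \<psi> \<in> borel_measurable borel \<and> (\<forall>z. \<bar>\<psi> z\<bar> \<le> A * exp (- l * (norm z)\<^sup>2)) \<and>
     (\<forall>z y. norm y \<le> 1 \<longrightarrow> \<bar>sdiff \<psi> z y\<bar> \<le> A * (norm y)\<^sup>2 * exp (- l * (norm z)\<^sup>2))"

text \<open>Majorant of the integrand of \<open>frac_form\<close>; its second summand comes from Peetre's inequality.\<close>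

definition maj :: "real \<Rightarrow> real \<Rightarrow> real^'n::finite \<Rightarrow> real^'n \<Rightarrow> real" where
  "maj \<alpha> l x y = 4 * exp (- l * (norm x)\<^sup>2) * min_ker \<alpha> y
     + 2 powr (real CARD('n) + \<alpha>) * (1 + norm x) powr (- (real CARD('n) + \<alpha>)) *
       ((1 + norm (x + y)) powr (real CARD('n) + \<alpha>) * exp (- l * (norm (x + y))\<^sup>2)
        + (1 + norm (x - y)) powr (real CARD('n) + \<alpha>) * exp (- l * (norm (x - y))\<^sup>2))"

text \<open>For \<open>norm y \<le> 1\<close> the quadratic bound tames the kernel. For larger
  \<open>y\<close> the kernel is comparable to the weight at \<open>y\<close>, and Peetre's
  inequality shifts this weight to \<open>x\<close>; the growth it leaves at \<open>x + y\<close>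
  and \<open>x - y\<close> is absorbed by the Gaussians located there.\<close>

lemma gauss_bd_sdiff_le:
  fixes x y :: "real^'n::finite"
  assumes \<psi>: "gauss_bd l A \<psi>" and \<alpha>: "0 < \<alpha>"
  shows "\<bar>sdiff \<psi> x y * riesz_ker \<alpha> y\<bar> \<le> A * maj \<alpha> l x y"
proof -
  let ?b = "real CARD('n) + \<alpha>"
  let ?G = "\<lambda>z. (1 + norm z) powr ?b * exp (- l * (norm z)\<^sup>2)"
  have A: "A \<ge> 0" using \<psi> by (simp add: gauss_bd_def)
  have G: "?G z \<ge> 0" for z :: "real^'n" by simp
  show ?thesis
  proof (cases "norm y \<le> 1")
    case True
    have m: "min 1 ((norm y)\<^sup>2) = (norm y)\<^sup>2" using True by (simp add: min_absorb2 power_le_one)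
    have "\<bar>sdiff \<psi> x y * riesz_ker \<alpha> y\<bar> \<le> A * (norm y)\<^sup>2 * exp (- l * (norm x)\<^sup>2) * riesz_ker \<alpha> y"
      using \<psi> True by (auto simp: gauss_bd_def abs_mult intro!: mult_right_mono)
    also have "\<dots> = A * (exp (- l * (norm x)\<^sup>2) * min_ker \<alpha> y)" by (simp add: m mult_ac)
    also have "\<dots> \<le> A * maj \<alpha> l x y"
    proof (rule mult_left_mono[OF _ A])
      have "0 \<le> 2 powr ?b * (1 + norm x) powr (- ?b) * (?G (x + y) + ?G (x - y))"
        using G[of "x + y"] G[of "x - y"] by simp
      moreover have "0 \<le> exp (- l * (norm x)\<^sup>2) * min_ker \<alpha> y" by simp
      ultimately show "exp (- l * (norm x)\<^sup>2) * min_ker \<alpha> y \<le> maj \<alpha> l x y" unfolding maj_def by linarith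
    qed
    finally show ?thesis .
  next
    case False
    have m: "min 1 ((norm y)\<^sup>2) = 1" using False by (auto simp: min_def power_le_one_iff)
    have K: "riesz_ker \<alpha> y \<le> 2 powr ?b * ((1 + norm x) powr (- ?b) * (1 + norm (x + z)) powr ?b)" if "z = y \<or> z = - y" for z
    proof -
      have nz: "norm z = norm y" using that by auto
      have "riesz_ker \<alpha> y \<le> 2 powr ?b * (1 + norm z) powr (- ?b)"
        unfolding nz using riesz_ker_le_weight[of y \<alpha>] False \<alpha> by simp
      also have "\<dots> \<le> 2 powr ?b * ((1 + norm x) powr (- ?b) * (1 + norm (x + z)) powr ?b)"
        using Peetre(1)[of ?b z x] \<alpha> by (intro mult_left_mono) auto
      finally show ?thesis .
    qed
    have b: "\<bar>\<psi> z\<bar> \<le> A * exp (- l * (norm z)\<^sup>2)" for z using \<psi> by (simp add: gauss_bd_def)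
    have "\<bar>sdiff \<psi> x y\<bar> \<le> 2 * \<bar>\<psi> x\<bar> + \<bar>\<psi> (x + y)\<bar> + \<bar>\<psi> (x - y)\<bar>" by (simp add: sdiff_def)
    also have "\<dots> \<le> A * (2 * exp (- l * (norm x)\<^sup>2) + exp (- l * (norm (x + y))\<^sup>2) + exp (- l * (norm (x - y))\<^sup>2))"
      using b[of x] b[of "x + y"] b[of "x - y"] by (simp add: algebra_simps)
    finally have "\<bar>sdiff \<psi> x y * riesz_ker \<alpha> y\<bar> \<le>
        A * (2 * exp (- l * (norm x)\<^sup>2) + exp (- l * (norm (x + y))\<^sup>2) + exp (- l * (norm (x - y))\<^sup>2)) * riesz_ker \<alpha> y"
      by (simp add: abs_mult mult_right_mono)
    also have "\<dots> = A * (2 * exp (- l * (norm x)\<^sup>2) * riesz_ker \<alpha> y + (exp (- l * (norm (x + y))\<^sup>2) * riesz_ker \<alpha> y + exp (- l * (norm (x - y))\<^sup>2) * riesz_ker \<alpha> y))"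
      by (simp add: algebra_simps)
    also have "\<dots> \<le> A * (4 * exp (- l * (norm x)\<^sup>2) * riesz_ker \<alpha> y +
        (exp (- l * (norm (x + y))\<^sup>2) * (2 powr ?b * ((1 + norm x) powr (- ?b) * (1 + norm (x + y)) powr ?b))
        + exp (- l * (norm (x - y))\<^sup>2) * (2 powr ?b * ((1 + norm x) powr (- ?b) * (1 + norm (x - y)) powr ?b))))"
      using A K[of y] K[of "- y"] by (intro mult_left_mono add_mono mult_right_mono) auto
    also have "\<dots> = A * maj \<alpha> l x y" unfolding maj_def m by (simp add: algebra_simps)
    finally show ?thesis .
  qed
qed

lemma maj_nonneg: "maj \<alpha> l x y \<ge> 0"
  unfolding maj_def by (intro add_nonneg_nonneg mult_nonneg_nonneg) auto

lemma integrable_maj: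
  fixes x :: "real^'n::finite"
  assumes "0 < \<alpha>" "\<alpha> < 2" "l > 0"
  shows "integrable lborel (maj \<alpha> l x)"
proof -
  let ?b = "real CARD('n) + \<alpha>"
  let ?G = "\<lambda>z. (1 + norm z) powr ?b * exp (- l * (norm z)\<^sup>2)"
  have "integrable lborel (?G :: real^'n \<Rightarrow> real)" using assms(3) by (rule integrable_powr_mult_gaussian)
  then have "integrable lborel (\<lambda>y::real^'n. ?G (y + x))" "integrable lborel (\<lambda>y::real^'n. ?G (x - y))"
    using integrable_lborel_add[of "?G::real^'n \<Rightarrow> real" x] integrable_lborel_sub[of "?G::real^'n \<Rightarrow> real" x] by auto
  then show ?thesis
    unfolding maj_def[abs_def] using integrable_min_riesz_ker[OF assms(1,2), where 'n='n]
    by (intro Bochner_Integration.integrable_add integrable_mult_right) (auto simp: add.commute)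
qed

text \<open>A nonlocal operator does not preserve Gaussian decay: what survives is the decay of its
  kernel. It is the weight against which \<open>u\<close> is integrable, so \<open>u\<close> can be
  paired with \<open>frac_form\<close> of a Gaussian.\<close>

lemma integral_maj_le:
  assumes "0 < \<alpha>" "\<alpha> < 2" "l > 0"
  shows "\<exists>C>0. \<forall>x::real^'n::finite. (\<integral>y. maj \<alpha> l x y \<partial>lborel) \<le> C * (1 + norm x) powr (- (real CARD('n) + \<alpha>))"
proof -
  let ?b = "real CARD('n) + \<alpha>"
  let ?G = "\<lambda>z. (1 + norm z) powr ?b * exp (- l * (norm z)\<^sup>2)"
  have iG: "integrable lborel (?G :: real^'n \<Rightarrow> real)" using assms(3) by (rule integrable_powr_mult_gaussian)
  then have iGx: "integrable lborel (\<lambda>y::real^'n. ?G (x + y))" "integrable lborel (\<lambda>y::real^'n. ?G (x - y))" for x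
    using integrable_lborel_add[of "?G::real^'n \<Rightarrow> real" x] integrable_lborel_sub[of "?G::real^'n \<Rightarrow> real" x] by (auto simp: add.commute)
  define Im where "Im = (\<integral>y. min_ker \<alpha> (y::real^'n) \<partial>lborel)"
  define IG where "IG = (\<integral>y. ?G (y::real^'n) \<partial>lborel)"
  have Im: "Im \<ge> 0" unfolding Im_def by (intro integral_nonneg_AE AE_I2 min_ker_nonneg)
  have IG: "IG \<ge> 0" unfolding IG_def by (intro integral_nonneg_AE AE_I2) auto
  obtain C1 where C1: "C1 > 0" "\<And>r. r \<ge> 0 \<Longrightarrow> (1 + r) powr ?b * exp (- l * r\<^sup>2) \<le> C1"
    using powr_mult_gaussian_bound[OF assms(3), of ?b] by auto
  have "(\<integral>y. maj \<alpha> l x y \<partial>lborel) \<le> (4 * C1 * Im + 2 powr ?b * 2 * IG + 1) * (1 + norm x) powr (- ?b)" for x :: "real^'n"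
  proof -
    have "(\<integral>y. ?G (x + y) \<partial>lborel) = IG" "(\<integral>y. ?G (x - y) \<partial>lborel) = IG"
      using integral_lborel_add[of "?G::real^'n \<Rightarrow> real" x] integral_lborel_sub[of "?G::real^'n \<Rightarrow> real" x]
      by (auto simp: add.commute IG_def)
    then have "(\<integral>y. maj \<alpha> l x y \<partial>lborel) = 4 * exp (- l * (norm x)\<^sup>2) * Im + 2 powr ?b * (1 + norm x) powr (- ?b) * (IG + IG)"
      unfolding maj_def Im_def using iGx[of x] integrable_min_riesz_ker[OF assms(1,2), where 'n='n]
      by (subst Bochner_Integration.integral_add) auto
    also have "exp (- l * (norm x)\<^sup>2) \<le> C1 * (1 + norm x) powr (- ?b)"
    proof -
      have p: "(1 + norm x) powr ?b > 0" by (smt (verit) norm_ge_zero powr_gt_zero)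
      have "(1 + norm x) powr (- ?b) = 1 / (1 + norm x) powr ?b" by (rule powr_minus_divide)
      then show ?thesis using C1(2)[of "norm x"] p by (simp add: pos_le_divide_eq mult.commute)
    qed
    then have "4 * exp (- l * (norm x)\<^sup>2) * Im \<le> 4 * (C1 * (1 + norm x) powr (- ?b)) * Im"
      using Im by (intro mult_right_mono mult_left_mono) auto
    finally show ?thesis by (simp add: algebra_simps) (smt (verit) powr_ge_zero)
  qed
  moreover have "4 * C1 * Im + 2 powr ?b * 2 * IG + 1 > 0" using C1 Im IG by (simp add: add_nonneg_pos)
  ultimately show ?thesis by blast
qed

lemma gauss_bd_frac_form:
  fixes \<psi> :: "real^'n::finite \<Rightarrow> real"
  assumes \<psi>: "gauss_bd l A \<psi>" and \<alpha>: "0 < \<alpha>" "\<alpha> < 2" and l: "l > 0"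
  shows "integrable lborel (\<lambda>y. sdiff \<psi> x y * riesz_ker \<alpha> y)"
    and "(\<integral>y. \<bar>sdiff \<psi> x y * riesz_ker \<alpha> y\<bar> \<partial>lborel) \<le> A * (\<integral>y. maj \<alpha> l x y \<partial>lborel)"
    and "\<bar>frac_form \<alpha> \<psi> x\<bar> \<le> A * (\<integral>y. maj \<alpha> l x y \<partial>lborel)"
proof -
  have [measurable]: "\<psi> \<in> borel_measurable borel" using \<psi> by (simp add: gauss_bd_def)
  note b = gauss_bd_sdiff_le[OF \<psi> \<alpha>(1), of x]
  have A: "A \<ge> 0" using \<psi> by (simp add: gauss_bd_def)
  have iM: "integrable lborel (\<lambda>y. A * maj \<alpha> l x y)" using integrable_maj[OF \<alpha> l, of x] by simp
  show i: "integrable lborel (\<lambda>y. sdiff \<psi> x y * riesz_ker \<alpha> y)"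
    by (rule Bochner_Integration.integrable_bound[OF iM]) (use b A maj_nonneg[of \<alpha> l x] in \<open>auto simp: abs_mult\<close>)
  show ii: "(\<integral>y. \<bar>sdiff \<psi> x y * riesz_ker \<alpha> y\<bar> \<partial>lborel) \<le> A * (\<integral>y. maj \<alpha> l x y \<partial>lborel)"
    using integral_mono[OF integrable_abs[OF i] iM b] by simp
  show "\<bar>frac_form \<alpha> \<psi> x\<bar> \<le> A * (\<integral>y. maj \<alpha> l x y \<partial>lborel)"
    unfolding frac_form_def using integral_abs_bound[of lborel "\<lambda>y. sdiff \<psi> x y * riesz_ker \<alpha> y"] ii by linarith
qed

text \<open>Second differences at \<open>x\<close> involve second derivatives at points
  \<open>z\<close> within distance 1. Moving the Gaussian from \<open>z\<close> to \<open>x\<close>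
  uses \<open>(norm x)^2 \<le> 2 * (norm z)^2 + 2\<close>, which halves the exponent and produces
  \<open>exp (2 * l)\<close>.\<close>

lemma gauss_bd_C2:
  fixes \<psi> :: "real^'n::finite \<Rightarrow> real"
  assumes C2: "\<psi> \<in> C_k 2" and l: "l > 0" and B: "B \<ge> 0" "\<And>z. \<bar>\<psi> z\<bar> \<le> B * exp (- (2 * l) * (norm z)\<^sup>2)"
    "\<And>i j z. \<bar>partial_derivative i (partial_derivative j \<psi>) z\<bar> \<le> B * exp (- (2 * l) * (norm z)\<^sup>2)"
  shows "gauss_bd l (2 * (real CARD('n))\<^sup>2 * exp (2 * l) * B) \<psi>"
proof -
  have 1: "exp (- (2 * l) * (norm z)\<^sup>2) \<le> exp (2 * l) * exp (- l * (norm x)\<^sup>2)" if "norm (z - x) \<le> norm y" "norm y \<le> 1" for x y z :: "real^'n"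
  proof -
    have "norm x \<le> norm z + 1" using that norm_triangle_ineq3[of z x] by linarith
    then have "(norm x)\<^sup>2 \<le> (norm z + 1)\<^sup>2" by (intro power_mono) auto
    also have "\<dots> \<le> 2 * (norm z)\<^sup>2 + 2" using zero_le_power2[of "norm z - 1"] by (simp add: power2_eq_square algebra_simps)
    finally have "l * (norm x)\<^sup>2 \<le> l * (2 * (norm z)\<^sup>2 + 2)" using l by (intro mult_left_mono) auto
    then have "- (2 * l) * (norm z)\<^sup>2 \<le> 2 * l + - l * (norm x)\<^sup>2" by (simp add: algebra_simps)
    then show ?thesis by (simp add: exp_add[symmetric])
  qed
  have n1: "(real CARD('n))\<^sup>2 \<ge> 1" by (simp add: one_le_power Suc_le_eq)
  have "1 \<le> exp (2 * l)" using l by simp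
  then have n2: "2 * (real CARD('n))\<^sup>2 * exp (2 * l) \<ge> 1"
    using n1 mult_mono[of 1 "2 * (real CARD('n))\<^sup>2" 1 "exp (2 * l)"] by linarith
  show ?thesis
    unfolding gauss_bd_def
  proof (intro conjI allI impI)
    show "\<psi> \<in> borel_measurable borel" using C_k_continuous[OF C2] by (rule borel_measurable_continuous_onI)
    fix z :: "real^'n"
    have "B * exp (- (2 * l) * (norm z)\<^sup>2) \<le> (2 * (real CARD('n))\<^sup>2 * exp (2 * l) * B) * exp (- l * (norm z)\<^sup>2)"
      using n2 B(1) l by (intro mult_mono) (auto simp: mult_le_cancel_right1)
    then show "\<bar>\<psi> z\<bar> \<le> 2 * (real CARD('n))\<^sup>2 * exp (2 * l) * B * exp (- l * (norm z)\<^sup>2)" using B(2)[of z] by linarith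
    fix y :: "real^'n" assume y: "norm y \<le> 1"
    have "\<bar>sdiff \<psi> z y\<bar> \<le> 2 * (real CARD('n))\<^sup>2 * (B * (exp (2 * l) * exp (- l * (norm z)\<^sup>2))) * (norm y)\<^sup>2"
    proof (rule sdiff_C2_bound)
      show "\<psi> \<in> C_k (Suc (Suc 0))" using C2 by (simp add: numeral_2_eq_2)
      fix i j w assume w: "norm (w - z) \<le> norm y"
      show "\<bar>partial_derivative i (partial_derivative j \<psi>) w\<bar> \<le> B * (exp (2 * l) * exp (- l * (norm z)\<^sup>2))"
        using B(3)[of i j w] mult_left_mono[OF 1[OF w y] B(1)] by linarith
    qed
    then show "\<bar>sdiff \<psi> z y\<bar> \<le> 2 * (real CARD('n))\<^sup>2 * exp (2 * l) * B * (norm y)\<^sup>2 * exp (- l * (norm z)\<^sup>2)"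
      by (simp add: mult_ac)
  qed (use B in auto)
qed

lemma C_2_sdiff_local:
  fixes u :: "real^'n::finite \<Rightarrow> real"
  assumes u: "u \<in> C_k 2"
  shows "\<exists>C\<ge>0. \<forall>x y. norm x \<le> R \<and> norm y \<le> 1 \<longrightarrow> \<bar>sdiff u x y\<bar> \<le> C * (norm y)\<^sup>2"
proof -
  have u2: "u \<in> C_k (Suc (Suc 0))" using u by (simp add: numeral_2_eq_2)
  have "\<exists>B. \<forall>z\<in>cball 0 (\<bar>R\<bar> + 1). \<bar>partial_derivative i (partial_derivative j u) z\<bar> \<le> B" for i j
  proof -
    have "continuous_on (cball 0 (\<bar>R\<bar> + 1)) (partial_derivative i (partial_derivative j u))"
      using u2 by (auto simp: C_k_Suc C_k_0 intro: continuous_on_subset)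
    then have "bounded (partial_derivative i (partial_derivative j u) ` cball 0 (\<bar>R\<bar> + 1))"
      by (intro compact_imp_bounded compact_continuous_image) auto
    then show ?thesis by (auto simp: bounded_iff)
  qed
  then obtain B where B: "\<And>i j z. z \<in> cball 0 (\<bar>R\<bar> + 1) \<Longrightarrow> \<bar>partial_derivative i (partial_derivative j u) z\<bar> \<le> B i j" by metis
  define B0 where "B0 = (\<Sum>i\<in>UNIV. \<Sum>j\<in>UNIV. \<bar>B i j\<bar>)"
  have B0: "\<bar>B i j\<bar> \<le> B0" for i j
  proof -
    have "\<bar>B i j\<bar> \<le> (\<Sum>j\<in>UNIV. \<bar>B i j\<bar>)" by (rule member_le_sum) auto
    also have "\<dots> \<le> B0" unfolding B0_def by (rule member_le_sum[of i UNIV "\<lambda>i. \<Sum>j\<in>UNIV. \<bar>B i j\<bar>"]) (auto intro: sum_nonneg)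
    finally show ?thesis .
  qed
  show ?thesis
  proof (intro exI[of _ "2 * (real CARD('n))\<^sup>2 * B0"] conjI allI impI)
    show "2 * (real CARD('n))\<^sup>2 * B0 \<ge> 0" unfolding B0_def by (intro mult_nonneg_nonneg sum_nonneg) auto
    fix x y :: "real^'n" assume xy: "norm x \<le> R \<and> norm y \<le> 1"
    show "\<bar>sdiff u x y\<bar> \<le> 2 * (real CARD('n))\<^sup>2 * B0 * (norm y)\<^sup>2"
    proof (rule sdiff_C2_bound[OF u2])
      fix i j z assume z: "norm (z - x) \<le> norm y"
      have "norm z \<le> \<bar>R\<bar> + 1" using z xy norm_triangle_ineq2[of z x] by linarith
      then show "\<bar>partial_derivative i (partial_derivative j u) z\<bar> \<le> B0"
        using B[of z i j] B0[of i j] by (auto simp: dist_norm)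
    qed
  qed
qed

text \<open>The counterpart of \<open>gauss_bd_sdiff_le\<close> for a function without decay:
  Peetre's inequality now places the weight at \<open>x + y\<close> and \<open>x - y\<close>, where
  \<open>u\<close> is evaluated, and leaves growth in \<open>x\<close>, which is harmless
  locally.\<close>

lemma sdiff_ker_le:
  fixes u :: "real^'n::finite \<Rightarrow> real"
  assumes \<alpha>: "0 < \<alpha>" and C: "norm y \<le> 1 \<Longrightarrow> \<bar>sdiff u x y\<bar> \<le> C * (norm y)\<^sup>2" "C \<ge> 0"
  shows "\<bar>sdiff u x y * riesz_ker \<alpha> y\<bar> \<le> (C + 2 * \<bar>u x\<bar>) * min_ker \<alpha> y
     + 2 powr (real CARD('n) + \<alpha>) * (1 + norm x) powr (real CARD('n) + \<alpha>) *
       (\<bar>u (x + y)\<bar> * (1 + norm (x + y)) powr (- (real CARD('n) + \<alpha>))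
        + \<bar>u (x - y)\<bar> * (1 + norm (x - y)) powr (- (real CARD('n) + \<alpha>)))" (is "_ \<le> ?R")
proof (cases "norm y \<le> 1")
  case True
  have m: "min 1 ((norm y)\<^sup>2) = (norm y)\<^sup>2" using True by (simp add: min_absorb2 power_le_one)
  have "\<bar>sdiff u x y * riesz_ker \<alpha> y\<bar> \<le> C * (norm y)\<^sup>2 * riesz_ker \<alpha> y"
    using C(1)[OF True] by (auto simp: abs_mult intro!: mult_right_mono)
  also have "\<dots> \<le> (C + 2 * \<bar>u x\<bar>) * min_ker \<alpha> y" unfolding m by (simp add: algebra_simps)
  also have "\<dots> \<le> ?R" by (simp add: add_nonneg_nonneg mult_nonneg_nonneg)
  finally show ?thesis .
next
  case False
  let ?b = "real CARD('n) + \<alpha>"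
  have m: "min 1 ((norm y)\<^sup>2) = 1" using False by (auto simp: min_def power_le_one_iff)
  have K: "riesz_ker \<alpha> y \<le> 2 powr ?b * ((1 + norm x) powr ?b * (1 + norm (x + z)) powr (- ?b))" if "z = y \<or> z = - y" for z
  proof -
    have nz: "norm z = norm y" using that by auto
    have "riesz_ker \<alpha> y \<le> 2 powr ?b * (1 + norm z) powr (- ?b)"
      unfolding nz using riesz_ker_le_weight[of y \<alpha>] False \<alpha> by simp
    also have "\<dots> \<le> 2 powr ?b * ((1 + norm x) powr ?b * (1 + norm (x + z)) powr (- ?b))"
      using Peetre(2)[of ?b z x] \<alpha> by (intro mult_left_mono) auto
    finally show ?thesis .
  qed
  have "\<bar>sdiff u x y\<bar> \<le> 2 * \<bar>u x\<bar> + \<bar>u (x + y)\<bar> + \<bar>u (x - y)\<bar>" by (simp add: sdiff_def)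
  then have "\<bar>sdiff u x y * riesz_ker \<alpha> y\<bar> \<le> (2 * \<bar>u x\<bar> + \<bar>u (x + y)\<bar> + \<bar>u (x - y)\<bar>) * riesz_ker \<alpha> y"
    by (simp add: abs_mult mult_right_mono)
  also have "\<dots> = 2 * \<bar>u x\<bar> * riesz_ker \<alpha> y + (\<bar>u (x + y)\<bar> * riesz_ker \<alpha> y + \<bar>u (x - y)\<bar> * riesz_ker \<alpha> y)"
    by (simp add: algebra_simps)
  also have "\<dots> \<le> (C + 2 * \<bar>u x\<bar>) * riesz_ker \<alpha> y +
      (\<bar>u (x + y)\<bar> * (2 powr ?b * ((1 + norm x) powr ?b * (1 + norm (x + y)) powr (- ?b)))
       + \<bar>u (x - y)\<bar> * (2 powr ?b * ((1 + norm x) powr ?b * (1 + norm (x - y)) powr (- ?b))))"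
    using C(2) K[of y] K[of "- y"] by (intro mult_left_mono add_mono mult_right_mono) auto
  also have "\<dots> = ?R" unfolding m by (simp add: algebra_simps)
  finally show ?thesis .
qed

section \<open>The fractional Laplacian of functions integrable against a power weight\<close>

abbreviation weighted :: "real \<Rightarrow> (real^'n::finite \<Rightarrow> real) \<Rightarrow> real^'n \<Rightarrow> real" where
  "weighted b u x \<equiv> \<bar>u x\<bar> * (1 + norm x) powr (- b)"

lemma continuous_bounded_on_cball:
  fixes f :: "real^'n::finite \<Rightarrow> real"
  assumes "continuous_on UNIV f"
  shows "\<exists>M\<ge>0. \<forall>x. norm x \<le> R \<longrightarrow> \<bar>f x\<bar> \<le> M"
proof -
  have "bounded (f ` cball 0 R)"
    by (intro compact_imp_bounded compact_continuous_image continuous_on_subset[OF assms]) auto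
  then obtain M where M: "\<forall>x\<in>cball 0 R. \<bar>f x\<bar> \<le> M" by (auto simp: bounded_iff)
  show ?thesis by (rule exI[of _ "\<bar>M\<bar>"]) (use M in force)
qed

lemma integrable_compact_support:
  fixes f :: "real^'n::finite \<Rightarrow> real"
  assumes "continuous_on UNIV f" "\<And>x. norm x > R \<Longrightarrow> f x = 0"
  shows "integrable lborel f"
proof -
  obtain M where M: "M \<ge> 0" "\<And>x. norm x \<le> R \<Longrightarrow> \<bar>f x\<bar> \<le> M" using continuous_bounded_on_cball[OF assms(1), of R] by auto
  show ?thesis
  proof (rule Bochner_Integration.integrable_bound)
    show "integrable lborel (\<lambda>x::real^'n. M * indicator (cball 0 R) x)"
      using emeasure_bounded_finite[of "cball (0::real^'n) R"] by (intro integrable_mult_right) (auto simp: integrable_indicator_iff)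
    show "f \<in> borel_measurable lborel" using borel_measurable_continuous_onI[OF assms(1)] by simp
    show "AE x in lborel. norm (f x) \<le> norm (M * indicator (cball 0 R) x)"
      using M assms(2) by (intro AE_I2) (auto simp: indicator_def not_le)
  qed
qed

text \<open>The locally uniform bound in the second claim is what Fubini requires when
  \<open>frac_form \<alpha> u\<close> is paired with a compactly supported function.\<close>

lemma frac_form_integrable:
  fixes u :: "real^'n::finite \<Rightarrow> real"
  assumes \<alpha>: "0 < \<alpha>" "\<alpha> < 2" and u: "u \<in> C_k 2"
    and W: "integrable lborel (weighted (real CARD('n) + \<alpha>) u)"
  shows "integrable lborel (\<lambda>y. sdiff u x y * riesz_ker \<alpha> y)"
    and "\<exists>C\<ge>0. \<forall>x. norm x \<le> R \<longrightarrow> (\<integral>y. \<bar>sdiff u x y * riesz_ker \<alpha> y\<bar> \<partial>lborel) \<le> C"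
proof -
  let ?b = "real CARD('n) + \<alpha>"
  have cu: "continuous_on UNIV u" using u by (rule C_k_continuous)
  have [measurable]: "u \<in> borel_measurable borel" using cu by (rule borel_measurable_continuous_onI)
  define Wf where "Wf = weighted ?b u"
  have Wm: "Wf \<in> borel_measurable borel" unfolding Wf_def by measurable
  have Wi: "integrable lborel Wf" using W unfolding Wf_def .
  have iW: "integrable lborel (\<lambda>y. Wf (x + y))" "integrable lborel (\<lambda>y. Wf (x - y))"
    and IW: "(\<integral>y. Wf (x + y) \<partial>lborel) = (\<integral>y. Wf y \<partial>lborel)" "(\<integral>y. Wf (x - y) \<partial>lborel) = (\<integral>y. Wf y \<partial>lborel)" for x
    using integrable_lborel_add[OF Wm, of x] integrable_lborel_sub[OF Wm, of x] Wi
       integral_lborel_add[OF Wm, of x] integral_lborel_sub[OF Wm, of x] by (auto simp: add.commute)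
  define B where "B C x y = (C + 2 * \<bar>u x\<bar>) * min_ker \<alpha> y + 2 powr ?b * (1 + norm x) powr ?b * (Wf (x + y) + Wf (x - y))" for C x y
  note im = integrable_min_riesz_ker[OF \<alpha>, where 'n='n]
  have iB: "integrable lborel (B C x)" for C x
    unfolding B_def[abs_def] using im iW[of x] by (intro Bochner_Integration.integrable_add integrable_mult_right) auto
  have IB: "(\<integral>y. B C x y \<partial>lborel) = (C + 2 * \<bar>u x\<bar>) * (\<integral>y. min_ker \<alpha> (y::real^'n) \<partial>lborel) + 2 powr ?b * (1 + norm x) powr ?b * (2 * (\<integral>y. Wf y \<partial>lborel))" for C x
    unfolding B_def using im iW[of x] IW[of x] by simp
  have loc: "\<exists>C\<ge>0. \<forall>x y. norm x \<le> R \<longrightarrow> \<bar>sdiff u x y * riesz_ker \<alpha> y\<bar> \<le> B C x y" for R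
  proof -
    obtain C where C: "C \<ge> 0" "\<And>x y. norm x \<le> R \<Longrightarrow> norm y \<le> 1 \<Longrightarrow> \<bar>sdiff u x y\<bar> \<le> C * (norm y)\<^sup>2"
      using C_2_sdiff_local[OF u, of R] by blast
    show ?thesis
      by (intro exI[of _ C] conjI allI impI C(1)) (unfold B_def Wf_def, rule sdiff_ker_le[OF \<alpha>(1)], use C in auto)
  qed
  have int: "integrable lborel (\<lambda>y. sdiff u x y * riesz_ker \<alpha> y)" for x
  proof -
    obtain C where C: "\<And>z y. norm z \<le> norm x \<Longrightarrow> \<bar>sdiff u z y * riesz_ker \<alpha> y\<bar> \<le> B C z y" using loc[of "norm x"] by auto
    show ?thesis
      by (rule Bochner_Integration.integrable_bound[OF iB[of C x]])
        (use C[of x] in \<open>auto intro!: AE_I2 order_trans[OF _ abs_ge_self]\<close>)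
  qed
  then show "integrable lborel (\<lambda>y. sdiff u x y * riesz_ker \<alpha> y)" .
  obtain C where C: "C \<ge> 0" "\<And>z y. norm z \<le> R \<Longrightarrow> \<bar>sdiff u z y * riesz_ker \<alpha> y\<bar> \<le> B C z y" using loc[of R] by auto
  obtain M where M: "M \<ge> 0" "\<And>x. norm x \<le> R \<Longrightarrow> \<bar>u x\<bar> \<le> M" using continuous_bounded_on_cball[OF cu, of R] by auto
  define Im where "Im = (\<integral>y. min_ker \<alpha> (y::real^'n) \<partial>lborel)"
  define Iw where "Iw = (\<integral>y. Wf y \<partial>lborel)"
  have pos: "Im \<ge> 0" "Iw \<ge> 0" unfolding Im_def Iw_def Wf_def by (intro integral_nonneg_AE AE_I2; simp)+
  show "\<exists>C\<ge>0. \<forall>x. norm x \<le> R \<longrightarrow> (\<integral>y. \<bar>sdiff u x y * riesz_ker \<alpha> y\<bar> \<partial>lborel) \<le> C"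
  proof (intro exI[of _ "(C + 2 * M) * Im + 2 powr ?b * (1 + \<bar>R\<bar>) powr ?b * (2 * Iw)"] conjI allI impI)
    show "0 \<le> (C + 2 * M) * Im + 2 powr ?b * (1 + \<bar>R\<bar>) powr ?b * (2 * Iw)" using C M pos by simp
    fix x :: "real^'n" assume x: "norm x \<le> R"
    have "(\<integral>y. \<bar>sdiff u x y * riesz_ker \<alpha> y\<bar> \<partial>lborel) \<le> (\<integral>y. B C x y \<partial>lborel)"
      using int iB C(2)[OF x] by (intro integral_mono integrable_abs) auto
    also have "\<dots> = (C + 2 * \<bar>u x\<bar>) * Im + 2 powr ?b * (1 + norm x) powr ?b * (2 * Iw)" unfolding IB Im_def Iw_def ..
    also have "\<dots> \<le> (C + 2 * M) * Im + 2 powr ?b * (1 + \<bar>R\<bar>) powr ?b * (2 * Iw)"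
      using M(2)[OF x] pos x \<alpha> by (intro add_mono mult_right_mono mult_left_mono powr_mono2) auto
    finally show "(\<integral>y. \<bar>sdiff u x y * riesz_ker \<alpha> y\<bar> \<partial>lborel) \<le> (C + 2 * M) * Im + 2 powr ?b * (1 + \<bar>R\<bar>) powr ?b * (2 * Iw)" .
  qed
qed

text \<open>Symmetrising \<open>y \<mapsto> -y\<close> turns the principal value into an absolutely convergent integral.\<close>

lemma frac_laplacian_eq_frac_form:
  fixes u :: "real^'n::finite \<Rightarrow> real"
  assumes \<alpha>: "0 < \<alpha>" "\<alpha> < 2" and u: "u \<in> C_k 2"
    and W: "integrable lborel (weighted (real CARD('n) + \<alpha>) u)"
  shows "frac_laplacian \<alpha> u x = frac_const \<alpha> TYPE('n) / 2 * frac_form \<alpha> u x"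
proof -
  let ?b = "real CARD('n) + \<alpha>"
  have cu: "continuous_on UNIV u" using u by (rule C_k_continuous)
  have [measurable]: "u \<in> borel_measurable borel" using cu by (rule borel_measurable_continuous_onI)
  define Wf where "Wf = weighted ?b u"
  have Wm: "Wf \<in> borel_measurable borel" unfolding Wf_def by measurable
  have Wi: "integrable lborel Wf" using W unfolding Wf_def .
  have iW: "integrable lborel (\<lambda>y. Wf (x + y))"
    using integrable_lborel_add[OF Wm, of x] Wi by (auto simp: add.commute)
  define I where "I e = (LINT y:{y. norm (y - x) \<ge> e}|lborel. (u x - u y) / norm (x - y) powr ?b)" for e
  define J where "J e = (\<integral>h. indicator {h. norm h \<ge> e} h * (sdiff u x h * riesz_ker \<alpha> h) \<partial>lborel)" for e
  obtain M where M: "M \<ge> 0" "\<And>z. norm z \<le> norm x + 1 \<Longrightarrow> \<bar>u z\<bar> \<le> M"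
    using continuous_bounded_on_cball[OF cu, of "norm x + 1"] by auto
  have IJ: "I e = J e / 2" if e: "0 < e" "e < 1" for e
  proof -
    define f where "f y = indicator {y. norm (y - x) \<ge> e} y * ((u x - u y) / norm (x - y) powr ?b)" for y
    define g where "g h = indicator {h. norm h \<ge> e} h * ((u x - u (x + h)) * riesz_ker \<alpha> h)" for h
    have fm[measurable]: "f \<in> borel_measurable borel" unfolding f_def by measurable
    have gm[measurable]: "g \<in> borel_measurable borel" unfolding g_def by measurable
    have "riesz_ker \<alpha> h = 1 / norm h powr ?b" for h :: "real^'n"
      unfolding riesz_ker_def by (rule powr_minus_divide)
    then have fg: "f (x + 1 *\<^sub>R h) = g h" for h
      by (simp add: f_def g_def indicator_def)
    \<comment> \<open>Where \<open>norm h \<ge> e\<close> the kernel is at most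
      \<open>min_ker\<close> divided by \<open>e^2\<close>. The bound \<open>M\<close> handles
      \<open>u\<close> near \<open>x\<close>, the weighted integral handles it for
      \<open>norm h > 1\<close>.\<close>
    have ig: "integrable lborel g"
    proof (rule Bochner_Integration.integrable_bound)
      show "integrable lborel (\<lambda>h. 2 * M / e\<^sup>2 * min_ker \<alpha> h + 2 powr ?b * (1 + norm x) powr ?b * Wf (x + h))"
        using integrable_min_riesz_ker[OF \<alpha>, where 'n='n] iW by (intro Bochner_Integration.integrable_add integrable_mult_right) auto
      show "AE h in lborel. norm (g h) \<le> norm (2 * M / e\<^sup>2 * min_ker \<alpha> h + 2 powr ?b * (1 + norm x) powr ?b * Wf (x + h))"
      proof (rule AE_I2)
        fix h
        let ?R = "2 * M / e\<^sup>2 * min_ker \<alpha> h + 2 powr ?b * (1 + norm x) powr ?b * Wf (x + h)"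
        have W0: "0 \<le> 2 powr ?b * (1 + norm x) powr ?b * Wf (x + h)" by (simp add: Wf_def)
        have m0: "0 \<le> 2 * M / e\<^sup>2 * min_ker \<alpha> h" using M by simp
        show "norm (g h) \<le> norm ?R"
        proof (cases "norm h \<ge> e")
          case False then show ?thesis by (simp add: g_def)
        next
          case True
          have ker: "riesz_ker \<alpha> h \<le> 1 / e\<^sup>2 * min_ker \<alpha> h"
          proof -
            have "e\<^sup>2 \<le> (norm h)\<^sup>2" "e\<^sup>2 \<le> 1" using True e by (auto intro!: power_mono power_le_one)
            then have "e\<^sup>2 * riesz_ker \<alpha> h \<le> min 1 ((norm h)\<^sup>2) * riesz_ker \<alpha> h" by (intro mult_right_mono) auto
            then show ?thesis using e by (simp add: field_simps)
          qed
          have ux: "\<bar>u x\<bar> \<le> M" by (rule M(2)) simp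
          have "\<bar>u (x + h)\<bar> * riesz_ker \<alpha> h \<le> M / e\<^sup>2 * min_ker \<alpha> h + 2 powr ?b * (1 + norm x) powr ?b * Wf (x + h)"
          proof (cases "norm h \<le> 1")
            case True
            have "\<bar>u (x + h)\<bar> \<le> M" using M(2)[of "x + h"] norm_triangle_ineq[of x h] True by simp
            then have "\<bar>u (x + h)\<bar> * riesz_ker \<alpha> h \<le> M * (1 / e\<^sup>2 * min_ker \<alpha> h)" using ker M by (intro mult_mono) auto
            then show ?thesis using W0 by simp
          next
            case False
            have "riesz_ker \<alpha> h \<le> 2 powr ?b * (1 + norm h) powr (- ?b)"
              using riesz_ker_le_weight[of h \<alpha>] False \<alpha> by simp
            also have "\<dots> \<le> 2 powr ?b * ((1 + norm x) powr ?b * (1 + norm (x + h)) powr (- ?b))"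
              using Peetre(2)[of ?b h x] \<alpha> by (intro mult_left_mono) auto
            finally have "\<bar>u (x + h)\<bar> * riesz_ker \<alpha> h \<le> \<bar>u (x + h)\<bar> * (2 powr ?b * ((1 + norm x) powr ?b * (1 + norm (x + h)) powr (- ?b)))"
              by (rule mult_left_mono) simp
            also have "\<dots> = 2 powr ?b * (1 + norm x) powr ?b * Wf (x + h)" by (simp add: Wf_def)
            finally show ?thesis using M by (simp add: add_increasing)
          qed
          moreover have "\<bar>u x\<bar> * riesz_ker \<alpha> h \<le> M * (1 / e\<^sup>2 * min_ker \<alpha> h)"
            using ux ker M by (intro mult_mono) auto
          moreover have "\<bar>g h\<bar> \<le> \<bar>u x\<bar> * riesz_ker \<alpha> h + \<bar>u (x + h)\<bar> * riesz_ker \<alpha> h"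
            using True abs_triangle_ineq4[of "u x" "u (x + h)"]
            by (simp add: g_def abs_mult distrib_right[symmetric] mult_right_mono)
          ultimately have "\<bar>g h\<bar> \<le> ?R" by simp
          then show ?thesis by simp
        qed
      qed
    qed measurable
    have "I e = (\<integral>y. f y \<partial>lborel)" unfolding I_def f_def set_lebesgue_integral_def by simp
    also have "\<dots> = (\<integral>h. f (x + 1 *\<^sub>R h) \<partial>lborel)" by (rule integral_lborel_affine[symmetric]) auto
    also have "\<dots> = (\<integral>h. g h \<partial>lborel)" unfolding fg ..
    finally have 1: "I e = (\<integral>h. g h \<partial>lborel)" .
    have 2: "(\<integral>h. g (0 - h) \<partial>lborel) = (\<integral>h. g h \<partial>lborel)" by (rule integral_lborel_sub) auto
    have i2: "integrable lborel (\<lambda>h. g (0 - h))" using ig by (subst integrable_lborel_sub) auto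
    have "J e = (\<integral>h. g h + g (0 - h) \<partial>lborel)" unfolding J_def
      by (intro Bochner_Integration.integral_cong) (auto simp: g_def sdiff_def algebra_simps indicator_def)
    also have "\<dots> = I e + I e" using ig i2 1 2 by simp
    finally show ?thesis by simp
  qed
  have int: "integrable lborel (\<lambda>h. sdiff u x h * riesz_ker \<alpha> h)"
    using frac_form_integrable(1)[OF \<alpha> u W] .
  have "(J \<longlongrightarrow> frac_form \<alpha> u x) (at_right 0)"
  proof (rule tendsto_at_right_sequentially[where b = 1])
    fix S :: "nat \<Rightarrow> real" assume S: "\<And>n. 0 < S n" "S \<longlonglongrightarrow> 0"
    show "(\<lambda>n. J (S n)) \<longlonglongrightarrow> frac_form \<alpha> u x"
      unfolding J_def frac_form_def
    proof (rule integral_dominated_convergence[where w = "\<lambda>h. \<bar>sdiff u x h * riesz_ker \<alpha> h\<bar>"])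
      show "AE h in lborel. (\<lambda>n. indicator {h. S n \<le> norm h} h * (sdiff u x h * riesz_ker \<alpha> h)) \<longlonglongrightarrow> sdiff u x h * riesz_ker \<alpha> h"
      proof (rule AE_I2)
        fix h :: "real^'n"
        show "(\<lambda>n. indicator {h. S n \<le> norm h} h * (sdiff u x h * riesz_ker \<alpha> h)) \<longlonglongrightarrow> sdiff u x h * riesz_ker \<alpha> h"
        proof (cases "h = 0")
          case True then show ?thesis by (simp add: sdiff_def)
        next
          case False
          then have "eventually (\<lambda>n. S n < norm h) sequentially" using S(2) by (intro order_tendstoD(2)) auto
          then have "eventually (\<lambda>n. sdiff u x h * riesz_ker \<alpha> h = indicator {h. S n \<le> norm h} h * (sdiff u x h * riesz_ker \<alpha> h)) sequentially"
            by eventually_elim auto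
          then show ?thesis by (rule Lim_transform_eventually[OF tendsto_const])
        qed
      qed
      show "AE h in lborel. norm (indicator {h. S n \<le> norm h} h * (sdiff u x h * riesz_ker \<alpha> h)) \<le> \<bar>sdiff u x h * riesz_ker \<alpha> h\<bar>" for n
        by (intro AE_I2) (auto simp: indicator_def)
    qed (use int in auto)
  qed auto
  then have "((\<lambda>e. J e / 2) \<longlongrightarrow> frac_form \<alpha> u x / 2) (at_right 0)" by (intro tendsto_divide) auto
  moreover have "eventually (\<lambda>e. J e / 2 = I e) (at_right 0)"
    by (rule eventually_at_rightI[of 0 1]) (auto simp: IJ)
  ultimately have "(I \<longlongrightarrow> frac_form \<alpha> u x / 2) (at_right 0)" by (rule Lim_transform_eventually)
  then have "Lim (at_right 0) I = frac_form \<alpha> u x / 2" by (intro tendsto_Lim) auto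
  then show ?thesis using \<alpha> by (simp add: frac_laplacian_def I_def[abs_def])
qed

text \<open>For each fixed \<open>y\<close>, translation invariance moves the second difference from
  \<open>u\<close> to \<open>\<psi>\<close>. The integrals over \<open>x\<close> and
  \<open>y\<close> are exchanged before and after this: first under the compact support of
  \<open>\<psi>\<close>, then under the weighted integral of \<open>u\<close>.\<close>

lemma frac_form_pairing:
  fixes u \<psi> :: "real^'n::finite \<Rightarrow> real"
  assumes \<alpha>: "0 < \<alpha>" "\<alpha> < 2" and u: "u \<in> C_k 2"
    and W: "integrable lborel (weighted (real CARD('n) + \<alpha>) u)"
    and \<psi>: "gauss_bd l A \<psi>" and l: "l > 0" and c\<psi>: "continuous_on UNIV \<psi>" and supp: "\<And>x. norm x > R \<Longrightarrow> \<psi> x = 0"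
  shows "(\<integral>x. \<psi> x * frac_form \<alpha> u x \<partial>lborel) = (\<integral>x. u x * frac_form \<alpha> \<psi> x \<partial>lborel)"
proof -
  let ?b = "real CARD('n) + \<alpha>"
  have cu: "continuous_on UNIV u" using u by (rule C_k_continuous)
  have um[measurable]: "u \<in> borel_measurable borel" using cu by (rule borel_measurable_continuous_onI)
  have \<psi>m[measurable]: "\<psi> \<in> borel_measurable borel" using c\<psi> by (rule borel_measurable_continuous_onI)
  have iu: "integrable lborel (\<lambda>y. sdiff u x y * riesz_ker \<alpha> y)" for x by (rule frac_form_integrable(1)[OF \<alpha> u W])
  obtain C where C: "C \<ge> 0" "\<And>x. norm x \<le> R \<Longrightarrow> (\<integral>y. \<bar>sdiff u x y * riesz_ker \<alpha> y\<bar> \<partial>lborel) \<le> C"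
    using frac_form_integrable(2)[OF \<alpha> u W, of R] by blast
  have i\<psi>: "integrable lborel \<psi>" by (rule integrable_compact_support[OF c\<psi> supp])
  have swap: "(\<integral>x. \<psi> x * (sdiff u x y * riesz_ker \<alpha> y) \<partial>lborel) = (\<integral>x. u x * (sdiff \<psi> x y * riesz_ker \<alpha> y) \<partial>lborel)" for y
  proof -
    have i: "integrable lborel (\<lambda>x. \<psi> x * u (x + z))" for z
      by (rule integrable_compact_support[where R=R])
        (auto intro!: continuous_intros c\<psi> continuous_on_compose2[OF cu] simp: supp)
    have "(\<lambda>x. (\<lambda>x. \<psi> (x - z) * u x) (x + z)) = (\<lambda>x. \<psi> x * u (x + z))" for z by simp
    then have i': "integrable lborel (\<lambda>x. \<psi> (x - z) * u x)"
      and e: "(\<integral>x. \<psi> x * u (x + z) \<partial>lborel) = (\<integral>x. \<psi> (x - z) * u x \<partial>lborel)" for z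
      using i[of z] integrable_lborel_add[of "\<lambda>x. \<psi> (x - z) * u x" z] integral_lborel_add[of "\<lambda>x. \<psi> (x - z) * u x" z]
      by auto
    have "(\<integral>x. \<psi> x * sdiff u x y \<partial>lborel) = (\<integral>x. 2 * (\<psi> x * u (x + 0)) - \<psi> x * u (x + y) - \<psi> x * u (x + - y) \<partial>lborel)"
      by (simp add: sdiff_def algebra_simps)
    also have "\<dots> = 2 * (\<integral>x. \<psi> x * u (x + 0) \<partial>lborel) - (\<integral>x. \<psi> x * u (x + y) \<partial>lborel) - (\<integral>x. \<psi> x * u (x + - y) \<partial>lborel)"
      using i[of 0] i[of y] i[of "- y"] by (subst Bochner_Integration.integral_diff Bochner_Integration.integral_mult_right_zero, auto)+
    also have "\<dots> = 2 * (\<integral>x. \<psi> (x - 0) * u x \<partial>lborel) - (\<integral>x. \<psi> (x - y) * u x \<partial>lborel) - (\<integral>x. \<psi> (x - - y) * u x \<partial>lborel)"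
      unfolding e ..
    also have "\<dots> = (\<integral>x. 2 * (\<psi> (x - 0) * u x) - \<psi> (x - y) * u x - \<psi> (x - - y) * u x \<partial>lborel)"
      using i'[of 0] i'[of y] i'[of "- y"] by (subst Bochner_Integration.integral_diff Bochner_Integration.integral_mult_right_zero, auto)+
    also have "\<dots> = (\<integral>x. u x * sdiff \<psi> x y \<partial>lborel)"
      by (simp add: sdiff_def algebra_simps)
    finally show ?thesis by (simp add: mult.assoc[symmetric])
  qed
  have "(\<integral>x. (\<integral>y. \<psi> x * (sdiff u x y * riesz_ker \<alpha> y) \<partial>lborel) \<partial>lborel) =
      (\<integral>y. (\<integral>x. \<psi> x * (sdiff u x y * riesz_ker \<alpha> y) \<partial>lborel) \<partial>lborel)"
  proof (rule lborel_Fubini_dominated(1))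
    show "(\<lambda>(x, y). \<psi> x * (sdiff u x y * riesz_ker \<alpha> y)) \<in> borel_measurable (lborel \<Otimes>\<^sub>M lborel)" by measurable
    show "integrable lborel (\<lambda>y. \<psi> x * (sdiff u x y * riesz_ker \<alpha> y))" for x using iu by (rule integrable_mult_right)
    show "(\<integral>y. \<bar>\<psi> x * (sdiff u x y * riesz_ker \<alpha> y)\<bar> \<partial>lborel) \<le> C * \<bar>\<psi> x\<bar>" for x
    proof (cases "norm x \<le> R")
      case True
      have "(\<integral>y. \<bar>\<psi> x * (sdiff u x y * riesz_ker \<alpha> y)\<bar> \<partial>lborel) = \<bar>\<psi> x\<bar> * (\<integral>y. \<bar>sdiff u x y * riesz_ker \<alpha> y\<bar> \<partial>lborel)"
        by (simp add: abs_mult[of "\<psi> x"])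
      also have "\<dots> \<le> \<bar>\<psi> x\<bar> * C" by (intro mult_left_mono C(2) True) simp
      finally show ?thesis by (simp only: mult.commute)
    qed (simp add: supp)
    show "integrable lborel (\<lambda>x. C * \<bar>\<psi> x\<bar>)" using i\<psi> by (intro integrable_mult_right integrable_abs)
  qed
  also have "\<dots> = (\<integral>y. (\<integral>x. u x * (sdiff \<psi> x y * riesz_ker \<alpha> y) \<partial>lborel) \<partial>lborel)"
    unfolding swap ..
  also have "\<dots> = (\<integral>x. (\<integral>y. u x * (sdiff \<psi> x y * riesz_ker \<alpha> y) \<partial>lborel) \<partial>lborel)"
  proof -
    obtain D where D: "D > 0" "\<And>x::real^'n. (\<integral>y. maj \<alpha> l x y \<partial>lborel) \<le> D * (1 + norm x) powr (- ?b)"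
      using integral_maj_le[OF \<alpha> l, where 'n='n] by blast
    have A: "A \<ge> 0" using \<psi> by (simp add: gauss_bd_def)
    note g = gauss_bd_frac_form[OF \<psi> \<alpha> l]
    show ?thesis
    proof (rule lborel_Fubini_dominated(1)[symmetric])
      show "(\<lambda>(x, y). u x * (sdiff \<psi> x y * riesz_ker \<alpha> y)) \<in> borel_measurable (lborel \<Otimes>\<^sub>M lborel)" by measurable
      show "integrable lborel (\<lambda>y. u x * (sdiff \<psi> x y * riesz_ker \<alpha> y))" for x using g(1) by (rule integrable_mult_right)
      show "(\<integral>y. \<bar>u x * (sdiff \<psi> x y * riesz_ker \<alpha> y)\<bar> \<partial>lborel) \<le> A * D * weighted ?b u x" for x
      proof -
        have "(\<integral>y. \<bar>u x * (sdiff \<psi> x y * riesz_ker \<alpha> y)\<bar> \<partial>lborel) = \<bar>u x\<bar> * (\<integral>y. \<bar>sdiff \<psi> x y * riesz_ker \<alpha> y\<bar> \<partial>lborel)"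
          by (simp add: abs_mult[of "u x"])
        also have "\<dots> \<le> \<bar>u x\<bar> * (A * (D * (1 + norm x) powr (- ?b)))"
          using g(2)[of x] D(2)[of x] A by (intro mult_left_mono order_trans[OF g(2)]) auto
        finally show ?thesis by (simp add: mult_ac)
      qed
      show "integrable lborel (\<lambda>x. A * D * weighted ?b u x)" using W by (rule integrable_mult_right)
    qed
  qed
  finally show ?thesis unfolding frac_form_def by simp
qed

subsection \<open>Regularity of the fractional Laplacian\<close>

text \<open>The part of the kernel far from the origin, continued to a function of class \<open>C^M\<close>: below \<open>z = 1\<close>
  the power is replaced by its Taylor polynomial at \<open>1\<close>.\<close>

definition taylor_powr :: "real \<Rightarrow> nat \<Rightarrow> real \<Rightarrow> real" where
  "taylor_powr \<gamma> M z = (if z \<le> 1 then \<Sum>j\<le>M. ((- \<gamma>) gchoose j) * (z - 1) ^ j else z powr (- \<gamma>))"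

text \<open>On the polynomial branch this is the absorption identity for generalised binomial
  coefficients. Differentiation raises the exponent by one and lowers the Taylor order by
  one.\<close>

lemma taylor_powr_DERIV:
  "(taylor_powr \<gamma> (Suc M) has_real_derivative - \<gamma> * taylor_powr (\<gamma> + 1) M z) (at z)"
proof -
  have s: "(\<Sum>j\<le>N. c j * (0::real) ^ j) = c 0" for N and c :: "nat \<Rightarrow> real"
    by (induction N) auto
  have "((\<lambda>z. if z \<le> 1 then \<Sum>j\<le>Suc M. ((- \<gamma>) gchoose j) * (z - 1) ^ j else z powr (- \<gamma>)) has_real_derivative
      (if z \<le> 1 then - \<gamma> * (\<Sum>j\<le>M. ((- (\<gamma> + 1)) gchoose j) * (z - 1) ^ j) else - \<gamma> * z powr (- (\<gamma> + 1)))) (at z)"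
  proof (rule DERIV_If_le)
    fix z :: real
    have "((\<lambda>z. \<Sum>j\<le>Suc M. ((- \<gamma>) gchoose j) * (z - 1) ^ j) has_real_derivative
        (\<Sum>j\<le>Suc M. ((- \<gamma>) gchoose j) * (real j * (z - 1) ^ (j - 1)))) (at z)"
      by (intro DERIV_sum) (auto intro!: derivative_eq_intros)
    also have "(\<Sum>j\<le>Suc M. ((- \<gamma>) gchoose j) * (real j * (z - 1) ^ (j - 1))) =
        (\<Sum>j\<le>M. ((- \<gamma>) gchoose (Suc j)) * (real (Suc j) * (z - 1) ^ j))"
      by (subst sum.atMost_Suc_shift) simp
    also have "\<dots> = - \<gamma> * (\<Sum>j\<le>M. ((- (\<gamma> + 1)) gchoose j) * (z - 1) ^ j)"
      unfolding sum_distrib_left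
    proof (rule sum.cong)
      fix j
      have "((- \<gamma>) gchoose (Suc j)) * (real (Suc j) * (z - 1) ^ j) = (real (Suc j) * ((- \<gamma>) gchoose (Suc j))) * (z - 1) ^ j"
        by (simp only: mult_ac)
      also have "real (Suc j) * ((- \<gamma>) gchoose (Suc j)) = - \<gamma> * ((- \<gamma> - 1) gchoose j)"
        by (rule gbinomial_absorption)
      finally show "((- \<gamma>) gchoose (Suc j)) * (real (Suc j) * (z - 1) ^ j) = - \<gamma> * ((- (\<gamma> + 1) gchoose j) * (z - 1) ^ j)"
        by (simp add: mult.assoc)
    qed simp
    finally show "((\<lambda>z. \<Sum>j\<le>Suc M. ((- \<gamma>) gchoose j) * (z - 1) ^ j) has_real_derivative
        - \<gamma> * (\<Sum>j\<le>M. ((- (\<gamma> + 1)) gchoose j) * (z - 1) ^ j)) (at z)" .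
  next
    fix z :: real assume "z \<ge> 1"
    then show "((\<lambda>z. z powr (- \<gamma>)) has_real_derivative - \<gamma> * z powr (- (\<gamma> + 1))) (at z)"
      using has_real_derivative_powr[of z "- \<gamma>"] by (simp add: minus_diff_commute)
  qed (simp_all add: s)
  then show ?thesis unfolding taylor_powr_def[abs_def] by (simp add: if_distrib cong: if_cong)
qed

lemma continuous_taylor_powr: "continuous_on UNIV (taylor_powr \<gamma> M)"
proof -
  have s: "(\<Sum>j\<le>N. c j * (0::real) ^ j) = c 0" for N and c :: "nat \<Rightarrow> real"
    by (induction N) auto
  have "continuous_on ({..1} \<union> {1..}) (taylor_powr \<gamma> M)"
    unfolding taylor_powr_def[abs_def]
    by (rule continuous_on_cases) (auto intro!: continuous_intros simp: s)
  moreover have "{..1} \<union> {1..} = (UNIV :: real set)" by auto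
  ultimately show ?thesis by simp
qed

lemma taylor_powr_bound:
  assumes "\<gamma> \<ge> 0"
  shows "\<exists>C>0. \<forall>y::real^'n::finite. \<bar>taylor_powr \<gamma> M (y \<bullet> y)\<bar> \<le> C * (1 + norm y) powr (- 2 * \<gamma>)"
proof -
  define S where "S = (\<Sum>j\<le>M. \<bar>(- \<gamma>) gchoose j\<bar>)"
  have S: "S \<ge> 0" unfolding S_def by (rule sum_nonneg) auto
  show ?thesis
  proof (intro exI[of _ "(S + 1) * 2 powr (2 * \<gamma>)"] conjI allI)
    show "(S + 1) * 2 powr (2 * \<gamma>) > 0" using S by simp
    fix y :: "real^'n"
    have yy: "y \<bullet> y = (norm y)\<^sup>2" by (simp add: power2_norm_eq_inner)
    show "\<bar>taylor_powr \<gamma> M (y \<bullet> y)\<bar> \<le> (S + 1) * 2 powr (2 * \<gamma>) * (1 + norm y) powr (- 2 * \<gamma>)"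
    proof (cases "norm y \<le> 1")
      case True
      then have z: "(norm y)\<^sup>2 \<le> 1" by (simp add: power_le_one)
      have "\<bar>taylor_powr \<gamma> M (y \<bullet> y)\<bar> \<le> S"
        unfolding taylor_powr_def S_def yy if_P[OF z]
      proof (rule order_trans[OF sum_abs sum_mono])
        fix j
        have "\<bar>(norm y)\<^sup>2 - 1\<bar> ^ j \<le> 1" using z by (intro power_le_one) auto
        then show "\<bar>(- \<gamma> gchoose j) * ((norm y)\<^sup>2 - 1) ^ j\<bar> \<le> \<bar>- \<gamma> gchoose j\<bar>"
          by (simp add: abs_mult power_abs mult_left_le)
      qed
      also have "\<dots> \<le> (S + 1) * (2 powr (2 * \<gamma>) * 2 powr (- 2 * \<gamma>))"
        by (simp add: powr_add[symmetric])
      also have "\<dots> \<le> (S + 1) * (2 powr (2 * \<gamma>) * (1 + norm y) powr (- 2 * \<gamma>))"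
        using True S assms by (intro mult_left_mono powr_mono2') (auto simp: add_pos_nonneg)
      finally show ?thesis by (simp add: mult.assoc)
    next
      case False
      then have z: "\<not> (norm y)\<^sup>2 \<le> 1" by (simp add: power_le_one_iff)
      have "(norm y)\<^sup>2 powr (- \<gamma>) = norm y powr (- 2 * \<gamma>)"
        using False by (simp add: powr_numeral[symmetric] powr_powr del: powr_numeral)
      then have "\<bar>taylor_powr \<gamma> M (y \<bullet> y)\<bar> = norm y powr (- 2 * \<gamma>)"
        unfolding taylor_powr_def yy if_not_P[OF z] by simp
      also have "\<dots> = 2 powr (2 * \<gamma>) * (2 * norm y) powr (- 2 * \<gamma>)"
        by (simp add: powr_mult powr_add[symmetric] mult.assoc[symmetric])
      also have "\<dots> \<le> 2 powr (2 * \<gamma>) * (1 + norm y) powr (- 2 * \<gamma>)"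
        using False assms by (intro mult_left_mono powr_mono2') (auto simp: add_pos_nonneg)
      also have "\<dots> \<le> (S + 1) * (2 powr (2 * \<gamma>) * (1 + norm y) powr (- 2 * \<gamma>))"
        using S mult_right_mono[of 1 "S + 1" "2 powr (2 * \<gamma>) * (1 + norm y) powr (- 2 * \<gamma>)"] by simp
      finally show ?thesis by (simp add: mult.assoc)
    qed
  qed
qed

text \<open>Members of \<open>ker_class \<gamma> M\<close> have \<open>M\<close> derivatives, all of size \<open>(1 + |y|) powr (- 2 * \<gamma>)\<close>.\<close>

inductive ker_class :: "real \<Rightarrow> nat \<Rightarrow> (real^'n::finite \<Rightarrow> real) \<Rightarrow> bool" where
  base: "0 \<le> \<gamma> \<Longrightarrow> ker_class \<gamma> M (\<lambda>y. taylor_powr \<gamma> M (y \<bullet> y))"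
| coord: "ker_class \<gamma> M F \<Longrightarrow> ker_class (\<gamma> - 1/2) M (\<lambda>y. y $ i * F y)"
| add: "ker_class \<gamma> M F \<Longrightarrow> ker_class \<gamma> M G \<Longrightarrow> ker_class \<gamma> M (\<lambda>y. F y + G y)"
| cmult: "ker_class \<gamma> M F \<Longrightarrow> ker_class \<gamma> M (\<lambda>y. c * F y)"
| weaken: "ker_class \<gamma> M F \<Longrightarrow> \<gamma>' \<le> \<gamma> \<Longrightarrow> ker_class \<gamma>' M F"
| less_smooth: "ker_class \<gamma> (Suc M) F \<Longrightarrow> ker_class \<gamma> M F"

lemma ker_class_continuous: "ker_class \<gamma> M F \<Longrightarrow> continuous_on UNIV F"
proof (induction rule: ker_class.induct)
  case (base \<gamma> M)
  show ?case by (intro continuous_on_compose2[OF continuous_taylor_powr] continuous_intros) auto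
qed (auto intro!: continuous_intros)

lemma ker_class_bound:
  "ker_class \<gamma> M (F :: real^'n::finite \<Rightarrow> real) \<Longrightarrow> \<exists>C>0. \<forall>y. \<bar>F y\<bar> \<le> C * (1 + norm y) powr (- 2 * \<gamma>)"
proof (induction rule: ker_class.induct)
  case (base \<gamma> M) then show ?case by (rule taylor_powr_bound)
next
  case (coord \<gamma> M F i)
  then obtain C where C: "C > 0" "\<And>y. \<bar>F y\<bar> \<le> C * (1 + norm y) powr (- 2 * \<gamma>)" by blast
  have "\<bar>y $ i * F y\<bar> \<le> C * (1 + norm y) powr (- 2 * (\<gamma> - 1/2))" for y
  proof -
    have "\<bar>y $ i\<bar> \<le> 1 + norm y" using component_le_norm_cart[of y i] by simp
    then have "\<bar>y $ i * F y\<bar> \<le> (1 + norm y) * (C * (1 + norm y) powr (- 2 * \<gamma>))"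
      unfolding abs_mult using C(2)[of y] by (intro mult_mono) auto
    also have "\<dots> = C * (1 + norm y) powr (1 + - 2 * \<gamma>)"
      by (subst powr_mult_base[symmetric]) auto
    also have "1 + - 2 * \<gamma> = - 2 * (\<gamma> - 1/2)" by simp
    finally show ?thesis .
  qed
  with C(1) show ?case by blast
next
  case (add \<gamma> M F G)
  then obtain C D where C: "C > 0" "\<And>y. \<bar>F y\<bar> \<le> C * (1 + norm y) powr (- 2 * \<gamma>)"
    and D: "D > 0" "\<And>y. \<bar>G y\<bar> \<le> D * (1 + norm y) powr (- 2 * \<gamma>)" by blast
  have "\<bar>F y + G y\<bar> \<le> (C + D) * (1 + norm y) powr (- 2 * \<gamma>)" for y
    using C(2)[of y] D(2)[of y] abs_triangle_ineq[of "F y" "G y"] by (simp only: distrib_right)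
  moreover have "C + D > 0" using C(1) D(1) by simp
  ultimately show ?case by blast
next
  case (cmult \<gamma> M F c)
  then obtain C where C: "C > 0" "\<And>y. \<bar>F y\<bar> \<le> C * (1 + norm y) powr (- 2 * \<gamma>)" by blast
  have "\<bar>c * F y\<bar> \<le> ((\<bar>c\<bar> + 1) * C) * (1 + norm y) powr (- 2 * \<gamma>)" for y
    unfolding abs_mult mult.assoc using C by (intro mult_mono) auto
  moreover have "(\<bar>c\<bar> + 1) * C > 0" using C(1) by simp
  ultimately show ?case by blast
next
  case (weaken \<gamma> M F \<gamma>')
  then obtain C where C: "C > 0" "\<And>y. \<bar>F y\<bar> \<le> C * (1 + norm y) powr (- 2 * \<gamma>)" by blast
  have "\<bar>F y\<bar> \<le> C * (1 + norm y) powr (- 2 * \<gamma>')" for y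
  proof -
    have "(1 + norm y) powr (- 2 * \<gamma>) \<le> (1 + norm y) powr (- 2 * \<gamma>')"
      using weaken(2) by (intro powr_mono) auto
    from mult_left_mono[OF this, of C] show ?thesis using C(2)[of y] C(1) by linarith
  qed
  with C(1) show ?case by blast
qed

lemma DERIV_inner_line:
  "((\<lambda>t. (y + t *\<^sub>R axis i 1) \<bullet> (y + t *\<^sub>R axis i 1)) has_real_derivative 2 * y $ i) (at 0)"
proof -
  have eq: "(y + t *\<^sub>R axis i 1) \<bullet> (y + t *\<^sub>R axis i 1) = y \<bullet> y + 2 * t * y $ i + t\<^sup>2" for t :: real
    by (simp add: inner_simps inner_axis inner_axis' inner_axis_axis power2_eq_square algebra_simps)
  show ?thesis unfolding eq by (auto intro!: derivative_eq_intros)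
qed

lemma DERIV_coord_line:
  "((\<lambda>t. (y + t *\<^sub>R axis i 1) $ l) has_real_derivative (if l = i then 1 else 0)) (at 0)"
proof -
  have eq: "(y + t *\<^sub>R axis i 1) $ l = y $ l + t * (if l = i then 1 else 0)" for t :: real
    by (simp add: axis_def)
  show ?thesis unfolding eq by (auto intro!: derivative_eq_intros)
qed

text \<open>The chain rule applied to \<open>y \<bullet> y\<close> gives exponent
  \<open>\<gamma> + 1\<close> times a coordinate, which costs 1/2. The net exponent
  \<open>\<gamma> + 1/2\<close> exceeds \<open>\<gamma>\<close>, so the class with fixed
  \<open>\<gamma>\<close> is closed under differentiation. The equation \<open>N = Suc M\<close>
  keeps the order a variable for rule induction.\<close>

lemma ker_class_DERIV_aux:
  fixes F :: "real^'n::finite \<Rightarrow> real" and i :: 'n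
  shows "ker_class \<gamma> N F \<Longrightarrow> N = Suc M \<Longrightarrow>
    \<exists>D. ker_class \<gamma> M D \<and> (\<forall>y. ((\<lambda>t. F (y + t *\<^sub>R axis i 1)) has_real_derivative D y) (at 0))"
proof (induction arbitrary: M rule: ker_class.induct)
  case (base \<gamma> N)
  have "((\<lambda>t. taylor_powr \<gamma> (Suc M) ((y + t *\<^sub>R axis i 1) \<bullet> (y + t *\<^sub>R axis i 1))) has_real_derivative
      - \<gamma> * taylor_powr (\<gamma> + 1) M (y \<bullet> y) * (2 * y $ i)) (at 0)" for y :: "real^'n"
    using DERIV_chain2[OF taylor_powr_DERIV DERIV_inner_line[of y i]] by simp
  moreover have "ker_class \<gamma> M (\<lambda>y::real^'n. (- 2 * \<gamma>) * (y $ i * taylor_powr (\<gamma> + 1) M (y \<bullet> y)))"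
  proof (rule ker_class.cmult, rule ker_class.weaken)
    show "ker_class (\<gamma> + 1 - 1/2) M (\<lambda>y::real^'n. y $ i * taylor_powr (\<gamma> + 1) M (y \<bullet> y))"
      using base by (intro ker_class.coord ker_class.base) auto
  qed simp
  ultimately show ?case unfolding base(2)
    by (intro exI[of _ "\<lambda>y. (- 2 * \<gamma>) * (y $ i * taylor_powr (\<gamma> + 1) M (y \<bullet> y))"]) (simp add: mult_ac)
next
  case (coord \<gamma> N F l)
  then obtain D where D: "ker_class \<gamma> M D" "\<And>y. ((\<lambda>t. F (y + t *\<^sub>R axis i 1)) has_real_derivative D y) (at 0)" by blast
  have "((\<lambda>t. (y + t *\<^sub>R axis i 1) $ l * F (y + t *\<^sub>R axis i 1)) has_real_derivative
      (if l = i then 1 else 0) * F y + y $ l * D y) (at 0)" for y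
    using DERIV_mult[OF DERIV_coord_line[of y i l] D(2)[of y]] by (simp add: mult_ac)
  moreover have "ker_class (\<gamma> - 1/2) M (\<lambda>y. (if l = i then 1 else 0) * F y + y $ l * D y)"
    using coord.hyps coord.prems D(1)
    by (intro ker_class.add ker_class.cmult ker_class.coord ker_class.weaken[OF ker_class.less_smooth[of \<gamma>], of _ _ "\<gamma> - 1/2"]) auto
  ultimately show ?case by blast
next
  case (add \<gamma> N F G)
  then obtain D E where D: "ker_class \<gamma> M D" "\<And>y. ((\<lambda>t. F (y + t *\<^sub>R axis i 1)) has_real_derivative D y) (at 0)"
    and E: "ker_class \<gamma> M E" "\<And>y. ((\<lambda>t. G (y + t *\<^sub>R axis i 1)) has_real_derivative E y) (at 0)" by metis
  show ?case using ker_class.add[OF D(1) E(1)] DERIV_add[OF D(2) E(2)] by blast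
next
  case (cmult \<gamma> N F c)
  then obtain D where D: "ker_class \<gamma> M D" "\<And>y. ((\<lambda>t. F (y + t *\<^sub>R axis i 1)) has_real_derivative D y) (at 0)" by blast
  show ?case using ker_class.cmult[OF D(1)] DERIV_cmult[OF D(2)] by blast
next
  case (weaken \<gamma> N F \<gamma>')
  then obtain D where "ker_class \<gamma> M D" "\<And>y. ((\<lambda>t. F (y + t *\<^sub>R axis i 1)) has_real_derivative D y) (at 0)" by blast
  then show ?case using ker_class.weaken[OF _ weaken.hyps(2)] by blast
next
  case (less_smooth \<gamma> N F)
  then obtain D where "ker_class \<gamma> (Suc M) D" "\<And>y. ((\<lambda>t. F (y + t *\<^sub>R axis i 1)) has_real_derivative D y) (at 0)" by blast
  then show ?case using ker_class.less_smooth by blast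
qed

lemma DERIV_line_shift:
  fixes F :: "real^'n::finite \<Rightarrow> real"
  assumes "\<And>y. ((\<lambda>t. F (y + t *\<^sub>R axis i 1)) has_real_derivative D y) (at 0)"
  shows "((\<lambda>t. F (y + t *\<^sub>R axis i 1)) has_real_derivative D (y + t *\<^sub>R axis i 1)) (at t)"
proof -
  have "((\<lambda>s. F (y + (s + t) *\<^sub>R axis i 1)) has_real_derivative D (y + t *\<^sub>R axis i 1)) (at 0)"
    using assms[of "y + t *\<^sub>R axis i 1"] by (simp add: algebra_simps)
  then show ?thesis
    using DERIV_shift[of "\<lambda>s. F (y + s *\<^sub>R axis i 1)" "D (y + t *\<^sub>R axis i 1)" 0 t] by simp
qed

text \<open>Peetre's inequality replaces the decay in \<open>x - z\<close> by decay in
  \<open>z\<close>, uniformly for bounded \<open>x\<close>; the majorant then serves for continuity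
  and for differentiation of the convolution.\<close>

lemma ker_class_conv_dominated:
  fixes u F :: "real^'n::finite \<Rightarrow> real"
  assumes F: "ker_class (b / 2) M F" and b: "b \<ge> 0"
  shows "\<exists>C>0. \<forall>x z. norm x \<le> R \<longrightarrow> \<bar>u z * F (x - z)\<bar> \<le> C * weighted b u z"
proof -
  obtain C where C: "C > 0" "\<And>y. \<bar>F y\<bar> \<le> C * (1 + norm y) powr (- 2 * (b / 2))" using ker_class_bound[OF F] by blast
  have "\<bar>u z * F (x - z)\<bar> \<le> (C * (1 + \<bar>R\<bar>) powr b) * weighted b u z" if x: "norm x \<le> R" for x z
  proof -
    have "(1 + norm (z - x)) powr (- b) \<le> (1 + norm x) powr b * (1 + norm (x + (z - x))) powr (- b)"
      by (rule Peetre(2)[OF b])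
    also have "x + (z - x) = z" by simp
    also have "(1 + norm x) powr b * (1 + norm z) powr (- b) \<le> (1 + \<bar>R\<bar>) powr b * (1 + norm z) powr (- b)"
      using x b by (intro mult_right_mono powr_mono2) auto
    finally have 1: "(1 + norm (x - z)) powr (- b) \<le> (1 + \<bar>R\<bar>) powr b * (1 + norm z) powr (- b)"
      by (simp add: norm_minus_commute)
    have e: "- 2 * (b / 2) = - b" by simp
    have "\<bar>F (x - z)\<bar> \<le> C * ((1 + \<bar>R\<bar>) powr b * (1 + norm z) powr (- b))"
      using C(2)[of "x - z", unfolded e] mult_left_mono[OF 1, of C] C(1) by linarith
    then have "\<bar>u z\<bar> * \<bar>F (x - z)\<bar> \<le> \<bar>u z\<bar> * (C * ((1 + \<bar>R\<bar>) powr b * (1 + norm z) powr (- b)))"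
      by (rule mult_left_mono) simp
    then show ?thesis by (simp add: abs_mult mult_ac)
  qed
  moreover have "C * (1 + \<bar>R\<bar>) powr b > 0" using C(1) by (simp add: add_pos_nonneg)
  ultimately show ?thesis by blast
qed

text \<open>All derivatives fall on the kernel, so \<open>u\<close> enters through its weighted
  integral alone, without any smoothness.\<close>

lemma conv_ker_class_C_k:
  fixes u F :: "real^'n::finite \<Rightarrow> real"
  assumes F: "ker_class (b / 2) M F" and b: "b \<ge> 0" and um [measurable]: "u \<in> borel_measurable borel"
    and W: "integrable lborel (weighted b u)"
  shows "(\<lambda>x. \<integral>z. u z * F (x - z) \<partial>lborel) \<in> C_k M"
proof (rule C_k_coinduct[where P = "\<lambda>M G. \<exists>F. ker_class (b / 2) M F \<and> G = (\<lambda>x. \<integral>z. u z * F (x - z) \<partial>lborel)"])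
  show "\<exists>Fa. ker_class (b / 2) M Fa \<and> (\<lambda>x. \<integral>z. u z * F (x - z) \<partial>lborel) = (\<lambda>x. \<integral>z. u z * Fa (x - z) \<partial>lborel)"
    using F by blast
next
  fix k and G :: "real^'n \<Rightarrow> real"
  assume "\<exists>F. ker_class (b / 2) k F \<and> G = (\<lambda>x. \<integral>z. u z * F (x - z) \<partial>lborel)"
  then obtain F where F: "ker_class (b / 2) k F" and G: "G = (\<lambda>x. \<integral>z. u z * F (x - z) \<partial>lborel)" by blast
  have cF: "continuous_on UNIV F" using F by (rule ker_class_continuous)
  have [measurable]: "F \<in> borel_measurable borel" using cF by (rule borel_measurable_continuous_onI)
  show "continuous_on UNIV G" unfolding G
  proof (rule continuous_on_integral_dominated)
    show "(\<lambda>z. u z * F (x - z)) \<in> borel_measurable lborel" for x by measurable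
    show "continuous_on UNIV (\<lambda>x. u z * F (x - z))" for z
      by (intro continuous_intros continuous_on_compose2[OF cF]) auto
    fix x0 :: "real^'n"
    obtain C where C: "C > 0" "\<And>x z. norm x \<le> norm x0 + 1 \<Longrightarrow> \<bar>u z * F (x - z)\<bar> \<le> C * weighted b u z"
      using ker_class_conv_dominated[OF F b, of "norm x0 + 1" u] by blast
    have "norm x \<le> norm x0 + 1" if "x \<in> ball x0 1" for x
      using that norm_triangle_ineq2[of x x0] by (simp add: dist_norm norm_minus_commute)
    then have "\<forall>x\<in>ball x0 1. \<forall>z\<in>space lborel. \<bar>u z * F (x - z)\<bar> \<le> C * weighted b u z"
      using C(2) by blast
    with integrable_mult_right[OF W, of C] zero_less_one
    show "\<exists>d>0. \<exists>g. integrable lborel g \<and> (\<forall>x\<in>ball x0 d. \<forall>z\<in>space lborel. \<bar>u z * F (x - z)\<bar> \<le> g z)"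
      by blast
  qed
next
  fix k and G :: "real^'n \<Rightarrow> real"
  assume "\<exists>F. ker_class (b / 2) (Suc k) F \<and> G = (\<lambda>x. \<integral>z. u z * F (x - z) \<partial>lborel)"
  then obtain F where F: "ker_class (b / 2) (Suc k) F" and G: "G = (\<lambda>x. \<integral>z. u z * F (x - z) \<partial>lborel)" by blast
  have cF: "continuous_on UNIV F" using F by (rule ker_class_continuous)
  have Fm [measurable]: "F \<in> borel_measurable borel" using cF by (rule borel_measurable_continuous_onI)
  have "\<exists>D. ker_class (b / 2) k D \<and> (\<forall>y. ((\<lambda>t. F (y + t *\<^sub>R axis i 1)) has_real_derivative D y) (at 0))" for i
    by (rule ker_class_DERIV_aux[OF F refl])
  then obtain D where D: "\<And>i. ker_class (b / 2) k (D i)"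
    "\<And>i y. ((\<lambda>t. F (y + t *\<^sub>R axis i 1)) has_real_derivative D i y) (at 0)" by metis
  have der: "((\<lambda>t. G (x + t *\<^sub>R axis i 1)) has_real_derivative (\<integral>z. u z * D i (x - z) \<partial>lborel)) (at 0)" for x i
  proof -
    have [measurable]: "D i \<in> borel_measurable borel"
      by (rule borel_measurable_continuous_onI[OF ker_class_continuous[OF D(1)]])
    obtain C where C: "C > 0" "\<And>y z. norm y \<le> norm x + 1 \<Longrightarrow> \<bar>u z * D i (y - z)\<bar> \<le> C * weighted b u z"
      using ker_class_conv_dominated[OF D(1) b, of "norm x + 1" u] by blast
    obtain C' where C': "C' > 0" "\<And>y z. norm y \<le> norm x + 1 \<Longrightarrow> \<bar>u z * F (y - z)\<bar> \<le> C' * weighted b u z"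
      using ker_class_conv_dominated[OF F b, of "norm x + 1" u] by blast
    have nx: "norm (x + t *\<^sub>R axis i 1) \<le> norm x + 1" if "\<bar>t - 0\<bar> < 1" for t :: real
      using that norm_triangle_ineq[of x "t *\<^sub>R axis i 1"] by simp
    have "((\<lambda>t. \<integral>z. u z * F (x + t *\<^sub>R axis i 1 - z) \<partial>lborel) has_real_derivative
        (\<integral>z. u z * D i (x + 0 *\<^sub>R axis i 1 - z) \<partial>lborel)) (at 0)"
    proof (rule has_real_derivative_integral_dominated[where d = 1 and F' = "\<lambda>t z. u z * D i (x + t *\<^sub>R axis i 1 - z)" and g = "\<lambda>z. C * weighted b u z"])
      fix t :: real assume t: "\<bar>t - 0\<bar> < 1"
      show "integrable lborel (\<lambda>z. u z * F (x + t *\<^sub>R axis i 1 - z))"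
        by (rule Bochner_Integration.integrable_bound[OF integrable_mult_right[OF W, of C']])
          (use C'(2)[OF nx[OF t]] in \<open>auto intro!: AE_I2 order_trans[OF _ abs_ge_self]\<close>)
      fix z :: "real^'n"
      show "\<bar>u z * D i (x + t *\<^sub>R axis i 1 - z)\<bar> \<le> C * weighted b u z" by (rule C(2)[OF nx[OF t]])
      show "((\<lambda>t. u z * F (x + t *\<^sub>R axis i 1 - z)) has_real_derivative u z * D i (x + t *\<^sub>R axis i 1 - z)) (at t)"
        using DERIV_cmult[OF DERIV_line_shift[OF D(2), where y = "x - z"], of "u z"] by (simp add: algebra_simps)
    qed (use W in auto)
    then show ?thesis unfolding G by simp
  qed
  show "has_partial_derivatives G \<and> (\<forall>i. \<exists>F. ker_class (b / 2) k F \<and> partial_derivative i G = (\<lambda>x. \<integral>z. u z * F (x - z) \<partial>lborel))"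
  proof (intro conjI allI)
    show "has_partial_derivatives G" by (rule has_partial_derivativesI[OF der])
    fix i
    have "partial_derivative i G = (\<lambda>x. \<integral>z. u z * D i (x - z) \<partial>lborel)"
      by (rule ext, rule partial_derivative_eqI, rule der)
    then show "\<exists>F. ker_class (b / 2) k F \<and> partial_derivative i G = (\<lambda>x. \<integral>z. u z * F (x - z) \<partial>lborel)"
      using D(1) by blast
  qed
qed

section \<open>Local Hoelder classes and the singular part of the kernel\<close>

lemma iterated_partial_C_k: "f \<in> C_k (k + length is) \<Longrightarrow> iterated_partial is f \<in> C_k k"
proof (induction "is" arbitrary: k)
  case (Cons i "is")
  then have "iterated_partial is f \<in> C_k (Suc k)" by simp
  then show ?case by (simp add: iterated_partial_Cons C_k_Suc)
qed simp

lemma C_Hoelder_loc_partial: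
  assumes w: "w \<in> C_Hoelder_loc (Suc k) \<gamma>"
  shows "partial_derivative i w \<in> C_Hoelder_loc k \<gamma>"
  unfolding C_Hoelder_loc_def
proof (intro CollectI conjI allI impI)
  show "partial_derivative i w \<in> C_k k" using w unfolding C_Hoelder_loc_def C_k_Suc by blast
  fix "is" :: "'a list" assume "length is = k"
  then have "length (is @ [i]) = Suc k" by simp
  then have "locally_Hoelder \<gamma> (iterated_partial (is @ [i]) w)" using w unfolding C_Hoelder_loc_def by blast
  then show "locally_Hoelder \<gamma> (iterated_partial is (partial_derivative i w))" by (simp only: iterated_partial_snoc)
qed

lemma C_1_locally_Hoelder:
  fixes f :: "real^'n::finite \<Rightarrow> real"
  assumes f: "f \<in> C_k (Suc 0)" and \<gamma>: "0 < \<gamma>" "\<gamma> \<le> 1"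
  shows "locally_Hoelder \<gamma> f"
  unfolding locally_Hoelder_def
proof (intro allI impI)
  fix K :: "(real^'n) set" assume "compact K"
  then obtain R where R: "R > 0" "\<And>x. x \<in> K \<Longrightarrow> norm x \<le> R" using compact_imp_bounded[of K] by (auto simp: bounded_pos)
  have "\<exists>B\<ge>0. \<forall>x. norm x \<le> R \<longrightarrow> \<bar>partial_derivative i f x\<bar> \<le> B" for i
    using f by (intro continuous_bounded_on_cball) (auto simp: C_k_Suc C_k_0)
  then obtain B where B: "\<And>i. B i \<ge> 0" "\<And>i x. norm x \<le> R \<Longrightarrow> \<bar>partial_derivative i f x\<bar> \<le> B i" by metis
  define B0 where "B0 = (\<Sum>i\<in>UNIV. B i)"
  have B0: "B i \<le> B0" "B0 \<ge> 0" for i unfolding B0_def using B(1) by (auto intro: member_le_sum sum_nonneg)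
  show "\<exists>C. \<forall>x\<in>K. \<forall>y\<in>K. \<bar>f x - f y\<bar> \<le> C * dist x y powr \<gamma>"
  proof (intro exI ballI)
    fix x y assume xy: "x \<in> K" "y \<in> K"
    have "\<bar>f x - f y\<bar> \<le> real CARD('n) * B0 * norm (x - y)"
    proof (rule C_1_diff_bound[OF f])
      fix i z assume "z \<in> closed_segment y x"
      moreover have "closed_segment y x \<subseteq> cball 0 R" using R xy by (intro closed_segment_subset) auto
      ultimately show "\<bar>partial_derivative i f z\<bar> \<le> B0" using B(2)[of z i] B0(1)[of i] by auto
    qed
    \<comment> \<open>The surplus power \<open>1 - \<gamma>\<close> of the distance is absorbed by
      the diameter of the ball.\<close>
    also have "norm (x - y) \<le> (2 * R) powr (1 - \<gamma>) * dist x y powr \<gamma>"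
    proof (cases "x = y")
      case False
      have "norm (x - y) \<le> 2 * R" using R(2)[OF xy(1)] R(2)[OF xy(2)] norm_triangle_ineq4[of x y] by linarith
      then have "norm (x - y) powr (1 - \<gamma>) * norm (x - y) powr \<gamma> \<le> (2 * R) powr (1 - \<gamma>) * dist x y powr \<gamma>"
        using \<gamma> by (intro mult_mono powr_mono2) (auto simp: dist_norm)
      then show ?thesis using False by (simp add: powr_add[symmetric])
    qed simp
    then have "real CARD('n) * B0 * norm (x - y) \<le> real CARD('n) * B0 * ((2 * R) powr (1 - \<gamma>) * dist x y powr \<gamma>)"
      using B0(2) by (intro mult_left_mono) auto
    finally show "\<bar>f x - f y\<bar> \<le> (real CARD('n) * B0 * (2 * R) powr (1 - \<gamma>)) * dist x y powr \<gamma>" by (simp add: mult.assoc)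
  qed
qed

text \<open>The Hoelder condition is imposed on the top derivatives, but
  \<open>near_form_C_k\<close> needs second-difference bounds for the function itself and for each
  of its intermediate derivatives.\<close>

lemma C_Hoelder_loc_lower:
  assumes w: "w \<in> C_Hoelder_loc (k + M) \<gamma>" and \<gamma>: "0 < \<gamma>" "\<gamma> \<le> 1"
  shows "w \<in> C_Hoelder_loc k \<gamma>"
  using w
proof (induction M)
  case (Suc M)
  then have w: "w \<in> C_k (Suc (k + M))" by (simp add: C_Hoelder_loc_def)
  have "w \<in> C_Hoelder_loc (k + M) \<gamma>"
    unfolding C_Hoelder_loc_def
  proof (intro CollectI conjI allI impI)
    show "w \<in> C_k (k + M)" using w by (rule C_k_mono) simp
    fix "is" :: "'a list" assume "length is = k + M"
    then show "locally_Hoelder \<gamma> (iterated_partial is w)"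
      using w \<gamma> by (intro C_1_locally_Hoelder iterated_partial_C_k) auto
  qed
  then show ?case by (rule Suc.IH)
qed simp

text \<open>With \<open>a\<close> the integer part of \<open>\<alpha>\<close> and
  \<open>\<gamma> = frac \<alpha> + \<epsilon>\<close>, the exponent is
  \<open>\<alpha> + \<epsilon>\<close> and thus beats the singularity of the kernel by
  \<open>\<epsilon>\<close>. For \<open>a = 1\<close> the additional power is the one gained in
  \<open>sdiff_C1_bound\<close>.\<close>

lemma Hoelder_sdiff_local:
  fixes w :: "real^'n::finite \<Rightarrow> real"
  assumes w: "w \<in> C_Hoelder_loc a \<gamma>" and a: "a \<le> 1" and \<gamma>: "0 < \<gamma>" "\<gamma> \<le> 1"
  shows "\<exists>C\<ge>0. \<forall>x y. norm x \<le> R \<and> norm y \<le> 1 \<longrightarrow> \<bar>sdiff w x y\<bar> \<le> C * norm y powr (real a + \<gamma>)"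
proof -
  have H: "\<exists>C\<ge>0. \<forall>x y. norm x \<le> \<bar>R\<bar> + 1 \<and> norm y \<le> \<bar>R\<bar> + 1 \<longrightarrow> \<bar>f x - f y\<bar> \<le> C * norm (x - y) powr \<gamma>"
    if "locally_Hoelder \<gamma> f" for f :: "real^'n \<Rightarrow> real"
  proof -
    obtain C where C: "\<And>x y. x \<in> cball 0 (\<bar>R\<bar> + 1) \<Longrightarrow> y \<in> cball 0 (\<bar>R\<bar> + 1) \<Longrightarrow> \<bar>f x - f y\<bar> \<le> C * dist x y powr \<gamma>"
      using \<open>locally_Hoelder \<gamma> f\<close> unfolding locally_Hoelder_def by (meson compact_cball)
    have "C * d powr \<gamma> \<le> \<bar>C\<bar> * d powr \<gamma>" for d by (intro mult_right_mono) auto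
    then have "\<bar>f x - f y\<bar> \<le> \<bar>C\<bar> * norm (x - y) powr \<gamma>" if "norm x \<le> \<bar>R\<bar> + 1" "norm y \<le> \<bar>R\<bar> + 1" for x y
      using C[of x y] that by (auto simp: dist_norm intro: order_trans)
    then show ?thesis using abs_ge_zero by blast
  qed
  have bd: "norm (x + z) \<le> \<bar>R\<bar> + 1" if "norm x \<le> R" "norm z \<le> 1" for x z :: "real^'n"
    using that norm_triangle_ineq[of x z] by linarith
  consider "a = 0" | "a = 1" using a by linarith
  then show ?thesis
  proof cases
    case 1
    then have "locally_Hoelder \<gamma> w" using w by (auto simp: C_Hoelder_loc_def dest: spec[of _ "[]"])
    from H[OF this] obtain C where C: "C \<ge> 0"
      "\<And>x y. norm x \<le> \<bar>R\<bar> + 1 \<Longrightarrow> norm y \<le> \<bar>R\<bar> + 1 \<Longrightarrow> \<bar>w x - w y\<bar> \<le> C * norm (x - y) powr \<gamma>" by blast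
    show ?thesis
    proof (intro exI[of _ "2 * C"] conjI allI impI)
      fix x y :: "real^'n" assume xy: "norm x \<le> R \<and> norm y \<le> 1"
      have "\<bar>w x - w (x + y)\<bar> \<le> C * norm (x - (x + y)) powr \<gamma>" "\<bar>w x - w (x + - y)\<bar> \<le> C * norm (x - (x + - y)) powr \<gamma>"
        using xy bd[of x 0] bd[of x y] bd[of x "- y"] by (intro C(2); simp)+
      then show "\<bar>sdiff w x y\<bar> \<le> 2 * C * norm y powr (real a + \<gamma>)" by (simp add: sdiff_def 1)
    qed (use C in auto)
  next
    case 2
    have w1: "w \<in> C_k (Suc 0)" using w 2 by (simp add: C_Hoelder_loc_def)
    have "locally_Hoelder \<gamma> (partial_derivative i w)" for i
      using w 2 by (auto simp: C_Hoelder_loc_def iterated_partial_Cons dest: spec[of _ "[i]"])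
    then have "\<exists>C\<ge>0. \<forall>x y. norm x \<le> \<bar>R\<bar> + 1 \<and> norm y \<le> \<bar>R\<bar> + 1 \<longrightarrow> \<bar>partial_derivative i w x - partial_derivative i w y\<bar> \<le> C * norm (x - y) powr \<gamma>" for i
      by (rule H)
    then obtain C where C: "\<And>i. C i \<ge> 0"
      "\<And>i x y. norm x \<le> \<bar>R\<bar> + 1 \<Longrightarrow> norm y \<le> \<bar>R\<bar> + 1 \<Longrightarrow> \<bar>partial_derivative i w x - partial_derivative i w y\<bar> \<le> C i * norm (x - y) powr \<gamma>"
      by metis
    define C0 where "C0 = (\<Sum>i\<in>UNIV. C i)"
    have C0: "C i \<le> C0" "C0 \<ge> 0" for i unfolding C0_def using C(1) by (auto intro: member_le_sum sum_nonneg)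
    show ?thesis
    proof (intro exI[of _ "real CARD('n) * (C0 * 2 powr \<gamma>)"] conjI allI impI)
      show "0 \<le> real CARD('n) * (C0 * 2 powr \<gamma>)" using C0(2) by simp
      fix x y :: "real^'n" assume xy: "norm x \<le> R \<and> norm y \<le> 1"
      have "\<bar>sdiff w x y\<bar> \<le> real CARD('n) * (C0 * (2 * norm y) powr \<gamma>) * norm y"
      proof (rule sdiff_C1_bound[OF w1])
        fix i and s :: real assume s: "0 \<le> s" "s \<le> 1"
        have sy: "norm (s *\<^sub>R y) \<le> norm y" using s by (simp add: mult_left_le_one_le)
        have "\<bar>partial_derivative i w (x + s *\<^sub>R y) - partial_derivative i w (x - s *\<^sub>R y)\<bar>
            \<le> C i * norm (x + s *\<^sub>R y - (x - s *\<^sub>R y)) powr \<gamma>"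
          using xy sy bd[of x "s *\<^sub>R y"] bd[of x "- (s *\<^sub>R y)"] by (intro C(2)) auto
        also have "norm (x + s *\<^sub>R y - (x - s *\<^sub>R y)) = 2 * norm (s *\<^sub>R y)"
        proof -
          have "x + s *\<^sub>R y - (x - s *\<^sub>R y) = 2 *\<^sub>R (s *\<^sub>R y)" unfolding scaleR_2 by simp
          then show ?thesis by (simp add: abs_mult)
        qed
        also have "C i * (2 * norm (s *\<^sub>R y)) powr \<gamma> \<le> C0 * (2 * norm y) powr \<gamma>"
          using C0(1)[of i] C0(2) C(1)[of i] sy \<gamma> by (intro mult_mono powr_mono2) auto
        finally show "\<bar>partial_derivative i w (x + s *\<^sub>R y) - partial_derivative i w (x - s *\<^sub>R y)\<bar> \<le> C0 * (2 * norm y) powr \<gamma>" .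
      qed
      also have "(2 * norm y) powr \<gamma> * norm y = 2 powr \<gamma> * norm y powr (real a + \<gamma>)"
        by (cases "y = 0") (auto simp: powr_mult powr_add 2)
      then  have "real CARD('n) * (C0 * (2 * norm y) powr \<gamma>) * norm y = real CARD('n) * (C0 * 2 powr \<gamma>) * norm y powr (real a + \<gamma>)"
        by (simp only: mult.assoc)
      finally show "\<bar>sdiff w x y\<bar> \<le> real CARD('n) * (C0 * 2 powr \<gamma>) * norm y powr (real a + \<gamma>)" .
    qed
  qed
qed

text \<open>As \<open>K\<close> is supported in the unit ball, only the local regularity of \<open>w\<close> matters.\<close>

lemma near_form_C_k:
  fixes w K :: "real^'n::finite \<Rightarrow> real"
  assumes w: "w \<in> C_Hoelder_loc (M + a) \<gamma>" and a: "a \<le> 1" and \<gamma>: "0 < \<gamma>" "\<gamma> \<le> 1"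
    and Km [measurable]: "K \<in> borel_measurable borel"
    and K: "integrable lborel (\<lambda>y. norm y powr (real a + \<gamma>) * \<bar>K y\<bar>)"
    and supp: "\<And>y. norm y > 1 \<Longrightarrow> K y = 0"
  shows "(\<lambda>x. \<integral>y. sdiff w x y * K y \<partial>lborel) \<in> C_k M"
proof (rule C_k_coinduct[where P = "\<lambda>M G. \<exists>w. w \<in> C_Hoelder_loc (M + a) \<gamma> \<and> G = (\<lambda>x. \<integral>y. sdiff w x y * K y \<partial>lborel)"])
  show "\<exists>w'. w' \<in> C_Hoelder_loc (M + a) \<gamma> \<and> (\<lambda>x. \<integral>y. sdiff w x y * K y \<partial>lborel) = (\<lambda>x. \<integral>y. sdiff w' x y * K y \<partial>lborel)"
    using w by blast
next
  have dom: "\<exists>C\<ge>0. \<forall>x y. norm x \<le> R \<longrightarrow> \<bar>sdiff w x y * K y\<bar> \<le> C * (norm y powr (real a + \<gamma>) * \<bar>K y\<bar>)"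
    if w: "w \<in> C_Hoelder_loc (k + a) \<gamma>" for k w R
  proof -
    have "w \<in> C_Hoelder_loc a \<gamma>" using w \<gamma> by (intro C_Hoelder_loc_lower[of w a k]) (auto simp: add.commute)
    from Hoelder_sdiff_local[OF this a \<gamma>, of R] obtain C where C: "C \<ge> 0"
      "\<And>x y. norm x \<le> R \<Longrightarrow> norm y \<le> 1 \<Longrightarrow> \<bar>sdiff w x y\<bar> \<le> C * norm y powr (real a + \<gamma>)" by blast
    have "\<bar>sdiff w x y * K y\<bar> \<le> C * (norm y powr (real a + \<gamma>) * \<bar>K y\<bar>)" if "norm x \<le> R" for x y
    proof (cases "norm y \<le> 1")
      case True
      from mult_right_mono[OF C(2)[OF that True], of "\<bar>K y\<bar>"] show ?thesis by (simp add: abs_mult mult.assoc)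
    qed (simp add: supp)
    with C(1) show ?thesis by blast
  qed
  {
    fix k and G :: "real^'n \<Rightarrow> real"
    assume "\<exists>w. w \<in> C_Hoelder_loc (k + a) \<gamma> \<and> G = (\<lambda>x. \<integral>y. sdiff w x y * K y \<partial>lborel)"
    then obtain w where w: "w \<in> C_Hoelder_loc (k + a) \<gamma>" and G: "G = (\<lambda>x. \<integral>y. sdiff w x y * K y \<partial>lborel)" by blast
    have cw: "continuous_on UNIV w" using w by (auto simp: C_Hoelder_loc_def intro: C_k_continuous)
    have [measurable]: "w \<in> borel_measurable borel" using cw by (rule borel_measurable_continuous_onI)
    show "continuous_on UNIV G" unfolding G
    proof (rule continuous_on_integral_dominated)
      show "(\<lambda>y. sdiff w x y * K y) \<in> borel_measurable lborel" for x by measurable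
      show "continuous_on UNIV (\<lambda>x. sdiff w x y * K y)" for y
        by (intro continuous_intros continuous_sdiff cw)
      fix x0 :: "real^'n"
      obtain C where C: "C \<ge> 0" "\<And>x y. norm x \<le> norm x0 + 1 \<Longrightarrow> \<bar>sdiff w x y * K y\<bar> \<le> C * (norm y powr (real a + \<gamma>) * \<bar>K y\<bar>)"
        using dom[OF w, of "norm x0 + 1"] by blast
      have "norm x \<le> norm x0 + 1" if "x \<in> ball x0 1" for x
        using that norm_triangle_ineq2[of x x0] by (simp add: dist_norm norm_minus_commute)
      then have "\<forall>x\<in>ball x0 1. \<forall>y\<in>space lborel. \<bar>sdiff w x y * K y\<bar> \<le> C * (norm y powr (real a + \<gamma>) * \<bar>K y\<bar>)"
        using C(2) by blast
      with integrable_mult_right[OF K, of C] zero_less_one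
      show "\<exists>d>0. \<exists>g. integrable lborel g \<and> (\<forall>x\<in>ball x0 d. \<forall>y\<in>space lborel. \<bar>sdiff w x y * K y\<bar> \<le> g y)"
        by blast
    qed
  }
  fix k and G :: "real^'n \<Rightarrow> real"
  assume "\<exists>w. w \<in> C_Hoelder_loc (Suc k + a) \<gamma> \<and> G = (\<lambda>x. \<integral>y. sdiff w x y * K y \<partial>lborel)"
  then obtain w where w: "w \<in> C_Hoelder_loc (Suc k + a) \<gamma>" and G: "G = (\<lambda>x. \<integral>y. sdiff w x y * K y \<partial>lborel)" by blast
  have wk: "w \<in> C_k (Suc (k + a))" using w by (simp add: C_Hoelder_loc_def)
  have [measurable]: "w \<in> borel_measurable borel"
    by (rule borel_measurable_continuous_onI[OF C_k_continuous[OF wk]])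
  have dw: "partial_derivative i w \<in> C_Hoelder_loc (k + a) \<gamma>" for i
    using w by (intro C_Hoelder_loc_partial) simp
  have dwm [measurable]: "partial_derivative i w \<in> borel_measurable borel" for i
    using dw[of i] by (intro borel_measurable_continuous_onI C_k_continuous[of _ "k + a"]) (simp add: C_Hoelder_loc_def)
  \<comment> \<open>Here the derivative falls on \<open>w\<close>, not on the singular kernel; it
    uses up one of the \<open>M\<close> spare orders.\<close>
  have der: "((\<lambda>t. G (x + t *\<^sub>R axis i 1)) has_real_derivative (\<integral>y. sdiff (partial_derivative i w) x y * K y \<partial>lborel)) (at 0)" for x i
  proof -
    obtain C where C: "C \<ge> 0" "\<And>z y. norm z \<le> norm x + 1 \<Longrightarrow> \<bar>sdiff (partial_derivative i w) z y * K y\<bar> \<le> C * (norm y powr (real a + \<gamma>) * \<bar>K y\<bar>)"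
      using dom[OF dw, of "norm x + 1"] by blast
    obtain C' where C': "C' \<ge> 0" "\<And>z y. norm z \<le> norm x + 1 \<Longrightarrow> \<bar>sdiff w z y * K y\<bar> \<le> C' * (norm y powr (real a + \<gamma>) * \<bar>K y\<bar>)"
      using dom[OF w, of "norm x + 1"] by blast
    have nx: "norm (x + t *\<^sub>R axis i 1) \<le> norm x + 1" if "\<bar>t - 0\<bar> < 1" for t :: real
      using that norm_triangle_ineq[of x "t *\<^sub>R axis i 1"] by simp
    have "((\<lambda>t. \<integral>y. sdiff w (x + t *\<^sub>R axis i 1) y * K y \<partial>lborel) has_real_derivative
        (\<integral>y. sdiff (partial_derivative i w) (x + 0 *\<^sub>R axis i 1) y * K y \<partial>lborel)) (at 0)"
    proof (rule has_real_derivative_integral_dominated[where d = 1 and F' = "\<lambda>t y. sdiff (partial_derivative i w) (x + t *\<^sub>R axis i 1) y * K y"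
          and g = "\<lambda>y. C * (norm y powr (real a + \<gamma>) * \<bar>K y\<bar>)"])
      fix t :: real assume t: "\<bar>t - 0\<bar> < 1"
      show "integrable lborel (\<lambda>y. sdiff w (x + t *\<^sub>R axis i 1) y * K y)"
        by (rule Bochner_Integration.integrable_bound[OF integrable_mult_right[OF K, of C']])
          (use C'(2)[OF nx[OF t]] in \<open>auto intro!: AE_I2 order_trans[OF _ abs_ge_self]\<close>)
      fix y :: "real^'n"
      show "\<bar>sdiff (partial_derivative i w) (x + t *\<^sub>R axis i 1) y * K y\<bar> \<le> C * (norm y powr (real a + \<gamma>) * \<bar>K y\<bar>)" by (rule C(2)[OF nx[OF t]])
      have d: "((\<lambda>t. w (x + t *\<^sub>R axis i 1 + z)) has_real_derivative partial_derivative i w (x + t *\<^sub>R axis i 1 + z)) (at t)" for z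
        using C_k_DERIV(1)[OF wk[THEN C_k_mono, of "Suc 0"], of "x + z" i t] by (simp add: algebra_simps)
      have "((\<lambda>t. sdiff w (x + t *\<^sub>R axis i 1) y) has_real_derivative sdiff (partial_derivative i w) (x + t *\<^sub>R axis i 1) y) (at t)"
        using DERIV_diff[OF DERIV_diff[OF DERIV_cmult[OF d[of 0], of 2] d[of y]] d[of "- y"]] by (simp add: sdiff_def)
      then show "((\<lambda>t. sdiff w (x + t *\<^sub>R axis i 1) y * K y) has_real_derivative sdiff (partial_derivative i w) (x + t *\<^sub>R axis i 1) y * K y) (at t)"
        by (rule DERIV_cmult_right)
    qed (use K in auto)
    then show ?thesis unfolding G by simp
  qed
  show "has_partial_derivatives G \<and> (\<forall>i. \<exists>w. w \<in> C_Hoelder_loc (k + a) \<gamma> \<and> partial_derivative i G = (\<lambda>x. \<integral>y. sdiff w x y * K y \<partial>lborel))"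
  proof (intro conjI allI)
    show "has_partial_derivatives G" by (rule has_partial_derivativesI[OF der])
    fix i
    have "partial_derivative i G = (\<lambda>x. \<integral>y. sdiff (partial_derivative i w) x y * K y \<partial>lborel)"
      by (rule ext, rule partial_derivative_eqI, rule der)
    then show "\<exists>w. w \<in> C_Hoelder_loc (k + a) \<gamma> \<and> partial_derivative i G = (\<lambda>x. \<integral>y. sdiff w x y * K y \<partial>lborel)"
      using dw by blast
  qed
qed

text \<open>The kernel is neither smooth at the origin nor compactly supported, so it is split as
  \<open>K0 + K1\<close>. Against \<open>K0\<close>, supported in the unit ball, derivatives go to
  \<open>u\<close>; against the smooth tail \<open>K1\<close> they go to the kernel, since nothing
  is known about derivatives of \<open>u\<close> at infinity.\<close>

lemma frac_form_C_k:
  fixes u :: "real^'n::finite \<Rightarrow> real"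
  assumes \<alpha>: "0 < \<alpha>" "\<alpha> < 2" and \<epsilon>: "\<epsilon> > 0" "frac \<alpha> + \<epsilon> \<le> 1" and M: "M \<ge> 2"
    and u: "u \<in> C_Hoelder_loc (M + nat \<lfloor>\<alpha>\<rfloor>) (frac \<alpha> + \<epsilon>)"
    and W: "integrable lborel (weighted (real CARD('n) + \<alpha>) u)"
  shows "frac_form \<alpha> u \<in> C_k M"
proof -
  let ?b = "real CARD('n) + \<alpha>"
  define a where "a = nat \<lfloor>\<alpha>\<rfloor>"
  define \<gamma> where "\<gamma> = frac \<alpha> + \<epsilon>"
  have fl: "0 \<le> \<lfloor>\<alpha>\<rfloor>" "\<lfloor>\<alpha>\<rfloor> \<le> 1" using \<alpha> by (auto simp: floor_le_iff)
  have a: "a \<le> 1" "real a + frac \<alpha> = \<alpha>" unfolding a_def frac_def using fl by linarith+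
  have \<gamma>: "0 < \<gamma>" "\<gamma> \<le> 1" using \<epsilon> by (auto simp: \<gamma>_def add_nonneg_pos)
  have a\<gamma>: "real a + \<gamma> = \<alpha> + \<epsilon>" using a(2) by (simp add: \<gamma>_def)
  have \<epsilon>1: "\<epsilon> \<le> 1" using \<epsilon>(2) frac_ge_0[of \<alpha>] by linarith
  have u2: "u \<in> C_k 2" using u M by (auto simp: C_Hoelder_loc_def intro: C_k_mono)
  have cu: "continuous_on UNIV u" using u2 by (rule C_k_continuous)
  have um [measurable]: "u \<in> borel_measurable borel" using cu by (rule borel_measurable_continuous_onI)
  define K1 :: "real^'n \<Rightarrow> real" where "K1 y = taylor_powr (?b / 2) M (y \<bullet> y)" for y
  define K0 where "K0 y = riesz_ker \<alpha> y - K1 y" for y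
  have K1c: "ker_class (?b / 2) M K1" unfolding K1_def[abs_def] using \<alpha> by (intro ker_class.base) auto
  have cK1: "continuous_on UNIV K1" by (rule ker_class_continuous[OF K1c])
  have K1m [measurable]: "K1 \<in> borel_measurable borel" using cK1 by (rule borel_measurable_continuous_onI)
  have K0m [measurable]: "K0 \<in> borel_measurable borel" unfolding K0_def[abs_def] by measurable
  obtain B where B: "B > 0" "\<And>y. \<bar>K1 y\<bar> \<le> B * (1 + norm y) powr (- 2 * (?b / 2))" using ker_class_bound[OF K1c] by blast
  have e: "- 2 * (?b / 2) = - ?b" by simp
  have supp: "K0 y = 0" if "norm y > 1" for y
  proof -
    have "\<not> y \<bullet> y \<le> 1" using that by (simp add: power2_norm_eq_inner[symmetric] power_le_one_iff)
    moreover have "(y \<bullet> y) powr (- (?b / 2)) = norm y powr (- ?b)"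
    proof -
      have "y \<bullet> y = norm y powr 2" using that by (simp add: power2_norm_eq_inner[symmetric])
      moreover have "2 * - (?b / 2) = - ?b" by (simp add: field_simps)
      ultimately show ?thesis by (simp only: powr_powr)
    qed
    ultimately show ?thesis by (simp add: K0_def K1_def riesz_ker_def taylor_powr_def)
  qed
  have near: "(\<lambda>x. \<integral>y. sdiff u x y * K0 y \<partial>lborel) \<in> C_k M"
  proof (rule near_form_C_k[OF _ a(1) \<gamma> K0m _ supp])
    show "u \<in> C_Hoelder_loc (M + a) \<gamma>" using u by (simp add: a_def \<gamma>_def)
    show "integrable lborel (\<lambda>y. norm y powr (real a + \<gamma>) * \<bar>K0 y\<bar>)"
    proof (rule Bochner_Integration.integrable_bound)
      \<comment> \<open>In the unit ball
        \<open>norm y powr (\<alpha> + \<epsilon>) * riesz_ker \<alpha> y\<close> is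
        \<open>norm y powr (\<epsilon> - n)\<close> for \<open>y \<noteq> 0\<close>, and
        \<open>min_ker (2 - \<epsilon>)\<close> is the same power: a square times
        \<open>norm y powr (- (n + 2 - \<epsilon>))\<close>.\<close>
      show "integrable lborel (\<lambda>y::real^'n. min_ker (2 - \<epsilon>) y + B * (1 + norm y) powr (- ?b))"
        using \<epsilon> \<epsilon>1 \<alpha> by (intro Bochner_Integration.integrable_add integrable_mult_right integrable_min_riesz_ker integrable_weight) auto
      show "AE y in lborel. norm (norm (y::real^'n) powr (real a + \<gamma>) * \<bar>K0 y\<bar>) \<le> norm (min_ker (2 - \<epsilon>) y + B * (1 + norm y) powr (- ?b))"
      proof (rule AE_I2)
        fix y :: "real^'n"
        have P: "0 \<le> B * (1 + norm y) powr (- ?b)" "0 \<le> min_ker (2 - \<epsilon>) y" using B by auto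
        show "norm (norm y powr (real a + \<gamma>) * \<bar>K0 y\<bar>) \<le> norm (min_ker (2 - \<epsilon>) y + B * (1 + norm y) powr (- ?b))"
        proof (cases "norm y \<le> 1")
          case True
          have m: "min 1 ((norm y)\<^sup>2) = (norm y)\<^sup>2" using True by (simp add: min_absorb2 power_le_one)
          have 1: "norm y powr (\<alpha> + \<epsilon>) * riesz_ker \<alpha> y = min_ker (2 - \<epsilon>) y"
          proof (cases "y = 0")
            case False
            then have "(norm y)\<^sup>2 = norm y powr 2" by simp
            then show ?thesis unfolding m riesz_ker_def using False by (simp only: powr_add[symmetric]) (simp add: algebra_simps)
          qed (simp add: riesz_ker_def)
          have "norm y powr (\<alpha> + \<epsilon>) \<le> 1" using True \<alpha> \<epsilon> by (intro powr_le1) auto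
          then have 2: "norm y powr (\<alpha> + \<epsilon>) * \<bar>K1 y\<bar> \<le> 1 * (B * (1 + norm y) powr (- ?b))"
            using B(2)[of y] unfolding e by (intro mult_mono) auto
          have "\<bar>K0 y\<bar> \<le> riesz_ker \<alpha> y + \<bar>K1 y\<bar>" unfolding K0_def using riesz_ker_nonneg[of \<alpha> y] by linarith
          then have "norm y powr (\<alpha> + \<epsilon>) * \<bar>K0 y\<bar> \<le> norm y powr (\<alpha> + \<epsilon>) * (riesz_ker \<alpha> y + \<bar>K1 y\<bar>)"
            by (rule mult_left_mono) simp
          then show ?thesis using 1 2 P unfolding a\<gamma> real_norm_def distrib_left
            by (simp only: abs_mult abs_of_nonneg[OF add_nonneg_nonneg[OF P(2,1)]] abs_idempotent abs_of_nonneg[OF powr_ge_zero])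
        next
          case False then show ?thesis using supp[of y] by simp
        qed
      qed
    qed measurable
  qed
  have far: "(\<lambda>x. \<integral>z. u z * K1 (x - z) \<partial>lborel) \<in> C_k M"
    using \<alpha> by (intro conv_ker_class_C_k[OF K1c _ um W]) auto
  have iK1: "integrable lborel K1"
  proof (rule Bochner_Integration.integrable_bound[OF integrable_mult_right[OF integrable_weight[of ?b], of B]])
    show "AE y in lborel. norm (K1 y) \<le> norm (B * (1 + norm y) powr (- ?b))"
      using B(2) unfolding e by (intro AE_I2) (auto intro: order_trans[OF _ abs_ge_self])
  qed (use \<alpha> in auto)
  have iuK: "integrable lborel (\<lambda>z. u z * K1 (x - z))" for x
  proof -
    obtain C where C: "\<And>y z. norm y \<le> norm x \<Longrightarrow> \<bar>u z * K1 (y - z)\<bar> \<le> C * weighted ?b u z"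
      using ker_class_conv_dominated[OF K1c, of "norm x" u] \<alpha> by auto
    show ?thesis
      by (rule Bochner_Integration.integrable_bound[OF integrable_mult_right[OF W, of C]])
        (use C[of x] in \<open>auto intro!: AE_I2 order_trans[OF _ abs_ge_self]\<close>)
  qed
  have K1even: "K1 (- y) = K1 y" for y by (simp add: K1_def)
  \<comment> \<open>The tail \<open>K1\<close> is integrable, so its second difference may be
    expanded: a multiple of \<open>u x\<close>, and two translates that give the same convolution
    because \<open>K1\<close> is even.\<close>
  have eq: "frac_form \<alpha> u x = (\<integral>y. sdiff u x y * K0 y \<partial>lborel) + (2 * (\<integral>y. K1 y \<partial>lborel)) * u x + (- 2) * (\<integral>z. u z * K1 (x - z) \<partial>lborel)" for x
  proof -
    let ?g = "\<lambda>z. u z * K1 (x - z)"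
    have gm: "?g \<in> borel_measurable borel" by measurable
    have g1: "?g (y + x) = u (x + y) * K1 y" and g2: "?g (x - y) = u (x - y) * K1 y" for y
      using K1even[of y] by (auto simp: add.commute)
    have i1: "integrable lborel (\<lambda>y. u (x + y) * K1 y)" and I1: "(\<integral>y. u (x + y) * K1 y \<partial>lborel) = (\<integral>z. ?g z \<partial>lborel)"
      using integrable_lborel_add[OF gm, of x] integral_lborel_add[OF gm, of x] iuK[of x] unfolding g1 by auto
    have i2: "integrable lborel (\<lambda>y. u (x - y) * K1 y)" and I2: "(\<integral>y. u (x - y) * K1 y \<partial>lborel) = (\<integral>z. ?g z \<partial>lborel)"
      using integrable_lborel_sub[OF gm, of x] integral_lborel_sub[OF gm, of x] iuK[of x] unfolding g2 by auto
    have s1: "sdiff u x y * K1 y = 2 * u x * K1 y - u (x + y) * K1 y - u (x - y) * K1 y" for y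
      by (simp add: sdiff_def algebra_simps)
    have iK: "integrable lborel (\<lambda>y. 2 * u x * K1 y)" using iK1 by (rule integrable_mult_right)
    have iS1: "integrable lborel (\<lambda>y. sdiff u x y * K1 y)" unfolding s1
      by (intro Bochner_Integration.integrable_diff iK i1 i2)
    have S1: "(\<integral>y. sdiff u x y * K1 y \<partial>lborel) = 2 * u x * (\<integral>y. K1 y \<partial>lborel) - 2 * (\<integral>z. ?g z \<partial>lborel)"
      unfolding s1 using iK i1 i2 I1 I2
      by (subst Bochner_Integration.integral_diff Bochner_Integration.integral_mult_right_zero, auto)+
    have iS: "integrable lborel (\<lambda>y. sdiff u x y * riesz_ker \<alpha> y)" by (rule frac_form_integrable(1)[OF \<alpha> u2 W])
    have "(\<integral>y. sdiff u x y * K0 y \<partial>lborel) = frac_form \<alpha> u x - (\<integral>y. sdiff u x y * K1 y \<partial>lborel)"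
      unfolding frac_form_def K0_def right_diff_distrib by (rule Bochner_Integration.integral_diff[OF iS iS1])
    then show ?thesis unfolding S1 by simp
  qed
  have "u \<in> C_k M" using u by (auto simp: C_Hoelder_loc_def intro: C_k_mono)
  then show ?thesis unfolding eq[abs_def] by (intro C_k_add C_k_cmult near far)
qed

subsection \<open>Integration by parts\<close>

lemma partial_derivative_support:
  assumes "\<And>x. norm x > R \<Longrightarrow> f x = 0" "norm x > R"
  shows "partial_derivative i f x = 0"
proof (rule partial_derivative_eqI)
  have "continuous (at 0) (\<lambda>t. norm (x + t *\<^sub>R axis i 1))" by (intro continuous_intros)
  then have "((\<lambda>t. norm (x + t *\<^sub>R axis i 1)) \<longlongrightarrow> norm x) (at 0)" by (simp add: isCont_def)
  then have "eventually (\<lambda>t. norm (x + t *\<^sub>R axis i 1) > R) (at 0)" using assms(2) by (rule order_tendstoD)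
  then have "eventually (\<lambda>t. f (x + t *\<^sub>R axis i 1) = 0) (nhds 0)"
    using assms unfolding eventually_at_filter by (auto elim!: eventually_mono)
  then have "((\<lambda>t. f (x + t *\<^sub>R axis i 1)) has_real_derivative 0) (at 0) \<longleftrightarrow> ((\<lambda>t. 0) has_real_derivative 0) (at (0::real))"
    by (intro DERIV_cong_ev) auto
  then show "((\<lambda>t. f (x + t *\<^sub>R axis i 1)) has_real_derivative 0) (at 0)" by simp
qed

text \<open>The integral of a translate of \<open>\<phi> * w\<close> does not depend on the
  translation, so its derivative in direction \<open>i\<close> vanishes; the product rule under the
  integral gives the claim.\<close>

lemma integral_by_parts:
  fixes \<phi> w :: "real^'n::finite \<Rightarrow> real"
  assumes \<phi>: "\<phi> \<in> C_k (Suc 0)" and w: "w \<in> C_k (Suc 0)" and supp: "\<And>x. norm x > R \<Longrightarrow> \<phi> x = 0"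
  shows "(\<integral>x. \<phi> x * partial_derivative i w x \<partial>lborel) = - (\<integral>x. partial_derivative i \<phi> x * w x \<partial>lborel)"
proof -
  have c: "continuous_on UNIV \<phi>" "continuous_on UNIV w" "continuous_on UNIV (partial_derivative i \<phi>)" "continuous_on UNIV (partial_derivative i w)"
    using \<phi> w by (auto simp: C_k_Suc C_k_0)
  have supp': "partial_derivative i \<phi> x = 0" if "norm x > R" for x
    using supp that by (rule partial_derivative_support)
  have i1: "integrable lborel (\<lambda>x. \<phi> x * partial_derivative i w x)" and i2: "integrable lborel (\<lambda>x. partial_derivative i \<phi> x * w x)"
    by (rule integrable_compact_support[where R=R]; use supp supp' in \<open>auto intro!: continuous_intros c\<close>)+
  let ?g = "\<lambda>x. \<phi> x * w x"
  let ?dg = "\<lambda>x. partial_derivative i \<phi> x * w x + \<phi> x * partial_derivative i w x"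
  have cdg: "continuous_on UNIV ?dg" by (intro continuous_intros c)
  obtain B where B: "B \<ge> 0" "\<And>x. norm x \<le> R \<Longrightarrow> \<bar>?dg x\<bar> \<le> B" using continuous_bounded_on_cball[OF cdg, of R] by blast
  have ig: "integrable lborel ?g" by (rule integrable_compact_support[where R=R]) (use supp in \<open>auto intro!: continuous_intros c\<close>)
  have gm [measurable]: "?g \<in> borel_measurable borel" using ig by auto
  have "((\<lambda>t. \<integral>x. ?g (x + t *\<^sub>R axis i 1) \<partial>lborel) has_real_derivative (\<integral>x. ?dg (x + 0 *\<^sub>R axis i 1) \<partial>lborel)) (at 0)"
  proof (rule has_real_derivative_integral_dominated[where d = 1 and F' = "\<lambda>t x. ?dg (x + t *\<^sub>R axis i 1)" and g = "\<lambda>x. B * indicator (cball 0 (R + 1)) x"])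
    fix t :: real assume t: "\<bar>t - 0\<bar> < 1"
    show "integrable lborel (\<lambda>x. ?g (x + t *\<^sub>R axis i 1))" using ig integrable_lborel_add[OF gm] by blast
    fix x
    show "((\<lambda>t. ?g (x + t *\<^sub>R axis i 1)) has_real_derivative ?dg (x + t *\<^sub>R axis i 1)) (at t)"
      using DERIV_mult[OF C_k_DERIV(1)[OF \<phi>, of x i t] C_k_DERIV(1)[OF w, of x i t]] by (simp add: algebra_simps)
    show "\<bar>?dg (x + t *\<^sub>R axis i 1)\<bar> \<le> B * indicator (cball 0 (R + 1)) x"
    proof (cases "norm (x + t *\<^sub>R axis i 1) \<le> R")
      case True
      have "norm x \<le> norm (x + t *\<^sub>R axis i 1) + norm (t *\<^sub>R axis i (1::real))"
        using norm_triangle_ineq4[of "x + t *\<^sub>R axis i 1" "t *\<^sub>R axis i 1"] by simp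
      then have "norm x \<le> R + 1" using True t by simp
      then show ?thesis using B(2)[OF True] by simp
    next
      case False
      then show ?thesis using supp supp' B(1) by simp
    qed
  next
    show "integrable lborel (\<lambda>x::real^'n. B * indicator (cball 0 (R + 1)) x)"
      using emeasure_bounded_finite[of "cball (0::real^'n) (R + 1)"] by (intro integrable_mult_right) (auto simp: integrable_indicator_iff)
    show "(\<lambda>x. ?dg (x + 0 *\<^sub>R axis i 1)) \<in> borel_measurable lborel"
      using borel_measurable_continuous_onI[OF cdg] by simp
  qed simp
  moreover have "(\<lambda>t. \<integral>x. ?g (x + t *\<^sub>R axis i 1) \<partial>lborel) = (\<lambda>t. \<integral>x. ?g x \<partial>lborel)"
    by (rule ext, rule integral_lborel_add[OF gm])
  ultimately have "((\<lambda>t::real. \<integral>x. ?g x \<partial>lborel) has_real_derivative (\<integral>x. ?dg x \<partial>lborel)) (at 0)" by simp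
  then have "(\<integral>x. ?dg x \<partial>lborel) = 0" by (rule DERIV_unique) auto
  then show ?thesis using i1 i2 by simp
qed

lemma neg_laplacian_support:
  assumes "\<And>x. norm x > R \<Longrightarrow> f x = 0" "norm x > R"
  shows "neg_laplacian f x = 0"
proof -
  have "partial_derivative i f x = 0" if "norm x > R" for x i using assms(1) that by (rule partial_derivative_support)
  then have "partial_derivative i (partial_derivative i f) x = 0" for i using assms(2) by (rule partial_derivative_support)
  then show ?thesis by (simp add: neg_laplacian_def laplacian_def)
qed

lemma neg_laplacian_self_adjoint:
  fixes \<phi> w :: "real^'n::finite \<Rightarrow> real"
  assumes \<phi>: "\<phi> \<in> C_k 2" and w: "w \<in> C_k 2" and supp: "\<And>x. norm x > R \<Longrightarrow> \<phi> x = 0"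
  shows "(\<integral>x. \<phi> x * neg_laplacian w x \<partial>lborel) = (\<integral>x. neg_laplacian \<phi> x * w x \<partial>lborel)"
proof -
  have 2: "2 = Suc (Suc 0)" by simp
  have \<phi>': "\<phi> \<in> C_k (Suc 0)" "partial_derivative i \<phi> \<in> C_k (Suc 0)" for i
    using \<phi> C_k_mono[OF \<phi>, of "Suc 0"] unfolding 2 by (auto simp: C_k_Suc[of _ "Suc 0"])
  have w': "w \<in> C_k (Suc 0)" "partial_derivative i w \<in> C_k (Suc 0)" for i
    using w C_k_mono[OF w, of "Suc 0"] unfolding 2 by (auto simp: C_k_Suc[of _ "Suc 0"])
  have c: "continuous_on UNIV \<phi>" "continuous_on UNIV w" "continuous_on UNIV (partial_derivative i (partial_derivative i \<phi>))"
     "continuous_on UNIV (partial_derivative i (partial_derivative i w))" for i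
    using \<phi>'(2)[of i] w'(2)[of i] C_k_continuous[OF \<phi>] C_k_continuous[OF w] by (auto simp: C_k_Suc C_k_0)
  have s1: "partial_derivative i \<phi> x = 0" if "norm x > R" for x i using supp that by (rule partial_derivative_support)
  have s2: "partial_derivative i (partial_derivative i \<phi>) x = 0" if "norm x > R" for x i using s1 that by (rule partial_derivative_support)
  have i1: "integrable lborel (\<lambda>x. \<phi> x * partial_derivative i (partial_derivative i w) x)" for i
    by (rule integrable_compact_support[where R=R]) (use supp in \<open>auto intro!: continuous_intros c\<close>)
  have i2: "integrable lborel (\<lambda>x. partial_derivative i (partial_derivative i \<phi>) x * w x)" for i
    by (rule integrable_compact_support[where R=R]) (use s2 in \<open>auto intro!: continuous_intros c\<close>)
  have "(\<integral>x. \<phi> x * partial_derivative i (partial_derivative i w) x \<partial>lborel)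
      = (\<integral>x. partial_derivative i (partial_derivative i \<phi>) x * w x \<partial>lborel)" for i
    using integral_by_parts[OF \<phi>'(1) w'(2) supp, where i = i] integral_by_parts[OF \<phi>'(2) w'(1) s1, where i = i] by simp
  then have "(\<Sum>i\<in>UNIV. \<integral>x. \<phi> x * partial_derivative i (partial_derivative i w) x \<partial>lborel)
      = (\<Sum>i\<in>UNIV. \<integral>x. partial_derivative i (partial_derivative i \<phi>) x * w x \<partial>lborel)" by simp
  then have "(\<integral>x. (\<Sum>i\<in>UNIV. \<phi> x * partial_derivative i (partial_derivative i w) x) \<partial>lborel)
      = (\<integral>x. (\<Sum>i\<in>UNIV. partial_derivative i (partial_derivative i \<phi>) x * w x) \<partial>lborel)"
    using i1 i2 by (simp add: Bochner_Integration.integral_sum)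
  then show ?thesis by (simp add: neg_laplacian_def laplacian_def sum_distrib_left sum_distrib_right)
qed

lemma neg_laplacian_power_support:
  "(\<And>x. norm x > R \<Longrightarrow> f x = 0) \<Longrightarrow> norm x > R \<Longrightarrow> (neg_laplacian ^^ m) f x = 0"
  by (induction m arbitrary: x) (auto intro: neg_laplacian_support)

lemma neg_laplacian_power_self_adjoint:
  fixes \<phi> w :: "real^'n::finite \<Rightarrow> real"
  assumes "\<phi> \<in> C_k (2 * m)" and "w \<in> C_k (2 * m)" and "\<And>x. norm x > R \<Longrightarrow> \<phi> x = 0"
  shows "(\<integral>x. \<phi> x * (neg_laplacian ^^ m) w x \<partial>lborel) = (\<integral>x. (neg_laplacian ^^ m) \<phi> x * w x \<partial>lborel)"
  using assms
proof (induction m arbitrary: w)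
  case (Suc m)
  have e: "2 * Suc m = 2 + 2 * m" by simp
  have "(\<integral>x. \<phi> x * (neg_laplacian ^^ Suc m) w x \<partial>lborel) = (\<integral>x. \<phi> x * (neg_laplacian ^^ m) (neg_laplacian w) x \<partial>lborel)"
    by (simp only: funpow_Suc_right o_apply)
  also have "\<dots> = (\<integral>x. (neg_laplacian ^^ m) \<phi> x * neg_laplacian w x \<partial>lborel)"
    using Suc.prems by (intro Suc.IH neg_laplacian_C_k) (auto intro: C_k_mono)
  also have "\<dots> = (\<integral>x. neg_laplacian ((neg_laplacian ^^ m) \<phi>) x * w x \<partial>lborel)"
  proof (rule neg_laplacian_self_adjoint[where R = R])
    show "(neg_laplacian ^^ m) \<phi> \<in> C_k 2" using Suc.prems(1) unfolding e by (rule neg_laplacian_power_C_k)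
    show "w \<in> C_k 2" using Suc.prems(2) by (rule C_k_mono) simp
  qed (rule neg_laplacian_power_support[OF Suc.prems(3)])
  finally show ?case by simp
qed simp

subsection \<open>Compactly supported approximations of Gaussians\<close>

text \<open>The remainder of the exponential series, continued by zero. It is of class
  \<open>C^M\<close> since its first \<open>M\<close> derivatives vanish at 0, it is asymptotic to
  \<open>exp\<close>, and its derivative is again a remainder. Inserted as
  \<open>exp_rem M (l * (k - x \<bullet> x))\<close> it yields a Gaussian cut off at
  \<open>x \<bullet> x = k\<close>, with no separate cut-off function to differentiate.\<close>

definition exp_rem :: "nat \<Rightarrow> real \<Rightarrow> real" where
  "exp_rem M y = (if y \<le> 0 then 0 else exp y - (\<Sum>j\<le>M. y ^ j / fact j))"

lemma exp_rem_DERIV: "(exp_rem (Suc M) has_real_derivative exp_rem M y) (at y)"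
proof -
  have s: "(\<Sum>j\<le>N. (0::real) ^ j / fact j) = 1" for N by (induction N) auto
  show ?thesis
    unfolding exp_rem_def[abs_def]
  proof (rule DERIV_If_le)
    fix y :: real
    have "((\<lambda>y. \<Sum>j\<le>Suc M. y ^ j / fact j) has_real_derivative (\<Sum>j\<le>Suc M. real j * y ^ (j - 1) / fact j)) (at y)"
      by (intro DERIV_sum) (auto intro!: derivative_eq_intros)
    also have "(\<Sum>j\<le>Suc M. real j * y ^ (j - 1) / fact j) = (\<Sum>j\<le>M. y ^ j / fact j)"
      by (subst sum.atMost_Suc_shift) (auto intro!: sum.cong simp: field_simps simp del: of_nat_Suc)
    finally show "((\<lambda>y. exp y - (\<Sum>j\<le>Suc M. y ^ j / fact j)) has_real_derivative exp y - (\<Sum>j\<le>M. y ^ j / fact j)) (at y)"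
      by (intro DERIV_diff DERIV_exp)
  qed (simp_all add: s)
qed

lemma continuous_exp_rem: "continuous_on UNIV (exp_rem M)"
proof -
  have s: "(\<Sum>j\<le>N. (0::real) ^ j / fact j) = 1" for N by (induction N) auto
  have "continuous_on ({..0} \<union> {0..}) (exp_rem M)"
    unfolding exp_rem_def[abs_def]
    by (rule continuous_on_cases) (auto intro!: continuous_intros simp: s)
  moreover have "{..0} \<union> {0..} = (UNIV :: real set)" by auto
  ultimately show ?thesis by simp
qed

lemma exp_rem_bounds: "0 \<le> exp_rem M y" "exp_rem M y \<le> exp y"
proof -
  have "(\<Sum>j\<le>M. y ^ j / fact j) \<le> exp y" if "y > 0"
  proof -
    have "(\<lambda>j. y ^ j / fact j) sums exp y" using exp_converges[of y] by (simp add: divide_inverse mult.commute)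
    then have "(\<Sum>j\<in>{..M}. y ^ j / fact j) \<le> (\<Sum>j. y ^ j / fact j)"
      using that by (intro sum_le_suminf) (auto simp: sums_iff)
    then show ?thesis using \<open>_ sums exp y\<close> by (simp add: sums_iff)
  qed
  then show "0 \<le> exp_rem M y" by (simp add: exp_rem_def)
  have "0 \<le> (\<Sum>j\<le>M. y ^ j / fact j)" if "y > 0" using that by (intro sum_nonneg) auto
  then show "exp_rem M y \<le> exp y" by (simp add: exp_rem_def)
qed

text \<open>With \<open>exp\<close> in place of \<open>exp_rem M\<close> both sides would agree for
  each \<open>k\<close>; the Taylor polynomial that was subtracted is negligible against the
  exponential.\<close>

lemma exp_rem_tendsto:
  assumes l: "l > 0"
  shows "(\<lambda>k. exp (- l * real k) * exp_rem M (l * (real k - z))) \<longlonglongrightarrow> exp (- l * z)"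
proof -
  have lim: "filterlim (\<lambda>k. l * (real k - z)) at_top sequentially"
    using l by real_asymp
  have "((\<lambda>y. exp (- l * z) * (1 - (\<Sum>j\<le>M. (y ^ j / exp y) / fact j))) \<longlongrightarrow> exp (- l * z) * (1 - (\<Sum>j\<le>M. 0 / fact j))) at_top"
    by (intro tendsto_intros tendsto_power_div_exp_0) auto
  from filterlim_compose[OF this lim]
  have "(\<lambda>k. exp (- l * z) * (1 - (\<Sum>j\<le>M. ((l * (real k - z)) ^ j / exp (l * (real k - z))) / fact j))) \<longlonglongrightarrow> exp (- l * z)"
    by simp
  moreover have "eventually (\<lambda>k. exp (- l * z) * (1 - (\<Sum>j\<le>M. ((l * (real k - z)) ^ j / exp (l * (real k - z))) / fact j))
     = exp (- l * real k) * exp_rem M (l * (real k - z))) sequentially"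
  proof -
    have "eventually (\<lambda>k. l * (real k - z) > 0) sequentially" using lim by (simp add: filterlim_at_top_dense)
    then show ?thesis
    proof eventually_elim
      case (elim k)
      let ?y = "l * (real k - z)"
      have e: "exp (- l * real k) = exp (- l * z) / exp ?y"
        by (simp add: exp_diff[symmetric] algebra_simps)
      have "(\<Sum>j\<le>M. (?y ^ j / exp ?y) / fact j) = (\<Sum>j\<le>M. ?y ^ j / fact j) / exp ?y"
        by (simp add: sum_divide_distrib mult.commute)
      then show ?case unfolding e exp_rem_def using elim by (simp add: field_simps)
    qed
  qed
  ultimately show ?thesis by (rule Lim_transform_eventually)
qed

text \<open>\<open>gtest l M F G\<close>: the compactly supported functions \<open>F k\<close> of class \<open>C^M\<close> converge to the
  Gaussian-type function \<open>G\<close>, together with all derivatives and with a common Gaussian bound.\<close>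

inductive gtest :: "real \<Rightarrow> nat \<Rightarrow> (nat \<Rightarrow> real^'n::finite \<Rightarrow> real) \<Rightarrow> (real^'n \<Rightarrow> real) \<Rightarrow> bool" for l where
  base: "gtest l M (\<lambda>k x. exp (- l * real k) * exp_rem M (l * (real k - x \<bullet> x))) (\<lambda>x. exp (- l * (x \<bullet> x)))"
| coord: "gtest l M F G \<Longrightarrow> gtest l M (\<lambda>k x. x $ i * F k x) (\<lambda>x. x $ i * G x)"
| add: "gtest l M F G \<Longrightarrow> gtest l M F' G' \<Longrightarrow> gtest l M (\<lambda>k x. F k x + F' k x) (\<lambda>x. G x + G' x)"
| cmult: "gtest l M F G \<Longrightarrow> gtest l M (\<lambda>k x. c * F k x) (\<lambda>x. c * G x)"
| less_smooth: "gtest l (Suc M) F G \<Longrightarrow> gtest l M F G"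

lemma gtest_continuous: "gtest l M F G \<Longrightarrow> continuous_on UNIV (F k) \<and> continuous_on UNIV G"
proof (induction rule: gtest.induct)
  case (base M)
  show ?case by (intro conjI continuous_intros continuous_on_compose2[OF continuous_exp_rem]) auto
qed (auto intro!: continuous_intros)

lemma gtest_tendsto: "gtest l M F G \<Longrightarrow> l > 0 \<Longrightarrow> (\<lambda>k. F k x) \<longlonglongrightarrow> G x"
  by (induction rule: gtest.induct) (auto intro!: tendsto_intros exp_rem_tendsto[simplified])

lemma gtest_support: "gtest l M F G \<Longrightarrow> l > 0 \<Longrightarrow> norm x > real k \<Longrightarrow> F k x = 0"
proof (induction rule: gtest.induct)
  case (base M)
  \<comment> \<open>The support is cut off at \<open>x \<bullet> x = k\<close>; the simpler radius
    \<open>k\<close> contains it since \<open>k \<le> k * k\<close> for natural numbers.\<close>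
  have "real k \<le> real k * real k" by (cases k) auto
  also have "\<dots> \<le> norm x * norm x" using base by (intro mult_mono) auto
  finally have "real k \<le> x \<bullet> x" by (simp add: power2_norm_eq_inner[symmetric] power2_eq_square)
  then have "l * (real k - x \<bullet> x) \<le> 0" using base by (intro mult_nonneg_nonpos) auto
  then show ?case by (simp add: exp_rem_def)
qed auto

text \<open>\<open>exp_rem M y \<le> exp y\<close> puts every basic cut-off below the limiting
  Gaussian, uniformly in \<open>k\<close>; the remaining rules contribute polynomial factors that do
  not depend on \<open>k\<close> either.\<close>

lemma gtest_bound_poly:
  "gtest l M F (G :: real^'n::finite \<Rightarrow> real) \<Longrightarrow> l > 0 \<Longrightarrow>
    \<exists>A\<ge>0. \<exists>b::nat. \<forall>x. (\<forall>k. \<bar>F k x\<bar> \<le> A * (1 + norm x) ^ b * exp (- l * (norm x)\<^sup>2)) \<and>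
      \<bar>G x\<bar> \<le> A * (1 + norm x) ^ b * exp (- l * (norm x)\<^sup>2)"
proof (induction rule: gtest.induct)
  case (base M)
  have "\<bar>exp (- l * real k) * exp_rem M (l * (real k - x \<bullet> x))\<bar> \<le> exp (- l * (norm x)\<^sup>2)" for k and x :: "real^'n"
  proof -
    have "exp (- l * real k) * exp_rem M (l * (real k - x \<bullet> x)) \<le> exp (- l * real k) * exp (l * (real k - x \<bullet> x))"
      using exp_rem_bounds by (intro mult_left_mono) auto
    also have "\<dots> = exp (- l * (norm x)\<^sup>2)" by (simp add: exp_add[symmetric] power2_norm_eq_inner algebra_simps)
    finally show ?thesis using exp_rem_bounds(1) by (simp add: abs_mult)
  qed
  then show ?case by (intro exI[of _ 1] exI[of _ "0::nat"] conjI allI) (auto simp: power2_norm_eq_inner)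
next
  case (coord M F G i)
  then obtain A b where A: "A \<ge> 0" "\<And>x k. \<bar>F k x\<bar> \<le> A * (1 + norm x) ^ b * exp (- l * (norm x)\<^sup>2)"
    "\<And>x. \<bar>G x\<bar> \<le> A * (1 + norm x) ^ b * exp (- l * (norm x)\<^sup>2)" by blast
  have "\<bar>x $ i * a\<bar> \<le> A * (1 + norm x) ^ Suc b * exp (- l * (norm x)\<^sup>2)" if "\<bar>a\<bar> \<le> A * (1 + norm x) ^ b * exp (- l * (norm x)\<^sup>2)" for x a
  proof -
    have "\<bar>x $ i\<bar> \<le> 1 + norm x" using component_le_norm_cart[of x i] by simp
    then have "\<bar>x $ i * a\<bar> \<le> (1 + norm x) * (A * (1 + norm x) ^ b * exp (- l * (norm x)\<^sup>2))"
      unfolding abs_mult using that by (intro mult_mono) auto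
    then show ?thesis by (simp add: mult_ac)
  qed
  with A show ?case by blast
next
  case (add M F G F' G')
  then obtain A b A' b' where A: "A \<ge> 0" "\<And>x k. \<bar>F k x\<bar> \<le> A * (1 + norm x) ^ b * exp (- l * (norm x)\<^sup>2)"
    "\<And>x. \<bar>G x\<bar> \<le> A * (1 + norm x) ^ b * exp (- l * (norm x)\<^sup>2)"
    and A': "A' \<ge> 0" "\<And>x k. \<bar>F' k x\<bar> \<le> A' * (1 + norm x) ^ b' * exp (- l * (norm x)\<^sup>2)"
    "\<And>x. \<bar>G' x\<bar> \<le> A' * (1 + norm x) ^ b' * exp (- l * (norm x)\<^sup>2)" by metis
  have "\<bar>a + a'\<bar> \<le> (A + A') * (1 + norm x) ^ (b + b') * exp (- l * (norm x)\<^sup>2)"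
    if "\<bar>a\<bar> \<le> A * (1 + norm x) ^ b * exp (- l * (norm x)\<^sup>2)" "\<bar>a'\<bar> \<le> A' * (1 + norm x) ^ b' * exp (- l * (norm x)\<^sup>2)"
    for a a' and x :: "real^'n"
  proof -
    have "A * (1 + norm x) ^ b * exp (- l * (norm x)\<^sup>2) \<le> A * (1 + norm x) ^ (b + b') * exp (- l * (norm x)\<^sup>2)"
      "A' * (1 + norm x) ^ b' * exp (- l * (norm x)\<^sup>2) \<le> A' * (1 + norm x) ^ (b + b') * exp (- l * (norm x)\<^sup>2)"
      using A(1) A'(1) by (intro mult_right_mono mult_left_mono power_increasing; simp)+
    then show ?thesis using that by (simp add: distrib_right)
  qed
  with A A' show ?case by (intro exI[of _ "A + A'"] conjI exI[of _ "b + b'"]) auto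
next
  case (cmult M F G c)
  then obtain A b where A: "A \<ge> 0" "\<And>x k. \<bar>F k x\<bar> \<le> A * (1 + norm x) ^ b * exp (- l * (norm x)\<^sup>2)"
    "\<And>x. \<bar>G x\<bar> \<le> A * (1 + norm x) ^ b * exp (- l * (norm x)\<^sup>2)" by blast
  have "\<bar>c * a\<bar> \<le> (\<bar>c\<bar> * A) * (1 + norm x) ^ b * exp (- l * (norm x)\<^sup>2)" if "\<bar>a\<bar> \<le> A * (1 + norm x) ^ b * exp (- l * (norm x)\<^sup>2)" for a and x :: "real^'n"
    unfolding abs_mult mult.assoc using that by (intro mult_left_mono) (auto simp: mult.assoc)
  with A show ?case by (intro exI[of _ "\<bar>c\<bar> * A"] conjI exI[of _ b]) auto
qed

lemma gtest_bound:
  assumes g: "gtest l M F (G :: real^'n::finite \<Rightarrow> real)" and l: "l > 0"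
  shows "\<exists>A\<ge>0. \<forall>x. (\<forall>k. \<bar>F k x\<bar> \<le> A * exp (- (l / 2) * (norm x)\<^sup>2)) \<and> \<bar>G x\<bar> \<le> A * exp (- (l / 2) * (norm x)\<^sup>2)"
proof -
  obtain A b where A: "A \<ge> 0" "\<And>x k. \<bar>F k x\<bar> \<le> A * (1 + norm x) ^ b * exp (- l * (norm x)\<^sup>2)"
    "\<And>x. \<bar>G x\<bar> \<le> A * (1 + norm x) ^ b * exp (- l * (norm x)\<^sup>2)" using gtest_bound_poly[OF g l] by blast
  obtain C where C: "C > 0" "\<And>r. r \<ge> 0 \<Longrightarrow> (1 + r) powr real b * exp (- (l / 2) * r\<^sup>2) \<le> C"
    using powr_mult_gaussian_bound[of "l / 2" "real b"] l by auto
  have "A * (1 + norm x) ^ b * exp (- l * (norm x)\<^sup>2) \<le> (A * C) * exp (- (l / 2) * (norm x)\<^sup>2)" for x :: "real^'n"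
  proof -
    have "exp (- l * (norm x)\<^sup>2) = exp (- (l / 2) * (norm x)\<^sup>2) * exp (- (l / 2) * (norm x)\<^sup>2)"
      by (simp add: exp_add[symmetric] field_simps)
    moreover have "(1 + norm x) ^ b = (1 + norm x) powr real b" by (subst powr_realpow) (auto simp: add_pos_nonneg)
    ultimately have "A * (1 + norm x) ^ b * exp (- l * (norm x)\<^sup>2) =
        A * (((1 + norm x) powr real b * exp (- (l / 2) * (norm x)\<^sup>2)) * exp (- (l / 2) * (norm x)\<^sup>2))"
      by (simp only: mult.assoc)
    also have "\<dots> \<le> A * (C * exp (- (l / 2) * (norm x)\<^sup>2))"
      using C(2)[of "norm x"] A(1) by (intro mult_left_mono mult_right_mono) auto
    finally show ?thesis by (simp add: mult.assoc)
  qed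
  note X = this
  show ?thesis
  proof (intro exI[of _ "A * C"] conjI allI)
    show "\<bar>F k x\<bar> \<le> A * C * exp (- (l / 2) * (norm x)\<^sup>2)" for k x by (rule order_trans[OF A(2) X])
    show "\<bar>G x\<bar> \<le> A * C * exp (- (l / 2) * (norm x)\<^sup>2)" for x by (rule order_trans[OF A(3) X])
  qed (use A(1) C(1) in auto)
qed

text \<open>The sequence and its limit are differentiated side by side by the same rules.
  Convergence of derivatives is therefore membership in the class, and no uniform convergence has to
  be argued.\<close>

lemma gtest_DERIV_aux:
  fixes G :: "real^'n::finite \<Rightarrow> real" and i :: 'n
  shows "gtest l N F G \<Longrightarrow> N = Suc M \<Longrightarrow>
    \<exists>F' G'. gtest l M F' G' \<and> (\<forall>k y. ((\<lambda>t. F k (y + t *\<^sub>R axis i 1)) has_real_derivative F' k y) (at 0)) \<and>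
      (\<forall>y. ((\<lambda>t. G (y + t *\<^sub>R axis i 1)) has_real_derivative G' y) (at 0))"
proof (induction arbitrary: M rule: gtest.induct)
  case (base N)
  let ?q = "\<lambda>y t. (y + t *\<^sub>R axis i 1) \<bullet> (y + t *\<^sub>R axis i 1)"
  have "((\<lambda>t. exp (- l * real k) * exp_rem (Suc M) (l * (real k - ?q y t))) has_real_derivative
      exp (- l * real k) * (exp_rem M (l * (real k - y \<bullet> y)) * (l * (0 - 2 * y $ i)))) (at 0)" for k and y :: "real^'n"
  proof -
    have "((\<lambda>t. l * (real k - ?q y t)) has_real_derivative l * (0 - 2 * y $ i)) (at 0)"
      by (intro DERIV_cmult DERIV_diff DERIV_const DERIV_inner_line)
    from DERIV_cmult[OF DERIV_chain2[OF exp_rem_DERIV this]] show ?thesis by simp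
  qed
  moreover have "((\<lambda>t. exp (- l * ?q y t)) has_real_derivative exp (- l * (y \<bullet> y)) * (- l * (2 * y $ i))) (at 0)" for y :: "real^'n"
    using DERIV_chain2[OF DERIV_exp DERIV_cmult[OF DERIV_inner_line[of y i], of "- l"]] by simp
  moreover have "gtest l M (\<lambda>k y. (- 2 * l) * (y $ i * (exp (- l * real k) * exp_rem M (l * (real k - y \<bullet> y)))))
     (\<lambda>y::real^'n. (- 2 * l) * (y $ i * exp (- l * (y \<bullet> y))))"
    by (intro gtest.cmult gtest.coord gtest.base)
  ultimately show ?case unfolding base
    by (intro exI[of _ "\<lambda>k y. (- 2 * l) * (y $ i * (exp (- l * real k) * exp_rem M (l * (real k - y \<bullet> y))))"]
          exI[of _ "\<lambda>y::real^'n. (- 2 * l) * (y $ i * exp (- l * (y \<bullet> y)))"]) (simp add: mult_ac)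
next
  case (coord N F G j)
  then obtain D E where D: "gtest l M D E" "\<And>k y. ((\<lambda>t. F k (y + t *\<^sub>R axis i 1)) has_real_derivative D k y) (at 0)"
    "\<And>y. ((\<lambda>t. G (y + t *\<^sub>R axis i 1)) has_real_derivative E y) (at 0)" by metis
  have "((\<lambda>t. (y + t *\<^sub>R axis i 1) $ j * F k (y + t *\<^sub>R axis i 1)) has_real_derivative
      (if j = i then 1 else 0) * F k y + y $ j * D k y) (at 0)" for y k
    using DERIV_mult[OF DERIV_coord_line[of y i j] D(2)[of k y]] by (simp add: mult_ac)
  moreover have "((\<lambda>t. (y + t *\<^sub>R axis i 1) $ j * G (y + t *\<^sub>R axis i 1)) has_real_derivative
      (if j = i then 1 else 0) * G y + y $ j * E y) (at 0)" for y
    using DERIV_mult[OF DERIV_coord_line[of y i j] D(3)[of y]] by (simp add: mult_ac)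
  moreover have "gtest l M (\<lambda>k y. (if j = i then 1 else 0) * F k y + y $ j * D k y) (\<lambda>y. (if j = i then 1 else 0) * G y + y $ j * E y)"
    using coord.hyps coord.prems D(1)
    by (intro gtest.add gtest.cmult gtest.coord) (auto intro: gtest.less_smooth)
  ultimately show ?case by blast
next
  case (add N F G F' G')
  then obtain D E D' E' where D: "gtest l M D E" "\<And>k y. ((\<lambda>t. F k (y + t *\<^sub>R axis i 1)) has_real_derivative D k y) (at 0)"
    "\<And>y. ((\<lambda>t. G (y + t *\<^sub>R axis i 1)) has_real_derivative E y) (at 0)"
    and D': "gtest l M D' E'" "\<And>k y. ((\<lambda>t. F' k (y + t *\<^sub>R axis i 1)) has_real_derivative D' k y) (at 0)"
    "\<And>y. ((\<lambda>t. G' (y + t *\<^sub>R axis i 1)) has_real_derivative E' y) (at 0)" by metis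
  show ?case using gtest.add[OF D(1) D'(1)] DERIV_add[OF D(2) D'(2)] DERIV_add[OF D(3) D'(3)] by blast
next
  case (cmult N F G c)
  then obtain D E where D: "gtest l M D E" "\<And>k y. ((\<lambda>t. F k (y + t *\<^sub>R axis i 1)) has_real_derivative D k y) (at 0)"
    "\<And>y. ((\<lambda>t. G (y + t *\<^sub>R axis i 1)) has_real_derivative E y) (at 0)" by metis
  show ?case using gtest.cmult[OF D(1)] DERIV_cmult[OF D(2)] DERIV_cmult[OF D(3)] by blast
next
  case (less_smooth N F G)
  then obtain D E where D: "gtest l (Suc M) D E" "\<And>k y. ((\<lambda>t. F k (y + t *\<^sub>R axis i 1)) has_real_derivative D k y) (at 0)"
    "\<And>y. ((\<lambda>t. G (y + t *\<^sub>R axis i 1)) has_real_derivative E y) (at 0)" by metis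
  then show ?case using gtest.less_smooth by blast
qed

lemma gtest_partial:
  assumes "gtest l (Suc M) F G"
  shows "gtest l M (\<lambda>k. partial_derivative i (F k)) (partial_derivative i G)"
    and "has_partial_derivatives (F k)" and "has_partial_derivatives G"
proof -
  have "\<exists>F' G'. gtest l M F' G' \<and> (\<forall>k y. ((\<lambda>t. F k (y + t *\<^sub>R axis i 1)) has_real_derivative F' k y) (at 0)) \<and>
      (\<forall>y. ((\<lambda>t. G (y + t *\<^sub>R axis i 1)) has_real_derivative G' y) (at 0))" for i
    by (rule gtest_DERIV_aux[OF assms refl])
  then obtain D E where D: "\<And>i. gtest l M (D i) (E i)" "\<And>i k y. ((\<lambda>t. F k (y + t *\<^sub>R axis i 1)) has_real_derivative D i k y) (at 0)"
    "\<And>i y. ((\<lambda>t. G (y + t *\<^sub>R axis i 1)) has_real_derivative E i y) (at 0)" by metis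
  have "partial_derivative i (F k) = D i k" "partial_derivative i G = E i" for i k
    using D(2,3) by (auto intro!: partial_derivative_eqI)
  then show "gtest l M (\<lambda>k. partial_derivative i (F k)) (partial_derivative i G)" using D(1) by simp
  show "has_partial_derivatives (F k)" "has_partial_derivatives G" by (rule has_partial_derivativesI[OF D(2)] has_partial_derivativesI[OF D(3)])+
qed

lemma gtest_C_k:
  assumes "gtest l M F G"
  shows "F k \<in> C_k M" "G \<in> C_k M"
proof -
  show "F k \<in> C_k M"
    by (rule C_k_coinduct[where P = "\<lambda>M f. \<exists>F G. gtest l M F G \<and> f = F k"])
      (use assms gtest_continuous gtest_partial in blast)+
  show "G \<in> C_k M"
    by (rule C_k_coinduct[where P = "\<lambda>M f. \<exists>F. gtest l M F f"])
      (use assms gtest_continuous gtest_partial in blast)+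
qed

lemma gtest_sum: "finite I \<Longrightarrow> (\<And>i. i \<in> I \<Longrightarrow> gtest l M (F i) (G i)) \<Longrightarrow> gtest l M (\<lambda>k x. \<Sum>i\<in>I. F i k x) (\<lambda>x. \<Sum>i\<in>I. G i x)"
proof (induction I rule: finite_induct)
  case empty
  show ?case using gtest.cmult[OF gtest.base, of l M 0] by simp
qed (auto intro: gtest.add)

lemma gtest_neg_laplacian:
  assumes "gtest l (M + 2) F G"
  shows "gtest l M (\<lambda>k. neg_laplacian (F k)) (neg_laplacian G)"
proof -
  have "gtest l M (\<lambda>k x. (- 1) * (\<Sum>i\<in>UNIV. partial_derivative i (partial_derivative i (F k)) x)) (\<lambda>x. (- 1) * (\<Sum>i\<in>UNIV. partial_derivative i (partial_derivative i G) x))"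
    using assms by (intro gtest.cmult gtest_sum gtest_partial) auto
  then show ?thesis by (simp add: neg_laplacian_def laplacian_def)
qed

lemma gtest_neg_laplacian_power:
  "gtest l (M + 2 * m) F G \<Longrightarrow> gtest l M (\<lambda>k. (neg_laplacian ^^ m) (F k)) ((neg_laplacian ^^ m) G)"
proof (induction m arbitrary: M)
  case (Suc m)
  then have "gtest l (M + 2) (\<lambda>k. (neg_laplacian ^^ m) (F k)) ((neg_laplacian ^^ m) G)" by (simp add: algebra_simps)
  from gtest_neg_laplacian[OF this] show ?case by simp
qed simp

text \<open>The exponent is halved twice: once to absorb the polynomial factors, once in
  \<open>gauss_bd_C2\<close>. The bound is common to all \<open>k\<close>, as dominated convergence
  requires.\<close>

lemma gtest_gauss_bd:
  fixes G :: "real^'n::finite \<Rightarrow> real"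
  assumes g: "gtest l 2 F G" and l: "l > 0"
  shows "\<exists>A. (\<forall>k. gauss_bd (l / 4) A (F k)) \<and> gauss_bd (l / 4) A G"
proof -
  have g': "gtest l (Suc (Suc 0)) F G" using g by (simp add: numeral_2_eq_2)
  obtain A where A: "A \<ge> 0" "\<And>x k. \<bar>F k x\<bar> \<le> A * exp (- (l / 2) * (norm x)\<^sup>2)" "\<And>x. \<bar>G x\<bar> \<le> A * exp (- (l / 2) * (norm x)\<^sup>2)"
    using gtest_bound[OF g l] by blast
  have "\<exists>A\<ge>0. \<forall>x. (\<forall>k. \<bar>partial_derivative i (partial_derivative j (F k)) x\<bar> \<le> A * exp (- (l / 2) * (norm x)\<^sup>2)) \<and>
      \<bar>partial_derivative i (partial_derivative j G) x\<bar> \<le> A * exp (- (l / 2) * (norm x)\<^sup>2)" for i j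
    by (rule gtest_bound[OF gtest_partial(1)[OF gtest_partial(1)[OF g']] l])
  then obtain B where B: "\<And>i j. B i j \<ge> 0"
    "\<And>i j x k. \<bar>partial_derivative i (partial_derivative j (F k)) x\<bar> \<le> B i j * exp (- (l / 2) * (norm x)\<^sup>2)"
    "\<And>i j x. \<bar>partial_derivative i (partial_derivative j G) x\<bar> \<le> B i j * exp (- (l / 2) * (norm x)\<^sup>2)" by metis
  define B0 where "B0 = A + (\<Sum>i\<in>UNIV. \<Sum>j\<in>UNIV. B i j)"
  have S0: "(\<Sum>i\<in>UNIV. \<Sum>j\<in>UNIV. B i j) \<ge> 0" by (intro sum_nonneg B(1))
  have B0: "B i j \<le> B0" "A \<le> B0" "B0 \<ge> 0" for i j
  proof -
    have "B i j \<le> (\<Sum>j\<in>UNIV. B i j)" by (rule member_le_sum) (use B in auto)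
    also have "\<dots> \<le> (\<Sum>i\<in>UNIV. \<Sum>j\<in>UNIV. B i j)" by (rule member_le_sum[of i UNIV "\<lambda>i. \<Sum>j\<in>UNIV. B i j"]) (use B in \<open>auto intro: sum_nonneg\<close>)
    finally show "B i j \<le> B0" using A(1) by (simp add: B0_def)
  qed (use S0 A(1) in \<open>auto simp: B0_def\<close>)
  have e: "- (2 * (l / 4)) * r = - (l / 2) * r" for r :: real by simp
  have up: "a \<le> B0 * exp c" if "a \<le> D * exp c" "D \<le> B0" for a D c
    using order_trans[OF that(1) mult_right_mono[OF that(2)]] by simp
  have "gauss_bd (l / 4) (2 * (real CARD('n))\<^sup>2 * exp (2 * (l / 4)) * B0) f"
    if "f \<in> C_k 2" "\<And>x. \<bar>f x\<bar> \<le> A * exp (- (l / 2) * (norm x)\<^sup>2)"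
      "\<And>i j x. \<bar>partial_derivative i (partial_derivative j f) x\<bar> \<le> B i j * exp (- (l / 2) * (norm x)\<^sup>2)" for f
  proof (rule gauss_bd_C2[OF that(1) _ B0(3)])
    show "\<bar>f z\<bar> \<le> B0 * exp (- (2 * (l / 4)) * (norm z)\<^sup>2)" for z
      unfolding e by (rule up[OF that(2) B0(2)])
    show "\<bar>partial_derivative i (partial_derivative j f) z\<bar> \<le> B0 * exp (- (2 * (l / 4)) * (norm z)\<^sup>2)" for i j z
      unfolding e by (rule up[OF that(3) B0(1)])
  qed (use l in simp)
  then show ?thesis using gtest_C_k[OF g] A(2,3) B(2,3) by blast
qed

subsection \<open>Derivatives of the heat kernel\<close>

text \<open>\<open>lag \<nu> j\<close> is \<open>fact j\<close> times the Laguerre polynomial with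
  parameter \<open>\<nu> - 1\<close>. The recursion is the effect of one negative time derivative on
  the polynomial factor of the heat kernel.\<close>

primrec lag :: "real \<Rightarrow> nat \<Rightarrow> real poly" where
  "lag \<nu> 0 = 1"
| "lag \<nu> (Suc j) = [:real j + \<nu>, - 1:] * lag \<nu> j + [:0, 1:] * pderiv (lag \<nu> j)"

text \<open>The Laguerre equation is what makes the two recursions, for the time derivative and for the
  Laplacian of the heat kernel, agree.\<close>

lemma lag_ode:
  "y * poly (pderiv (pderiv (lag \<nu> j))) y + (\<nu> - y) * poly (pderiv (lag \<nu> j)) y + real j * poly (lag \<nu> j) y = 0"
proof (induction j arbitrary: y)
  case (Suc j)
  let ?p = "lag \<nu> j"
  \<comment> \<open>The equation for \<open>j\<close> eliminates the second derivative, which leaves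
    a first-order expression; differentiating it once more yields the equation for
    \<open>Suc j\<close>.\<close>
  have "poly (pderiv (lag \<nu> (Suc j))) y = poly (smult (real j + 1) (pderiv ?p - ?p)) y" for y
    using Suc.IH[of y] by (simp add: pderiv_add pderiv_mult pderiv_pCons pderiv_smult pderiv_minus algebra_simps)
  then have "pderiv (lag \<nu> (Suc j)) = smult (real j + 1) (pderiv ?p - ?p)"
    by (intro poly_ext) auto
  then have 1: "poly (pderiv (lag \<nu> (Suc j))) y = (real j + 1) * (poly (pderiv ?p) y - poly ?p y)"
    "poly (pderiv (pderiv (lag \<nu> (Suc j)))) y = (real j + 1) * (poly (pderiv (pderiv ?p)) y - poly (pderiv ?p) y)" for y
    by (simp_all add: pderiv_smult pderiv_diff)
  have 2: "poly (lag \<nu> (Suc j)) y = (real j + \<nu> - y) * poly ?p y + y * poly (pderiv ?p) y"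
    by (simp add: algebra_simps)
  have "y * ((real j + 1) * (q2 - q1)) + (\<nu> - y) * ((real j + 1) * (q1 - q0)) + (real j + 1) * ((real j + \<nu> - y) * q0 + y * q1)
      = (real j + 1) * (y * q2 + (\<nu> - y) * q1 + real j * q0)" for q0 q1 q2 :: real
    by (simp add: algebra_simps)
  then show ?case unfolding 1 2 using Suc.IH[of y] by (simp add: add.commute)
qed simp

text \<open>Closed form of \<open>(neg_laplacian ^^ j) (heat t)\<close> and, equally, of the
  \<open>j\<close>-th negative time derivative of the heat kernel.\<close>

definition heatD :: "nat \<Rightarrow> real \<Rightarrow> real^'n::finite \<Rightarrow> real" where
  "heatD j t x = t powr (- (real j + real CARD('n) / 2)) *
     (poly (lag (real CARD('n) / 2) j) (x \<bullet> x / (4 * t)) * exp (- (x \<bullet> x) / (4 * t)))"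

lemma heatD_0: "heatD 0 t = heat t"
  by (rule ext) (simp add: heatD_def heat_def power2_norm_eq_inner)

lemma heatD_measurable [measurable]: "heatD j t \<in> borel_measurable borel"
proof -
  have [measurable]: "poly p \<in> borel_measurable borel" for p :: "real poly"
    by (intro borel_measurable_continuous_onI continuous_intros)
  show ?thesis unfolding heatD_def[abs_def] by measurable
qed

lemma heatD_scale:
  assumes t: "t > 0"
  shows "heatD j t (x::real^'n::finite) = t powr (- (real j + real CARD('n) / 2)) * heatD j 1 ((1 / sqrt t) *\<^sub>R x)"
proof -
  have "((1 / sqrt t) *\<^sub>R x) \<bullet> ((1 / sqrt t) *\<^sub>R x) = x \<bullet> x / t" using t by simp
  then show ?thesis using t by (simp add: heatD_def mult.commute)
qed

lemma neg_laplacian_radial: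
  fixes g g' g'' :: "real \<Rightarrow> real"
  assumes g: "\<And>z. (g has_real_derivative g' z) (at z)" and g': "\<And>z. (g' has_real_derivative g'' z) (at z)"
  shows "neg_laplacian (\<lambda>x::real^'n::finite. g (x \<bullet> x)) x = - (4 * (x \<bullet> x) * g'' (x \<bullet> x) + 2 * real CARD('n) * g' (x \<bullet> x))"
proof -
  have 1: "partial_derivative i (\<lambda>x::real^'n. g (x \<bullet> x)) = (\<lambda>x. g' (x \<bullet> x) * (2 * x $ i))" for i
    by (rule ext, rule partial_derivative_eqI) (use DERIV_chain2[OF g DERIV_inner_line] in simp)
  have 2: "partial_derivative i (\<lambda>x::real^'n. g' (x \<bullet> x) * (2 * x $ i)) x = g'' (x \<bullet> x) * (2 * x $ i) * (2 * x $ i) + g' (x \<bullet> x) * 2" for i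
  proof (rule partial_derivative_eqI)
    show "((\<lambda>t. g' ((x + t *\<^sub>R axis i 1) \<bullet> (x + t *\<^sub>R axis i 1)) * (2 * (x + t *\<^sub>R axis i 1) $ i)) has_real_derivative
        g'' (x \<bullet> x) * (2 * x $ i) * (2 * x $ i) + g' (x \<bullet> x) * 2) (at 0)"
      using DERIV_mult[OF DERIV_chain2[OF g' DERIV_inner_line[of x i]] DERIV_cmult[OF DERIV_coord_line[of x i i], of 2]]
      by (simp add: algebra_simps)
  qed
  have "(\<Sum>i\<in>UNIV. g'' (x \<bullet> x) * (2 * x $ i) * (2 * x $ i) + g' (x \<bullet> x) * 2) = 4 * (x \<bullet> x) * g'' (x \<bullet> x) + 2 * real CARD('n) * g' (x \<bullet> x)"
    by (simp add: sum.distrib inner_vec_def sum_distrib_left sum_distrib_right mult_ac)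
  then show ?thesis unfolding neg_laplacian_def laplacian_def 1 2 by simp
qed

lemma neg_laplacian_heatD:
  assumes t: "t > 0"
  shows "neg_laplacian (heatD j t :: real^'n::finite \<Rightarrow> real) = heatD (Suc j) t"
proof (rule ext)
  fix x :: "real^'n"
  define \<nu> where "\<nu> = real CARD('n) / 2"
  let ?p = "lag \<nu> j"
  define c where "c = t powr (- (real j + \<nu>))"
  let ?y = "\<lambda>z. z / (4 * t)"
  have dy: "(?y has_real_derivative 1 / (4 * t)) (at z)" for z using t by (auto intro!: derivative_eq_intros)
  have dp: "((\<lambda>z. poly q (?y z)) has_real_derivative poly (pderiv q) (?y z) * (1 / (4 * t))) (at z)" for q z
    by (rule DERIV_chain2[OF poly_DERIV dy])
  have de: "((\<lambda>z. exp (- z / (4 * t))) has_real_derivative exp (- z / (4 * t)) * (- (1 / (4 * t)))) (at z)" for z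
    using t by (auto intro!: derivative_eq_intros)
  have D: "((\<lambda>z. c * (poly q (?y z) * exp (- z / (4 * t)))) has_real_derivative
       (c / (4 * t)) * (poly (pderiv q - q) (?y z) * exp (- z / (4 * t)))) (at z)" for q c z
    by (rule DERIV_cong[OF DERIV_cmult[OF DERIV_mult[OF dp de]]]) (use t in \<open>simp add: field_simps\<close>)
  let ?r = "pderiv ?p - ?p"
  have "neg_laplacian (\<lambda>x::real^'n. c * (poly ?p (?y (x \<bullet> x)) * exp (- (x \<bullet> x) / (4 * t)))) x =
      - (4 * (x \<bullet> x) * ((c / (4 * t) / (4 * t)) * (poly (pderiv ?r - ?r) (?y (x \<bullet> x)) * exp (- (x \<bullet> x) / (4 * t))))
         + 2 * real CARD('n) * ((c / (4 * t)) * (poly ?r (?y (x \<bullet> x)) * exp (- (x \<bullet> x) / (4 * t)))))"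
    by (rule neg_laplacian_radial[OF D D])
  also have "\<dots> = c / t * (poly (lag \<nu> (Suc j)) (?y (x \<bullet> x)) * exp (- (x \<bullet> x) / (4 * t)))"
  proof -
    define Y where "Y = ?y (x \<bullet> x)"
    define E where "E = exp (- (x \<bullet> x) / (4 * t))"
    have xx: "x \<bullet> x = 4 * t * Y" using t by (simp add: Y_def)
    have n: "real CARD('n) = 2 * \<nu>" by (simp add: \<nu>_def)
    have "- (4 * (4 * t * Y) * ((c / (4 * t) / (4 * t)) * (poly (pderiv ?r - ?r) Y * E)) + 2 * (2 * \<nu>) * ((c / (4 * t)) * (poly ?r Y * E)))
       = c / t * E * (- Y * poly (pderiv ?r - ?r) Y - \<nu> * poly ?r Y)"
      using t by (simp add: field_simps)
    \<comment> \<open>The Laguerre equation removes the second derivative here and leaves the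
      right-hand side of the recursion.\<close>
    also have "- Y * poly (pderiv ?r - ?r) Y - \<nu> * poly ?r Y = poly (lag \<nu> (Suc j)) Y"
      using lag_ode[of Y \<nu> j] by (simp add: pderiv_diff algebra_simps)
    finally show ?thesis unfolding Y_def[symmetric] E_def[symmetric] by (simp only: xx n mult_ac)
  qed
  also have "c / t = t powr (- (real j + \<nu>) - 1)"
    using t powr_diff[of t "- (real j + \<nu>)" 1] by (simp add: c_def)
  also have "- (real j + \<nu>) - 1 = - (real (Suc j) + \<nu>)" by simp
  finally show "neg_laplacian (heatD j t) x = heatD (Suc j) t x"
    by (simp add: heatD_def[abs_def] \<nu>_def c_def)
qed

lemma neg_laplacian_power_heat: "t > 0 \<Longrightarrow> (neg_laplacian ^^ j) (heat t) = heatD j t"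
  by (induction j) (simp_all add: heatD_0 neg_laplacian_heatD)

text \<open>Immediate from the recursion of \<open>lag\<close>. Together with
  \<open>neg_laplacian_heatD\<close> it is the heat equation, the source of the relation between
  consecutive \<open>A j\<close>.\<close>

lemma heatD_DERIV_time:
  assumes t: "t > 0"
  shows "((\<lambda>t. heatD j t (x::real^'n::finite)) has_real_derivative - heatD (Suc j) t x) (at t)"
proof -
  define \<nu> where "\<nu> = real CARD('n) / 2"
  define z where "z = x \<bullet> x"
  let ?p = "lag \<nu> j"
  have dy: "((\<lambda>t. z / (4 * t)) has_real_derivative - (z / (4 * t)) / t) (at t)"
    using t by (auto intro!: derivative_eq_intros simp: field_simps power2_eq_square)
  have dp: "((\<lambda>t. poly ?p (z / (4 * t))) has_real_derivative poly (pderiv ?p) (z / (4 * t)) * (- (z / (4 * t)) / t)) (at t)"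
    by (rule DERIV_chain2[OF poly_DERIV dy])
  have de: "((\<lambda>t. exp (- z / (4 * t))) has_real_derivative exp (- z / (4 * t)) * ((z / (4 * t)) / t)) (at t)"
    using DERIV_chain2[OF DERIV_exp DERIV_minus[OF dy]] by simp
  have dt: "((\<lambda>t. t powr (- (real j + \<nu>))) has_real_derivative (- (real j + \<nu>)) * t powr (- (real j + \<nu>) - 1)) (at t)"
    using t by (rule has_real_derivative_powr)
  have pw: "t powr (- (real j + \<nu>)) = t * t powr (- (real j + \<nu>) - 1)"
    using t by (simp add: powr_diff)
  have "((\<lambda>t. t powr (- (real j + \<nu>)) * (poly ?p (z / (4 * t)) * exp (- z / (4 * t)))) has_real_derivative
      - (t powr (- (real j + \<nu>) - 1) * (poly (lag \<nu> (Suc j)) (z / (4 * t)) * exp (- z / (4 * t))))) (at t)"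
  proof (rule DERIV_cong[OF DERIV_mult[OF dt DERIV_mult[OF dp de]]])
    define Y where "Y = z / (4 * t)"
    define E where "E = exp (- z / (4 * t))"
    define T where "T = t powr (- (real j + \<nu>) - 1)"
    have "(- (real j + \<nu>)) * T * (poly ?p Y * E) + (poly (pderiv ?p) Y * (- Y / t) * E + E * (Y / t) * poly ?p Y) * (t * T)
       = - (T * (poly (lag \<nu> (Suc j)) Y * E))"
      using t by (simp add: field_simps)
    then show "- (real j + \<nu>) * t powr (- (real j + \<nu>) - 1) * (poly ?p (z / (4 * t)) * exp (- z / (4 * t))) +
      (poly (pderiv ?p) (z / (4 * t)) * (- (z / (4 * t)) / t) * exp (- z / (4 * t)) +
       exp (- z / (4 * t)) * (z / (4 * t) / t) * poly ?p (z / (4 * t))) * t powr (- (real j + \<nu>)) =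
      - (t powr (- (real j + \<nu>) - 1) * (poly (lag \<nu> (Suc j)) (z / (4 * t)) * exp (- z / (4 * t))))"
      unfolding pw Y_def[symmetric] E_def[symmetric] T_def[symmetric] .
  qed
  moreover have "- (real j + \<nu>) - 1 = - (real (Suc j) + \<nu>)" by simp
  ultimately show ?thesis unfolding heatD_def \<nu>_def[symmetric] z_def[symmetric] by (simp only:)
qed

lemma heat_gtest:
  assumes t: "t > 0"
  shows "\<exists>F. gtest (1 / (4 * t)) M F (heat t :: real^'n::finite \<Rightarrow> real) \<and> (\<forall>k x. 0 \<le> F k x)"
proof -
  let ?l = "1 / (4 * t)"
  have "gtest ?l M (\<lambda>k x. t powr (- (real CARD('n) / 2)) * (exp (- ?l * real k) * exp_rem M (?l * (real k - x \<bullet> x))))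
     (\<lambda>x::real^'n. t powr (- (real CARD('n) / 2)) * exp (- ?l * (x \<bullet> x)))"
    by (intro gtest.cmult gtest.base)
  moreover have "(\<lambda>x::real^'n. t powr (- (real CARD('n) / 2)) * exp (- ?l * (x \<bullet> x))) = heat t"
    by (rule ext) (simp add: heat_def power2_norm_eq_inner)
  ultimately show ?thesis
    by (intro exI[of _ "\<lambda>k x. t powr (- (real CARD('n) / 2)) * (exp (- ?l * real k) * exp_rem M (?l * (real k - x \<bullet> x)))"])
      (auto intro!: mult_nonneg_nonneg exp_rem_bounds)
qed

lemma heatD_gtest:
  assumes t: "t > 0" and g: "gtest (1 / (4 * t)) (M + 2 * j) F (heat t)"
  shows "gtest (1 / (4 * t)) M (\<lambda>k. (neg_laplacian ^^ j) (F k)) (heatD j t)"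
  using gtest_neg_laplacian_power[OF g] by (simp only: neg_laplacian_power_heat[OF t])

text \<open>At time 1 the Gaussian parameter is 1/4, and \<open>gtest_gauss_bd\<close> divides it by
  4.\<close>

lemma heatD_gauss_bd: "\<exists>A. gauss_bd (1 / 16) A (heatD j 1 :: real^'n::finite \<Rightarrow> real)"
proof -
  obtain F where F: "gtest (1 / (4 * 1)) (2 + 2 * j) F (heat 1 :: real^'n \<Rightarrow> real)" using heat_gtest[OF zero_less_one, of "2 + 2 * j"] by blast
  from heatD_gtest[OF _ F] have "gtest (1 / 4) 2 (\<lambda>k. (neg_laplacian ^^ j) (F k)) (heatD j 1)" by simp
  from gtest_gauss_bd[OF this] show ?thesis by auto
qed

subsection \<open>Integrals against scaling families of kernels\<close>

text \<open>Serves both cases: \<open>heatD\<close> with \<open>\<beta> = n\<close> for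
  \<open>\<alpha> = 2\<close>, and \<open>frac_form \<alpha> (heatD j t)\<close> with
  \<open>\<beta> = n + \<alpha>\<close> for \<open>\<alpha> < 2\<close>. The same exponent
  \<open>\<beta>\<close> governs the parabolic scaling, the spatial decay at time 1 and the weight
  for \<open>u\<close>; this agreement makes the bounds below close up.\<close>

locale kernel_family =
  fixes Q :: "nat \<Rightarrow> real \<Rightarrow> real^'n::finite \<Rightarrow> real" and \<beta> :: real and u :: "real^'n \<Rightarrow> real"
  assumes scale: "t > 0 \<Longrightarrow> Q j t x = t powr (- (real j + \<beta> / 2)) * Q j 1 ((1 / sqrt t) *\<^sub>R x)"
    and decay: "\<exists>C>0. \<forall>x. \<bar>Q j 1 x\<bar> \<le> C * (1 + norm x) powr (- \<beta>)"
    and DERIV_Q: "t > 0 \<Longrightarrow> ((\<lambda>t. Q j t x) has_real_derivative - Q (Suc j) t x) (at t)"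
    and Q_measurable [measurable]: "Q j t \<in> borel_measurable borel"
    and u_measurable [measurable]: "u \<in> borel_measurable borel"
    and W: "integrable lborel (weighted \<beta> u)"
    and \<beta>: "\<beta> > 0"
begin

text \<open>Undoing the scaling turns \<open>1 + norm x\<close> into \<open>sqrt t + norm x\<close>.
  The powers \<open>t powr (\<beta> / 2)\<close> cancel, and \<open>t powr (- j)\<close>
  remains.\<close>

lemma Q_bound: "\<exists>C>0. \<forall>t>0. \<forall>x. \<bar>Q j t x\<bar> \<le> C * t powr (- real j) * (sqrt t + norm x) powr (- \<beta>)"
proof -
  obtain C where C: "C > 0" "\<And>x. \<bar>Q j 1 x\<bar> \<le> C * (1 + norm x) powr (- \<beta>)" using decay by blast
  have "\<bar>Q j t x\<bar> \<le> C * t powr (- real j) * (sqrt t + norm x) powr (- \<beta>)" if t: "t > 0" for t x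
  proof -
    have "\<bar>Q j t x\<bar> = t powr (- (real j + \<beta> / 2)) * \<bar>Q j 1 ((1 / sqrt t) *\<^sub>R x)\<bar>" by (subst scale[OF t]) (simp add: abs_mult)
    also have "\<dots> \<le> t powr (- (real j + \<beta> / 2)) * (C * (1 + norm ((1 / sqrt t) *\<^sub>R x)) powr (- \<beta>))"
      by (intro mult_left_mono C(2)) simp
    also have "1 + norm ((1 / sqrt t) *\<^sub>R x) = (sqrt t + norm x) / sqrt t" using t by (simp add: field_simps)
    also have "((sqrt t + norm x) / sqrt t) powr (- \<beta>) = (sqrt t + norm x) powr (- \<beta>) * t powr (\<beta> / 2)"
    proof -
      have "sqrt t = t powr (1/2)" using t by (simp add: powr_half_sqrt)
      then have "sqrt t powr (- \<beta>) = t powr (- \<beta> / 2)" by (simp add: powr_powr)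
      then show ?thesis using t by (simp add: powr_divide add_nonneg_nonneg powr_minus field_simps)
    qed
    also have "t powr (- (real j + \<beta> / 2)) * (C * ((sqrt t + norm x) powr (- \<beta>) * t powr (\<beta> / 2))) =
       C * (t powr (- (real j + \<beta> / 2)) * t powr (\<beta> / 2)) * (sqrt t + norm x) powr (- \<beta>)" by (simp only: mult_ac)
    also have "t powr (- (real j + \<beta> / 2)) * t powr (\<beta> / 2) = t powr (- real j)" by (simp add: powr_add[symmetric])
    finally show ?thesis .
  qed
  with C(1) show ?thesis by blast
qed

lemma Q_dominated:
  assumes "t0 > 0"
  shows "\<exists>C>0. \<forall>t\<ge>t0. \<forall>x. \<bar>u x * Q j t x\<bar> \<le> C * weighted \<beta> u x"
proof -
  obtain C where C: "C > 0" "\<And>t x. t > 0 \<Longrightarrow> \<bar>Q j t x\<bar> \<le> C * t powr (- real j) * (sqrt t + norm x) powr (- \<beta>)"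
    using Q_bound by blast
  \<comment> \<open>The largest factor for which \<open>m * (1 + norm x)\<close> stays below
    \<open>sqrt t + norm x\<close> for all \<open>x\<close> and all
    \<open>t \<ge> t0\<close>.\<close>
  define m where "m = min (sqrt t0) 1"
  have m: "m > 0" "m \<le> sqrt t0" "m \<le> 1" using assms by (auto simp: m_def)
  have "\<bar>u x * Q j t x\<bar> \<le> (C * t0 powr (- real j) * m powr (- \<beta>)) * weighted \<beta> u x" if t: "t \<ge> t0" for t x
  proof -
    have "m * (1 + norm x) \<le> sqrt t + norm x"
    proof -
      have "m * norm x \<le> norm x" using m by (simp add: mult_left_le_one_le)
      moreover have "m \<le> sqrt t" using m(2) t by (meson order_trans real_sqrt_le_iff)
      ultimately show ?thesis by (simp add: distrib_left)
    qed
    then have "(sqrt t + norm x) powr (- \<beta>) \<le> (m * (1 + norm x)) powr (- \<beta>)"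
      using m(1) \<beta> by (intro powr_mono2') (auto simp: add_pos_nonneg)
    also have "\<dots> = m powr (- \<beta>) * (1 + norm x) powr (- \<beta>)" using m by (simp add: powr_mult)
    finally have 1: "(sqrt t + norm x) powr (- \<beta>) \<le> m powr (- \<beta>) * (1 + norm x) powr (- \<beta>)" .
    have 2: "t powr (- real j) \<le> t0 powr (- real j)" using t assms by (intro powr_mono2') auto
    have "\<bar>Q j t x\<bar> \<le> C * t powr (- real j) * (sqrt t + norm x) powr (- \<beta>)" using C(2) t assms by simp
    also have "\<dots> \<le> C * t0 powr (- real j) * (m powr (- \<beta>) * (1 + norm x) powr (- \<beta>))"
      using 1 2 C(1) by (intro mult_mono mult_left_mono) auto
    finally have "\<bar>u x\<bar> * \<bar>Q j t x\<bar> \<le> \<bar>u x\<bar> * (C * t0 powr (- real j) * (m powr (- \<beta>) * (1 + norm x) powr (- \<beta>)))"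
      by (rule mult_left_mono) simp
    then show ?thesis by (simp add: abs_mult mult_ac)
  qed
  moreover have "C * t0 powr (- real j) * m powr (- \<beta>) > 0" using C(1) m assms by simp
  ultimately show ?thesis by blast
qed

definition A :: "nat \<Rightarrow> real \<Rightarrow> real" where "A j t = (\<integral>x. u x * Q j t x \<partial>lborel)"

lemma integrable_uQ: "t > 0 \<Longrightarrow> integrable lborel (\<lambda>x. u x * Q j t x)"
proof -
  assume t: "t > 0"
  obtain C where C: "C > 0" "\<And>s x. s \<ge> t \<Longrightarrow> \<bar>u x * Q j s x\<bar> \<le> C * weighted \<beta> u x" using Q_dominated[OF t] by blast
  show ?thesis
    by (rule Bochner_Integration.integrable_bound[OF integrable_mult_right[OF W, of C]])
      (use C(2)[of t] in \<open>auto intro!: AE_I2 order_trans[OF _ abs_ge_self]\<close>)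
qed

lemma A_DERIV: "t > 0 \<Longrightarrow> (A j has_real_derivative - A (Suc j) t) (at t)"
proof -
  assume t: "t > 0"
  obtain C where C: "C > 0" "\<And>s x. s \<ge> t / 2 \<Longrightarrow> \<bar>u x * Q (Suc j) s x\<bar> \<le> C * weighted \<beta> u x"
    using Q_dominated[of "t / 2" "Suc j"] t by auto
  have "((\<lambda>t. \<integral>x. u x * Q j t x \<partial>lborel) has_real_derivative (\<integral>x. u x * (- Q (Suc j) t x) \<partial>lborel)) (at t)"
  proof (rule has_real_derivative_integral_dominated[where d = "t / 2" and F' = "\<lambda>t x. u x * (- Q (Suc j) t x)" and g = "\<lambda>x. C * weighted \<beta> u x"])
    fix s assume s: "\<bar>s - t\<bar> < t / 2"
    then have s0: "s > 0" "s \<ge> t / 2" using t unfolding abs_less_iff by linarith+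
    show "integrable lborel (\<lambda>x. u x * Q j s x)" using s0(1) by (rule integrable_uQ)
    fix x
    show "((\<lambda>t. u x * Q j t x) has_real_derivative u x * (- Q (Suc j) s x)) (at s)" by (intro DERIV_cmult DERIV_Q s0)
    show "\<bar>u x * (- Q (Suc j) s x)\<bar> \<le> C * weighted \<beta> u x" using C(2)[OF s0(2), of x] by simp
  qed (use t W in auto)
  then show ?thesis by (simp add: A_def[abs_def])
qed

text \<open>The pointwise decay \<open>sqrt t powr (- \<beta>)\<close> comes from
  \<open>\<beta> > 0\<close> and not from the index, so \<open>A 0\<close> tends to zero as
  well.\<close>

lemma A_tendsto_0: "(A j \<longlongrightarrow> 0) at_top"
proof -
  obtain C where C: "C > 0" "\<And>s x. s \<ge> 1 \<Longrightarrow> \<bar>u x * Q j s x\<bar> \<le> C * weighted \<beta> u x" using Q_dominated[OF zero_less_one] by blast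
  obtain D where D: "D > 0" "\<And>t x. t > 0 \<Longrightarrow> \<bar>Q j t x\<bar> \<le> D * t powr (- real j) * (sqrt t + norm x) powr (- \<beta>)"
    using Q_bound by blast
  have "((\<lambda>t. \<integral>x. u x * Q j t x \<partial>lborel) \<longlongrightarrow> (\<integral>x. 0 \<partial>(lborel :: (real^'n) measure))) at_top"
  proof (rule integral_dominated_convergence_at_top[where w = "\<lambda>x. C * weighted \<beta> u x"])
    show "\<forall>\<^sub>F t in at_top. AE x in lborel. norm (u x * Q j t x) \<le> C * weighted \<beta> u x"
      using eventually_ge_at_top[of 1] by eventually_elim (use C(2) in auto)
    show "AE x in lborel. ((\<lambda>t. u x * Q j t x) \<longlongrightarrow> 0) at_top"
    proof (rule AE_I2)
      fix x
      have "((\<lambda>t. \<bar>u x\<bar> * (D * (sqrt t) powr (- \<beta>))) \<longlongrightarrow> \<bar>u x\<bar> * (D * 0)) at_top"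
        using \<beta> by (intro tendsto_intros tendsto_neg_powr sqrt_at_top) auto
      moreover have "\<forall>\<^sub>F t in at_top. norm (u x * Q j t x) \<le> \<bar>u x\<bar> * (D * (sqrt t) powr (- \<beta>))"
        using eventually_ge_at_top[of 1]
      proof eventually_elim
        case (elim t)
        have "t powr (- real j) \<le> 1" using powr_mono2'[of "- real j" 1 t] elim by simp
        moreover have "(sqrt t + norm x) powr (- \<beta>) \<le> (sqrt t) powr (- \<beta>)" using elim \<beta> by (intro powr_mono2') auto
        ultimately have "D * t powr (- real j) * (sqrt t + norm x) powr (- \<beta>) \<le> D * 1 * (sqrt t) powr (- \<beta>)"
          using D(1) by (intro mult_mono mult_left_mono) auto
        then have "\<bar>Q j t x\<bar> \<le> D * (sqrt t) powr (- \<beta>)" using D(2)[of t x] elim by simp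
        then show ?case by (simp add: abs_mult mult_left_mono)
      qed
      ultimately show "((\<lambda>t. u x * Q j t x) \<longlongrightarrow> 0) at_top"
        unfolding mult_zero_right by (rule Lim_null_comparison[rotated])
    qed
  qed (use W in auto)
  then show ?thesis by (simp add: A_def[abs_def])
qed

end

subsection \<open>Integrating power lower bounds\<close>

text \<open>Subtracting the integrated power from \<open>A\<close> leaves a nonincreasing function
  with limit 0, which is therefore nonnegative.\<close>

lemma power_lower_bound_step:
  fixes A B :: "real \<Rightarrow> real"
  assumes D: "\<And>t. t \<ge> 1 \<Longrightarrow> (A has_real_derivative - B t) (at t)" and lim: "(A \<longlongrightarrow> 0) at_top"
    and B: "\<And>t. t \<ge> 1 \<Longrightarrow> B t \<ge> c * t powr (- b)" and b: "b > 1" and t: "t \<ge> 1"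
  shows "A t \<ge> c / (b - 1) * t powr (1 - b)"
proof -
  define g where "g t = A t - c / (b - 1) * t powr (1 - b)" for t
  have dg: "(g has_real_derivative - B s + c * s powr (- b)) (at s)" if "s \<ge> 1" for s
  proof -
    have "((\<lambda>t. t powr (1 - b)) has_real_derivative (1 - b) * s powr (1 - b - 1)) (at s)"
      using that by (intro has_real_derivative_powr) auto
    from DERIV_diff[OF D[OF that] DERIV_cmult[OF this, of "c / (b - 1)"]]
    have "(g has_real_derivative - B s - c / (b - 1) * ((1 - b) * s powr (1 - b - 1))) (at s)"
      by (simp add: g_def[abs_def])
    moreover have "c / (b - 1) * ((1 - b) * P) = - c * P" for P using b by (simp add: field_simps)
    ultimately show ?thesis by simp
  qed
  have mono: "g s \<le> g t" if "s \<ge> t" for s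
  proof (rule DERIV_nonpos_imp_nonincreasing[OF that])
    fix x assume "t \<le> x" "x \<le> s"
    then have "x \<ge> 1" using t by simp
    then show "\<exists>y. (g has_real_derivative y) (at x) \<and> y \<le> 0" using dg[of x] B[of x] by (intro exI conjI) auto
  qed
  have "((\<lambda>t. t powr (1 - b)) \<longlongrightarrow> 0) at_top" using b by (intro tendsto_neg_powr filterlim_ident) auto
  then have "(g \<longlongrightarrow> 0 - c / (b - 1) * 0) at_top" unfolding g_def[abs_def] by (intro tendsto_intros lim)
  then have "(g \<longlongrightarrow> 0) at_top" by simp
  then have "g t \<ge> 0"
    by (rule tendsto_upperbound) (auto intro: eventually_mono[OF eventually_ge_at_top[of t] mono])
  then show ?thesis by (simp add: g_def)
qed

text \<open>For \<open>b \<le> 1\<close> the lower bound has a divergent integral: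
  \<open>A t + c * ln t\<close> would be nonincreasing and yet tend to infinity.\<close>

lemma power_lower_bound_contra:
  fixes A B :: "real \<Rightarrow> real"
  assumes D: "\<And>t. t \<ge> 1 \<Longrightarrow> (A has_real_derivative - B t) (at t)" and lim: "(A \<longlongrightarrow> 0) at_top"
    and B: "\<And>t. t \<ge> 1 \<Longrightarrow> B t \<ge> c * t powr (- b)" and b: "b \<le> 1" and c: "c > 0"
  shows False
proof -
  define g where "g t = A t + c * ln t" for t
  have dg: "(g has_real_derivative - B s + c * (1 / s)) (at s)" if "s \<ge> 1" for s
  proof -
    have "(ln has_real_derivative 1 / s) (at s)" using DERIV_ln_divide[of s] that by simp
    from DERIV_add[OF D[OF that] DERIV_cmult[OF this, of c]] show ?thesis by (simp add: g_def[abs_def])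
  qed
  have le: "g s \<le> g 1" if "s \<ge> 1" for s
  proof (rule DERIV_nonpos_imp_nonincreasing[OF that])
    fix x :: real assume x: "1 \<le> x" "x \<le> s"
    have "x powr (- b) \<ge> x powr (- 1)" using b x by (intro powr_mono) auto
    moreover have "x powr (- 1) = 1 / x" using x by (simp add: powr_minus_divide)
    ultimately have "c * (1 / x) \<le> c * x powr (- b)" using c by (intro mult_left_mono) auto
    then show "\<exists>y. (g has_real_derivative y) (at x) \<and> y \<le> 0" using dg[of x] B[of x] x by (intro exI conjI) auto
  qed
  have "filterlim (\<lambda>t. A t + c * ln t) at_top at_top"
    by (rule filterlim_tendsto_add_at_top[OF lim]) (use c in real_asymp)
  then have "eventually (\<lambda>t. g t > g 1) at_top" unfolding g_def[abs_def] by (simp add: filterlim_at_top_dense)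
  with eventually_ge_at_top[of 1] have "eventually (\<lambda>t::real. False) at_top"
    by eventually_elim (use le in force)
  then show False by simp
qed

text \<open>Every integration lowers the index by one and the exponent \<open>b\<close> by one, and
  it is possible only from \<open>b > 1\<close>. Hence \<open>M\<close> integrations need
  \<open>M < b\<close>, and the exponent \<open>real M - b\<close> is left at the end.\<close>

lemma power_lower_bound_chain:
  fixes A :: "nat \<Rightarrow> real \<Rightarrow> real"
  assumes D: "\<And>j t. t \<ge> 1 \<Longrightarrow> (A j has_real_derivative - A (Suc j) t) (at t)" and lim: "\<And>j. (A j \<longlongrightarrow> 0) at_top"
    and M: "\<And>t. t \<ge> 1 \<Longrightarrow> A M t \<ge> c * t powr (- b)" and c: "c > 0" and b: "b > 0"
  shows "real M < b \<and> (\<exists>c>0. \<forall>t\<ge>1. A 0 t \<ge> c * t powr (real M - b))"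
  using M c b
proof (induction M arbitrary: b c)
  case 0
  then show ?case by (auto intro!: exI[of _ c])
next
  case (Suc M)
  have b: "b > 1"
  proof (rule ccontr)
    assume "\<not> b > 1"
    then show False using power_lower_bound_contra[where A = "A M" and B = "A (Suc M)" and c = c and b = b] D lim Suc.prems by auto
  qed
  have "real M < b - 1 \<and> (\<exists>c>0. \<forall>t\<ge>1. A 0 t \<ge> c * t powr (real M - (b - 1)))"
  proof (rule Suc.IH)
    show "c / (b - 1) * t powr (- (b - 1)) \<le> A M t" if "t \<ge> 1" for t
      using power_lower_bound_step[where A = "A M" and B = "A (Suc M)" and c = c and b = b] D lim Suc.prems b that by simp
  qed (use b Suc.prems in auto)
  then show ?case by (simp add: algebra_simps)
qed

section \<open>Gaussian bounds uniform in time, and the two kernel families\<close>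

lemma gauss_bd_cmult:
  assumes "gauss_bd l A \<psi>"
  shows "gauss_bd l (\<bar>c\<bar> * A) (\<lambda>z. c * \<psi> z)"
proof -
  have "sdiff (\<lambda>z. c * \<psi> z) z y = c * sdiff \<psi> z y" for z y by (simp add: sdiff_def algebra_simps)
  then show ?thesis using assms unfolding gauss_bd_def
    by (auto simp: abs_mult mult.assoc intro!: mult_left_mono)
qed

lemma gauss_bd_mono:
  fixes \<psi> :: "real^'n::finite \<Rightarrow> real"
  assumes \<psi>: "gauss_bd l A \<psi>" and "l' \<le> l" "A \<le> A'"
  shows "gauss_bd l' A' \<psi>"
proof -
  have "B * exp (- l * r\<^sup>2) \<le> B * exp (- l' * r\<^sup>2)" if "B \<ge> 0" for B r
    using that assms(2) by (intro mult_left_mono) (auto intro: mult_right_mono)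
  moreover have "B * exp r \<le> B' * exp r" if "B \<le> B'" for B B' r :: real using that by (intro mult_right_mono) auto
  moreover have "A * (norm y)\<^sup>2 \<le> A' * (norm y)\<^sup>2" for y :: "real^'n" using assms(3) by (intro mult_right_mono) auto
  ultimately show ?thesis using \<psi> assms(3) unfolding gauss_bd_def
    by (meson order_trans zero_le_mult_iff zero_le_power2)
qed

text \<open>The constants depend on \<open>c0\<close> and \<open>c1\<close> but not on
  \<open>c\<close>, so one bound covers a whole range of dilations.\<close>

lemma gauss_bd_scale:
  fixes h :: "real^'n::finite \<Rightarrow> real"
  assumes h: "gauss_bd l A h" and l: "l > 0" and c: "0 < c0" "c0 \<le> c" "c \<le> c1"
  shows "gauss_bd (l * c0\<^sup>2 / 2) (4 * A * exp (l * c1\<^sup>2) * (1 + c1\<^sup>2)) (\<lambda>z. h (c *\<^sub>R z))"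
proof -
  have A: "A \<ge> 0" and hm [measurable]: "h \<in> borel_measurable borel"
    and b1: "\<And>z. \<bar>h z\<bar> \<le> A * exp (- l * (norm z)\<^sup>2)"
    and b2: "\<And>z y. norm y \<le> 1 \<Longrightarrow> \<bar>sdiff h z y\<bar> \<le> A * (norm y)\<^sup>2 * exp (- l * (norm z)\<^sup>2)"
    using h by (auto simp: gauss_bd_def)
  have c': "c > 0" "c0\<^sup>2 \<le> c\<^sup>2" "c\<^sup>2 \<le> c1\<^sup>2" using c by (auto intro: power_mono)
  have E1: "exp (l * c1\<^sup>2) \<ge> 1" using l by simp
  have sd: "sdiff (\<lambda>z. h (c *\<^sub>R z)) z y = sdiff h (c *\<^sub>R z) (c *\<^sub>R y)" for z y
    by (simp add: sdiff_def scaleR_add_right scaleR_diff_right)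
  have e: "exp (- l * (norm (c *\<^sub>R w))\<^sup>2) \<le> exp (l * c1\<^sup>2) * exp (- (l * c0\<^sup>2 / 2) * (norm z)\<^sup>2)"
    if "norm (w - z) \<le> 1" for w z :: "real^'n"
  proof -
    have "norm z \<le> norm w + 1" using that norm_triangle_ineq3[of w z] by linarith
    then have "(norm z)\<^sup>2 \<le> (norm w + 1)\<^sup>2" by (intro power_mono) auto
    also have "\<dots> \<le> 2 * (norm w)\<^sup>2 + 2" using zero_le_power2[of "norm w - 1"] by (simp add: power2_eq_square algebra_simps)
    finally have "c\<^sup>2 * (norm z)\<^sup>2 \<le> c\<^sup>2 * (2 * (norm w)\<^sup>2 + 2)" by (intro mult_left_mono) auto
    moreover have "c0\<^sup>2 * (norm z)\<^sup>2 \<le> c\<^sup>2 * (norm z)\<^sup>2" using c' by (intro mult_right_mono) auto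
    ultimately have "c0\<^sup>2 * (norm z)\<^sup>2 \<le> 2 * (c\<^sup>2 * (norm w)\<^sup>2) + 2 * c1\<^sup>2" using c' by (simp add: algebra_simps)
    then have "l * (c0\<^sup>2 * (norm z)\<^sup>2) \<le> l * (2 * (c\<^sup>2 * (norm w)\<^sup>2) + 2 * c1\<^sup>2)" using l by (intro mult_left_mono) auto
    then have "- l * (norm (c *\<^sub>R w))\<^sup>2 \<le> l * c1\<^sup>2 + - (l * c0\<^sup>2 / 2) * (norm z)\<^sup>2"
      by (simp add: power_mult_distrib algebra_simps)
    then show ?thesis by (simp add: exp_add[symmetric])
  qed
  have H: "\<bar>h (c *\<^sub>R w)\<bar> \<le> A * (exp (l * c1\<^sup>2) * exp (- (l * c0\<^sup>2 / 2) * (norm z)\<^sup>2))" if "norm (w - z) \<le> 1" for w z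
    using b1[of "c *\<^sub>R w"] mult_left_mono[OF e[OF that] A] by linarith
  show ?thesis
    unfolding gauss_bd_def
  proof (intro conjI allI impI)
    show "0 \<le> 4 * A * exp (l * c1\<^sup>2) * (1 + c1\<^sup>2)" using A by (intro mult_nonneg_nonneg) auto
    show "(\<lambda>z. h (c *\<^sub>R z)) \<in> borel_measurable borel" by measurable
    fix z :: "real^'n"
    let ?P = "exp (l * c1\<^sup>2) * exp (- (l * c0\<^sup>2 / 2) * (norm z)\<^sup>2)"
    have P: "A * ?P \<ge> 0" using A by simp
    have up: "k * (A * ?P) \<le> k * (4 * (1 + c1\<^sup>2) * (A * ?P))" if "k \<ge> 0" for k
    proof -
      have "1 * (A * ?P) \<le> (4 * (1 + c1\<^sup>2)) * (A * ?P)" using P by (intro mult_right_mono) auto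
      then show ?thesis using that by (intro mult_left_mono) auto
    qed
    have "\<bar>h (c *\<^sub>R z)\<bar> \<le> A * ?P" by (rule H) simp
    also have "\<dots> \<le> 4 * (1 + c1\<^sup>2) * (A * ?P)" using up[of 1] by (simp only: mult_1 zero_le_one simp_thms)
    finally show "\<bar>h (c *\<^sub>R z)\<bar> \<le> 4 * A * exp (l * c1\<^sup>2) * (1 + c1\<^sup>2) * exp (- (l * c0\<^sup>2 / 2) * (norm z)\<^sup>2)"
      by (simp only: mult_ac)
    fix y :: "real^'n" assume y: "norm y \<le> 1"
    show "\<bar>sdiff (\<lambda>z. h (c *\<^sub>R z)) z y\<bar> \<le> 4 * A * exp (l * c1\<^sup>2) * (1 + c1\<^sup>2) * (norm y)\<^sup>2 * exp (- (l * c0\<^sup>2 / 2) * (norm z)\<^sup>2)"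
    proof (cases "norm (c *\<^sub>R y) \<le> 1")
      case True
      have "\<bar>sdiff h (c *\<^sub>R z) (c *\<^sub>R y)\<bar> \<le> A * (norm (c *\<^sub>R y))\<^sup>2 * exp (- l * (norm (c *\<^sub>R z))\<^sup>2)" by (rule b2[OF True])
      also have "\<dots> \<le> A * (c1\<^sup>2 * (norm y)\<^sup>2) * ?P"
        using A c' e[of z z] by (intro mult_mono mult_left_mono) (auto simp: power_mult_distrib intro: mult_right_mono)
      also have "\<dots> = c1\<^sup>2 * (norm y)\<^sup>2 * (A * ?P)" by (simp add: mult_ac)
      also have "\<dots> \<le> (4 * (1 + c1\<^sup>2)) * (norm y)\<^sup>2 * (A * ?P)"
        using P by (intro mult_right_mono) auto
      finally show ?thesis unfolding sd by (simp only: mult_ac)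
    next
      \<comment> \<open>The dilated increment has left the unit ball and the quadratic bound does
        not apply. But then \<open>1 \<le> c1^2 * (norm y)^2\<close>, so bounding the values of
        \<open>h\<close> separately suffices; this explains the factor
        \<open>4 * (1 + c1^2)\<close>.\<close>
      case False
      have "norm (c *\<^sub>R y) \<le> c1 * norm y" using c c' by (simp add: mult_right_mono)
      then have "1 \<le> c1 * norm y" using False by linarith
      then have y2: "1 \<le> c1\<^sup>2 * (norm y)\<^sup>2" using one_le_power[of "c1 * norm y" 2] by (simp add: power_mult_distrib)
      have "\<bar>sdiff h (c *\<^sub>R z) (c *\<^sub>R y)\<bar> \<le> 2 * \<bar>h (c *\<^sub>R z)\<bar> + \<bar>h (c *\<^sub>R (z + y))\<bar> + \<bar>h (c *\<^sub>R (z - y))\<bar>"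
        by (simp add: sdiff_def scaleR_add_right scaleR_diff_right)
      also have "\<dots> \<le> 4 * (A * ?P)" using H[of z z] H[of "z + y" z] H[of "z - y" z] y by simp
      also have "\<dots> \<le> (4 * (c1\<^sup>2 * (norm y)\<^sup>2)) * (A * ?P)" using P y2 by (intro mult_right_mono) auto
      also have "\<dots> \<le> (4 * (1 + c1\<^sup>2) * (norm y)\<^sup>2) * (A * ?P)" using P by (intro mult_right_mono) (auto simp: algebra_simps)
      finally show ?thesis unfolding sd by (simp only: mult_ac)
    qed
  qed
qed

text \<open>Differentiation in \<open>t\<close> under an integral requires one bound on a whole time
  interval. By parabolic scaling it reduces to time 1, with dilation factors
  \<open>1 / sqrt s\<close> confined between \<open>c0\<close> and \<open>c1\<close>.\<close>

lemma heatD_gauss_bd_uniform: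
  assumes t: "t > 0"
  shows "\<exists>l>0. \<exists>A. \<forall>s. \<bar>s - t\<bar> < t / 2 \<longrightarrow> gauss_bd l A (heatD j s :: real^'n::finite \<Rightarrow> real)"
proof -
  let ?a = "real j + real CARD('n) / 2"
  obtain A where A: "gauss_bd (1 / 16) A (heatD j 1 :: real^'n \<Rightarrow> real)" using heatD_gauss_bd by blast
  have A0: "A \<ge> 0" using A by (simp add: gauss_bd_def)
  define c0 where "c0 = 1 / sqrt (3 * t / 2)"
  define c1 where "c1 = 1 / sqrt (t / 2)"
  define B where "B = 4 * A * exp (1 / 16 * c1\<^sup>2) * (1 + c1\<^sup>2)"
  have B: "B \<ge> 0" unfolding B_def using A0 by simp
  have "gauss_bd (1 / 16 * c0\<^sup>2 / 2) ((t / 2) powr (- ?a) * B) (heatD j s :: real^'n \<Rightarrow> real)" if s: "\<bar>s - t\<bar> < t / 2" for s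
  proof -
    have s0: "t / 2 < s" "s < 3 * t / 2" using s by linarith+
    then have sp: "s > 0" using t by linarith
    have "gauss_bd (1 / 16 * c0\<^sup>2 / 2) B (\<lambda>z::real^'n. heatD j 1 ((1 / sqrt s) *\<^sub>R z))"
      unfolding B_def
    proof (rule gauss_bd_scale[OF A])
      show "c0 > 0" "c0 \<le> 1 / sqrt s" "1 / sqrt s \<le> c1" unfolding c0_def c1_def using t s0 sp
        by (auto intro!: divide_left_mono mult_pos_pos)
    qed simp
    from gauss_bd_cmult[OF this, of "s powr (- ?a)"]
    have "gauss_bd (1 / 16 * c0\<^sup>2 / 2) (s powr (- ?a) * B) (heatD j s :: real^'n \<Rightarrow> real)"
      by (simp only: heatD_scale[OF sp, symmetric] abs_of_nonneg[OF powr_ge_zero])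
    then show ?thesis
    proof (rule gauss_bd_mono)
      have "s powr (- ?a) \<le> (t / 2) powr (- ?a)" using t s0 by (intro powr_mono2') auto
      then show "s powr (- ?a) * B \<le> (t / 2) powr (- ?a) * B" using B by (rule mult_right_mono)
    qed simp
  qed
  moreover have "1 / 16 * c0\<^sup>2 / 2 > 0" using t by (simp add: c0_def)
  ultimately show ?thesis by blast
qed

lemma gaussian_le_weight:
  fixes l b :: real
  assumes "l > 0"
  shows "\<exists>C>0. \<forall>x::real^'n::finite. exp (- l * (norm x)\<^sup>2) \<le> C * (1 + norm x) powr (- b)"
proof -
  obtain C where C: "C > 0" "\<And>r. r \<ge> 0 \<Longrightarrow> (1 + r) powr b * exp (- l * r\<^sup>2) \<le> C" using powr_mult_gaussian_bound[OF assms, of b] by blast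
  have "exp (- l * (norm x)\<^sup>2) \<le> C * (1 + norm x) powr (- b)" for x :: "real^'n"
  proof -
    have p: "(1 + norm x) powr b > 0" by (smt (verit) norm_ge_zero powr_gt_zero)
    show ?thesis using C(2)[of "norm x"] p unfolding powr_minus_divide by (simp add: pos_le_divide_eq mult.commute)
  qed
  with C(1) show ?thesis by blast
qed

text \<open>The decay is far better than required; the exponent \<open>\<beta> = n\<close> is
  dictated by the scaling of the heat kernel.\<close>

lemma heatD_kernel_family:
  fixes u :: "real^'n::finite \<Rightarrow> real"
  assumes um: "u \<in> borel_measurable borel" and W: "integrable lborel (weighted (real CARD('n)) u)"
  shows "kernel_family heatD (real CARD('n)) u"
proof
  show "\<exists>C>0. \<forall>x::real^'n. \<bar>heatD j 1 x\<bar> \<le> C * (1 + norm x) powr (- real CARD('n))" for j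
  proof -
    obtain A where A: "gauss_bd (1 / 16) A (heatD j 1 :: real^'n \<Rightarrow> real)" using heatD_gauss_bd by blast
    obtain C where C: "C > 0" "\<And>x::real^'n. exp (- (1/16) * (norm x)\<^sup>2) \<le> C * (1 + norm x) powr (- real CARD('n))"
      using gaussian_le_weight[of "1/16", where 'n='n] by (metis zero_less_divide_1_iff zero_less_numeral)
    have A0: "A \<ge> 0" using A by (simp add: gauss_bd_def)
    have "\<bar>heatD j 1 x\<bar> \<le> ((A + 1) * C) * (1 + norm x) powr (- real CARD('n))" for x :: "real^'n"
    proof -
      have "\<bar>heatD j 1 x\<bar> \<le> A * exp (- (1/16) * (norm x)\<^sup>2)" using A unfolding gauss_bd_def by blast
      also have "\<dots> \<le> (A + 1) * (C * (1 + norm x) powr (- real CARD('n)))" using A0 C(2) by (intro mult_mono) auto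
      finally show ?thesis by (simp add: mult.assoc)
    qed
    moreover have "(A + 1) * C > 0" using A0 C by simp
    ultimately show ?thesis by blast
  qed
qed (use assms heatD_DERIV_time heatD_scale in auto)

lemma frac_form_measurable [measurable]:
  fixes w :: "real^'n::finite \<Rightarrow> real"
  assumes [measurable]: "w \<in> borel_measurable borel"
  shows "frac_form \<alpha> w \<in> borel_measurable borel"
proof -
  have "(\<lambda>x. \<integral>y. sdiff w x y * riesz_ker \<alpha> y \<partial>lborel) \<in> borel_measurable borel"
    by (rule lborel.borel_measurable_lebesgue_integral) measurable
  then show ?thesis by (simp add: frac_form_def[abs_def])
qed

text \<open>The kernel is homogeneous of degree \<open>- (n + \<alpha>)\<close>, so rescaling
  \<open>y\<close> by \<open>1 / sqrt t\<close> costs \<open>t powr (- \<alpha> / 2)\<close>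
  altogether.\<close>

lemma frac_form_heatD_scale:
  assumes t: "t > 0"
  shows "frac_form \<alpha> (heatD j t) (x::real^'n::finite) =
    t powr (- (real j + (real CARD('n) + \<alpha>) / 2)) * frac_form \<alpha> (heatD j 1) ((1 / sqrt t) *\<^sub>R x)"
proof -
  let ?n = "real CARD('n)"
  define c where "c = 1 / sqrt t"
  have c: "c > 0" using t by (simp add: c_def)
  let ?h = "heatD j 1 :: real^'n \<Rightarrow> real"
  let ?G = "\<lambda>w. sdiff ?h (c *\<^sub>R x) w * riesz_ker \<alpha> w"
  have sq: "sqrt t = t powr (1/2)" using t by (simp add: powr_half_sqrt)
  have ct: "c = t powr (- (1 / 2))" unfolding c_def sq by (simp add: powr_minus_divide)
  have K: "riesz_ker \<alpha> y = t powr (- ((?n + \<alpha>) / 2)) * riesz_ker \<alpha> (c *\<^sub>R y)" for y :: "real^'n"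
  proof -
    have "riesz_ker \<alpha> (c *\<^sub>R y) = c powr (- (?n + \<alpha>)) * norm y powr (- (?n + \<alpha>))"
      using c unfolding riesz_ker_def by (simp add: powr_mult)
    also have "c powr (- (?n + \<alpha>)) = t powr ((?n + \<alpha>) / 2)"
      unfolding ct powr_powr by (rule arg_cong[where f = "\<lambda>e. t powr e"]) (simp add: field_simps)
    finally have "t powr (- ((?n + \<alpha>) / 2)) * riesz_ker \<alpha> (c *\<^sub>R y) = (t powr (- ((?n + \<alpha>) / 2)) * t powr ((?n + \<alpha>) / 2)) * norm y powr (- (?n + \<alpha>))"
      by (simp only: mult.assoc)
    also have "t powr (- ((?n + \<alpha>) / 2)) * t powr ((?n + \<alpha>) / 2) = 1" using t by (simp add: powr_add[symmetric])
    finally show ?thesis by (simp add: riesz_ker_def)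
  qed
  have S: "sdiff (heatD j t) x y = t powr (- (real j + ?n / 2)) * sdiff ?h (c *\<^sub>R x) (c *\<^sub>R y)" for y
    unfolding sdiff_def heatD_scale[OF t, of j x] heatD_scale[OF t, of j "x + y"] heatD_scale[OF t, of j "x - y"] c_def
    by (simp add: scaleR_add_right scaleR_diff_right algebra_simps)
  have "frac_form \<alpha> (heatD j t) x = (\<integral>y. (t powr (- (real j + ?n / 2)) * t powr (- ((?n + \<alpha>) / 2))) * ?G (c *\<^sub>R y) \<partial>lborel)"
    unfolding frac_form_def S by (subst K) (simp only: mult_ac)
  also have "\<dots> = (t powr (- (real j + ?n / 2)) * t powr (- ((?n + \<alpha>) / 2))) * ((\<integral>w. ?G w \<partial>lborel) / c ^ CARD('n))"
    using c by (subst integral_mult_right_zero, subst integral_lborel_scale) auto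
  also have "\<dots> = (t powr (- (real j + ?n / 2)) * t powr (- ((?n + \<alpha>) / 2)) / c ^ CARD('n)) * frac_form \<alpha> ?h (c *\<^sub>R x)"
    by (simp add: frac_form_def)
  also have "c ^ CARD('n) = t powr (- (?n / 2))" using powr_half_card[OF t, of "CARD('n)"] by (simp add: c_def)
  also have "t powr (- (real j + ?n / 2)) * t powr (- ((?n + \<alpha>) / 2)) / t powr (- (?n / 2)) = t powr (- (real j + (?n + \<alpha>) / 2))"
    unfolding powr_add[symmetric] powr_diff[symmetric] by (rule arg_cong[where f = "\<lambda>e. t powr e"]) (simp add: field_simps)
  finally show ?thesis by (simp add: c_def)
qed

lemma frac_form_heatD_DERIV:
  assumes \<alpha>: "0 < \<alpha>" "\<alpha> < 2" and t: "t > 0"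
  shows "((\<lambda>t. frac_form \<alpha> (heatD j t) (x::real^'n::finite)) has_real_derivative - frac_form \<alpha> (heatD (Suc j) t) x) (at t)"
proof -
  obtain l A where l: "l > 0" and A: "\<And>s. \<bar>s - t\<bar> < t / 2 \<Longrightarrow> gauss_bd l A (heatD (Suc j) s :: real^'n \<Rightarrow> real)"
    using heatD_gauss_bd_uniform[OF t, of "Suc j", where 'n='n] by blast
  obtain l' A' where l': "l' > 0" and A': "\<And>s. \<bar>s - t\<bar> < t / 2 \<Longrightarrow> gauss_bd l' A' (heatD j s :: real^'n \<Rightarrow> real)"
    using heatD_gauss_bd_uniform[OF t, of j, where 'n='n] by blast
  have "((\<lambda>t. \<integral>y. sdiff (heatD j t) x y * riesz_ker \<alpha> y \<partial>lborel) has_real_derivative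
      (\<integral>y. - sdiff (heatD (Suc j) t) x y * riesz_ker \<alpha> y \<partial>lborel)) (at t)"
  proof (rule has_real_derivative_integral_dominated[where d = "t / 2" and F' = "\<lambda>t y. - sdiff (heatD (Suc j) t) x y * riesz_ker \<alpha> y" and g = "\<lambda>y. A * maj \<alpha> l x y"])
    fix s assume s: "\<bar>s - t\<bar> < t / 2"
    then have sp: "s > 0" using t unfolding abs_less_iff by linarith
    show "integrable lborel (\<lambda>y. sdiff (heatD j s) x y * riesz_ker \<alpha> y)"
      by (rule gauss_bd_frac_form(1)[OF A'[OF s] \<alpha> l'])
    fix y :: "real^'n"
    show "\<bar>- sdiff (heatD (Suc j) s) x y * riesz_ker \<alpha> y\<bar> \<le> A * maj \<alpha> l x y"
      using gauss_bd_sdiff_le[OF A[OF s] \<alpha>(1), of x y] by simp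
    have "((\<lambda>t. sdiff (heatD j t) x y) has_real_derivative
        2 * - heatD (Suc j) s x - - heatD (Suc j) s (x + y) - - heatD (Suc j) s (x - y)) (at s)"
      unfolding sdiff_def by (intro DERIV_diff DERIV_cmult heatD_DERIV_time[OF sp])
    then have "((\<lambda>t. sdiff (heatD j t) x y) has_real_derivative - sdiff (heatD (Suc j) s) x y) (at s)"
      by (simp add: sdiff_def algebra_simps)
    then show "((\<lambda>t. sdiff (heatD j t) x y * riesz_ker \<alpha> y) has_real_derivative - sdiff (heatD (Suc j) s) x y * riesz_ker \<alpha> y) (at s)"
      by (rule DERIV_cmult_right)
  qed (use t integrable_maj[OF \<alpha> l, of x] in auto)
  then show ?thesis by (simp add: frac_form_def[abs_def])
qed

text \<open>Decay at time 1 is that of the kernel, by \<open>integral_maj_le\<close>. Its exponent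
  \<open>n + \<alpha>\<close> coincides with the one found in the scaling law.\<close>

lemma frac_form_heatD_kernel_family:
  fixes u :: "real^'n::finite \<Rightarrow> real"
  assumes \<alpha>: "0 < \<alpha>" "\<alpha> < 2"
    and um: "u \<in> borel_measurable borel" and W: "integrable lborel (weighted (real CARD('n) + \<alpha>) u)"
  shows "kernel_family (\<lambda>j t. frac_form \<alpha> (heatD j t)) (real CARD('n) + \<alpha>) u"
proof
  show "\<exists>C>0. \<forall>x::real^'n. \<bar>frac_form \<alpha> (heatD j 1) x\<bar> \<le> C * (1 + norm x) powr (- (real CARD('n) + \<alpha>))" for j
  proof -
    obtain A where A: "gauss_bd (1 / 16) A (heatD j 1 :: real^'n \<Rightarrow> real)" using heatD_gauss_bd by blast
    have A0: "A \<ge> 0" using A by (simp add: gauss_bd_def)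
    obtain C where C: "C > 0" "\<And>x::real^'n. (\<integral>y. maj \<alpha> (1/16) x y \<partial>lborel) \<le> C * (1 + norm x) powr (- (real CARD('n) + \<alpha>))"
      using integral_maj_le[OF \<alpha>, of "1/16", where 'n='n] by auto
    have "\<bar>frac_form \<alpha> (heatD j 1) x\<bar> \<le> ((A + 1) * C) * (1 + norm x) powr (- (real CARD('n) + \<alpha>))" for x :: "real^'n"
    proof -
      have "\<bar>frac_form \<alpha> (heatD j 1) x\<bar> \<le> A * (\<integral>y. maj \<alpha> (1/16) x y \<partial>lborel)"
        by (rule gauss_bd_frac_form(3)[OF A \<alpha>]) simp
      also have "\<dots> \<le> (A + 1) * (C * (1 + norm x) powr (- (real CARD('n) + \<alpha>)))"
        using A0 C(2)[of x] by (intro mult_mono) (auto intro!: integral_nonneg_AE maj_nonneg)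
      finally show ?thesis by (simp add: mult.assoc)
    qed
    moreover have "(A + 1) * C > 0" using A0 C by simp
    ultimately show ?thesis by blast
  qed
qed (use assms frac_form_heatD_DERIV[OF \<alpha>] frac_form_heatD_scale in auto)

subsection \<open>Lower bound from the equation\<close>

text \<open>Stated for limits \<open>L\<close> along compactly supported approximations, because the
  integral of \<open>f\<close> against the heat kernel is not known to exist. Positivity at
  \<open>x0\<close> spreads to a ball, and nonnegativity discards the rest. The constant precedes
  the quantifiers over time, approximation and limit.\<close>

lemma heat_test_lower_bound:
  fixes f :: "real^'n::finite \<Rightarrow> real"
  assumes cf: "continuous_on UNIV f" and f0: "\<And>x. f x \<ge> 0" and x0: "f x0 > 0"
  shows "\<exists>c>0. \<forall>t\<ge>1. \<forall>F M L. gtest (1 / (4 * t)) M F (heat t) \<longrightarrow> (\<forall>k x. 0 \<le> F k x) \<longrightarrow>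
     (\<lambda>k. \<integral>x. F k x * f x \<partial>lborel) \<longlonglongrightarrow> L \<longrightarrow> c * t powr (- (real CARD('n) / 2)) \<le> L"
proof -
  have "isCont f x0" using cf by (simp add: continuous_on_eq_continuous_at)
  then obtain r where r: "r > 0" "\<And>x. dist x x0 < r \<Longrightarrow> dist (f x) (f x0) < f x0 / 2"
    using x0 unfolding continuous_at_eps_delta by (meson half_gt_zero)
  define B where "B = ball x0 r"
  have fB: "f x \<ge> f x0 / 2" if "x \<in> B" for x
  proof -
    have "dist (f x) (f x0) < f x0 / 2" using that by (intro r(2)) (simp add: B_def dist_commute)
    then show ?thesis unfolding dist_real_def by linarith
  qed
  define R where "R = norm x0 + r"
  have RB: "norm x \<le> R" if "x \<in> B" for x using that norm_triangle_ineq2[of x x0] by (auto simp: B_def R_def dist_norm norm_minus_commute)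
  have mB: "measure lborel B > 0" unfolding B_def by (rule content_ball_pos[OF r(1)])
  have eB: "emeasure lborel B < \<infinity>" unfolding B_def by (rule emeasure_bounded_finite) simp
  have Bm [measurable]: "B \<in> sets borel" by (simp add: B_def)
  \<comment> \<open>On the ball \<open>norm x \<le> R\<close>, and \<open>t \<ge> 1\<close>, so the
    exponential factor of the heat kernel is at least \<open>exp (- R^2 / 4)\<close>.\<close>
  define c where "c = f x0 / 2 * (exp (- R\<^sup>2 / 4) * measure lborel B)"
  have c: "c > 0" unfolding c_def using x0 mB by simp
  show ?thesis
  proof (intro exI[of _ c] conjI allI impI c)
    fix t F M L
    assume t: "(1::real) \<le> t" and g: "gtest (1 / (4 * t)) M F (heat t :: real^'n \<Rightarrow> real)" and Fp: "\<forall>k x. 0 \<le> F k x"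
      and L: "(\<lambda>k. \<integral>x. F k x * f x \<partial>lborel) \<longlonglongrightarrow> L"
    let ?l = "1 / (4 * t)"
    have l: "?l > 0" using t by simp
    have cF: "continuous_on UNIV (F k)" for k using gtest_continuous[OF g] by blast
    have Fm [measurable]: "F k \<in> borel_measurable borel" for k by (rule borel_measurable_continuous_onI[OF cF])
    obtain A where A: "A \<ge> 0" "\<And>x k. \<bar>F k x\<bar> \<le> A * exp (- (?l / 2) * (norm x)\<^sup>2)" using gtest_bound[OF g l] by blast
    have iA: "integrable lborel (\<lambda>x::real^'n. A * exp (- (?l / 2) * (norm x)\<^sup>2))"
      using integrable_gaussian[of "?l / 2", where 'n='n] l by (intro integrable_mult_right) auto
    have lim: "(\<lambda>k. \<integral>x. indicator B x * F k x \<partial>lborel) \<longlonglongrightarrow> (\<integral>x. indicator B x * heat t x \<partial>lborel)"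
    proof (rule integral_dominated_convergence[OF _ _ iA])
      show "AE x in lborel. (\<lambda>k. indicator B x * F k x) \<longlonglongrightarrow> indicator B x * heat t x"
        by (intro AE_I2 tendsto_intros gtest_tendsto[OF g l])
      show "AE x in lborel. norm (indicator B x * F k x) \<le> A * exp (- (?l / 2) * (norm x)\<^sup>2)" for k
        using A by (intro AE_I2) (auto simp: indicator_def)
    qed measurable
    have le: "f x0 / 2 * (\<integral>x. indicator B x * F k x \<partial>lborel) \<le> (\<integral>x. F k x * f x \<partial>lborel)" for k
    proof -
      have i1: "integrable lborel (\<lambda>x. F k x * f x)"
        by (rule integrable_compact_support[where R = "real k"]) (auto intro!: continuous_intros cF cf simp: gtest_support[OF g l])
      have i2: "integrable lborel (\<lambda>x. indicator B x * F k x)"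
        by (rule Bochner_Integration.integrable_bound[OF iA]) (use A in \<open>auto simp: indicator_def intro!: AE_I2 order_trans[OF A(2)]\<close>)
      have "(\<integral>x. f x0 / 2 * (indicator B x * F k x) \<partial>lborel) \<le> (\<integral>x. F k x * f x \<partial>lborel)"
      proof (rule integral_mono[OF integrable_mult_right[OF i2] i1])
        fix x
        show "f x0 / 2 * (indicator B x * F k x) \<le> F k x * f x"
        proof (cases "x \<in> B")
          case True
          have "F k x * (f x0 / 2) \<le> F k x * f x" using fB[OF True] Fp by (intro mult_left_mono) auto
          then show ?thesis using True by (simp add: mult.commute)
        next
          case False
          then show ?thesis using Fp f0 by simp
        qed
      qed
      then show ?thesis by simp
    qed
    have "f x0 / 2 * (\<integral>x. indicator B x * heat t x \<partial>lborel) \<le> L"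
      by (rule LIMSEQ_le[OF tendsto_mult_left[OF lim] L]) (use le in auto)
    moreover have "(t powr (- (real CARD('n) / 2)) * exp (- R\<^sup>2 / 4)) * measure lborel B \<le> (\<integral>x. indicator B x * heat t x \<partial>lborel)"
    proof -
      have "(\<integral>x. (t powr (- (real CARD('n) / 2)) * exp (- R\<^sup>2 / 4)) * indicator B x \<partial>lborel) \<le> (\<integral>x. indicator B x * heat t x \<partial>lborel)"
      proof (rule integral_mono)
        show "integrable lborel (\<lambda>x. (t powr (- (real CARD('n) / 2)) * exp (- R\<^sup>2 / 4)) * indicator B x)"
          using eB by (intro integrable_mult_right) (auto simp: integrable_indicator_iff)
        show "integrable lborel (\<lambda>x. indicator B x * heat t x)"
          by (rule Bochner_Integration.integrable_bound[OF integrable_heat[of t]]) (use t in \<open>auto simp: indicator_def\<close>)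
        fix x
        show "t powr (- (real CARD('n) / 2)) * exp (- R\<^sup>2 / 4) * indicator B x \<le> indicator B x * heat t x"
        proof (cases "x \<in> B")
          case True
          have "(norm x)\<^sup>2 \<le> R\<^sup>2" using RB[OF True] by (intro power_mono) auto
          then have "(norm x)\<^sup>2 / (4 * t) \<le> R\<^sup>2 / 4" using t by (intro frac_le) auto
          then have "exp (- R\<^sup>2 / 4) \<le> exp (- (norm x)\<^sup>2 / (4 * t))" by simp
          then have "t powr (- (real CARD('n) / 2)) * exp (- R\<^sup>2 / 4) \<le> heat t x"
            unfolding heat_def by (rule mult_left_mono) simp
          then show ?thesis using True by simp
        qed simp
      qed
      then show ?thesis by simp
    qed
    ultimately have "f x0 / 2 * ((t powr (- (real CARD('n) / 2)) * exp (- R\<^sup>2 / 4)) * measure lborel B) \<le> L"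
      using x0 by (smt (verit, best) mult_left_mono half_gt_zero)
    then show "c * t powr (- (real CARD('n) / 2)) \<le> L" by (simp add: c_def mult_ac)
  qed
qed

text \<open>Dominated convergence twice, first in \<open>y\<close> under \<open>maj\<close> and then
  in \<open>x\<close> under the weight of \<open>u\<close>; both rest on a \<open>gauss_bd\<close>
  common to all \<open>k\<close>.\<close>

lemma frac_form_tendsto:
  fixes G :: "real^'n::finite \<Rightarrow> real"
  assumes g: "gtest l 2 F G" and l: "l > 0" and \<alpha>: "0 < \<alpha>" "\<alpha> < 2"
    and um [measurable]: "u \<in> borel_measurable borel" and W: "integrable lborel (weighted (real CARD('n) + \<alpha>) u)"
  shows "(\<lambda>k. \<integral>x. u x * frac_form \<alpha> (F k) x \<partial>lborel) \<longlonglongrightarrow> (\<integral>x. u x * frac_form \<alpha> G x \<partial>lborel)"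
proof -
  let ?b = "real CARD('n) + \<alpha>"
  obtain A where A: "\<And>k. gauss_bd (l / 4) A (F k)" "gauss_bd (l / 4) A G" using gtest_gauss_bd[OF g l] by blast
  have A0: "A \<ge> 0" using A(2) by (simp add: gauss_bd_def)
  have l4: "l / 4 > 0" using l by simp
  have [measurable]: "F k \<in> borel_measurable borel" "G \<in> borel_measurable borel" for k
    using A(1)[of k] A(2) by (auto simp: gauss_bd_def)
  obtain C where C: "C > 0" "\<And>x::real^'n. (\<integral>y. maj \<alpha> (l / 4) x y \<partial>lborel) \<le> C * (1 + norm x) powr (- ?b)"
    using integral_maj_le[OF \<alpha> l4, where 'n='n] by blast
  have pt: "(\<lambda>k. frac_form \<alpha> (F k) x) \<longlonglongrightarrow> frac_form \<alpha> G x" for x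
    unfolding frac_form_def
  proof (rule integral_dominated_convergence[where w = "\<lambda>y. A * maj \<alpha> (l / 4) x y"])
    show "integrable lborel (\<lambda>y. A * maj \<alpha> (l / 4) x y)" using integrable_maj[OF \<alpha> l4, of x] by simp
    show "AE y in lborel. (\<lambda>k. sdiff (F k) x y * riesz_ker \<alpha> y) \<longlonglongrightarrow> sdiff G x y * riesz_ker \<alpha> y"
      unfolding sdiff_def by (intro AE_I2 tendsto_intros gtest_tendsto[OF g l])
    show "AE y in lborel. norm (sdiff (F k) x y * riesz_ker \<alpha> y) \<le> A * maj \<alpha> (l / 4) x y" for k
      using gauss_bd_sdiff_le[OF A(1) \<alpha>(1)] by (intro AE_I2) simp
  qed measurable
  show ?thesis
  proof (rule integral_dominated_convergence[where w = "\<lambda>x. A * C * weighted ?b u x"])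
    show "integrable lborel (\<lambda>x. A * C * weighted ?b u x)" using W by (rule integrable_mult_right)
    show "AE x in lborel. (\<lambda>k. u x * frac_form \<alpha> (F k) x) \<longlonglongrightarrow> u x * frac_form \<alpha> G x"
      by (intro AE_I2 tendsto_intros pt)
    show "AE x in lborel. norm (u x * frac_form \<alpha> (F k) x) \<le> A * C * weighted ?b u x" for k
    proof (rule AE_I2)
      fix x
      have "\<bar>frac_form \<alpha> (F k) x\<bar> \<le> A * (\<integral>y. maj \<alpha> (l / 4) x y \<partial>lborel)" by (rule gauss_bd_frac_form(3)[OF A(1) \<alpha> l4])
      also have "\<dots> \<le> A * (C * (1 + norm x) powr (- ?b))" using A0 C(2) by (intro mult_left_mono) auto
      finally have "\<bar>u x\<bar> * \<bar>frac_form \<alpha> (F k) x\<bar> \<le> \<bar>u x\<bar> * (A * (C * (1 + norm x) powr (- ?b)))" by (rule mult_left_mono) simp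
      then show "norm (u x * frac_form \<alpha> (F k) x) \<le> A * C * weighted ?b u x" by (simp add: abs_mult mult_ac)
    qed
  qed measurable
qed

subsection \<open>Subordination\<close>

lemma heat_gauss_bd:
  assumes t: "t > 0"
  shows "\<exists>l>0. \<exists>A. gauss_bd l A (heat t :: real^'n::finite \<Rightarrow> real)"
proof -
  obtain l A where l: "l > 0" "\<And>s. \<bar>s - t\<bar> < t / 2 \<Longrightarrow> gauss_bd l A (heatD 0 s :: real^'n \<Rightarrow> real)"
    using heatD_gauss_bd_uniform[OF t, of 0, where 'n='n] by blast
  have "gauss_bd l A (heatD 0 t :: real^'n \<Rightarrow> real)" using t by (intro l(2)) simp
  with l(1) show ?thesis unfolding heatD_0 by blast
qed

text \<open>After inserting the mixture for the kernel and exchanging integrals, the inner integral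
  of \<open>sdiff (heat t) x y * heat s y\<close> is
  \<open>2 * \<mu> * (heat t x - heat (t + s) x)\<close>, by the total mass and the semigroup law.
  The absolute bound in the last claim prepares the next exchange, with the integral over
  \<open>x\<close>.\<close>

lemma frac_form_heat_subordination:
  fixes x :: "real^'n::finite"
  assumes \<alpha>: "0 < \<alpha>" "\<alpha> < 2" and t: "t > 0"
  defines "c \<equiv> subord_const (\<alpha> / 2 + real CARD('n) / 2)"
  defines "\<mu> \<equiv> heat_mass TYPE('n)"
  shows "c * frac_form \<alpha> (heat t) x =
      2 * \<mu> * (\<integral>s. indicator {0<..} s * (s powr (- 1 - \<alpha> / 2) * (heat t x - heat (t + s) x)) \<partial>lborel)"
    and "integrable lborel (\<lambda>s. indicator {0<..} s * (s powr (- 1 - \<alpha> / 2) * (heat t x - heat (t + s) x)))"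
    and "2 * \<mu> * (\<integral>s. \<bar>indicator {0<..} s * (s powr (- 1 - \<alpha> / 2) * (heat t x - heat (t + s) x))\<bar> \<partial>lborel)
      \<le> c * (\<integral>y. \<bar>sdiff (heat t) x y * riesz_ker \<alpha> y\<bar> \<partial>lborel)"
proof -
  let ?w = "\<lambda>s. indicator {0<..} s * (s powr (- 1 - \<alpha> / 2) * (heat t x - heat (t + s) x))"
  define f where "f y s = sdiff (heat t) x y * (indicator {0<..} s * (s powr (- 1 - \<alpha> / 2) * heat s y))" for y s
  obtain l A where l: "l > 0" and A: "gauss_bd l A (heat t :: real^'n \<Rightarrow> real)"
    using heat_gauss_bd[OF t, where 'n='n] by blast
  have i0: "integrable lborel (\<lambda>y. sdiff (heat t) x y * riesz_ker \<alpha> y)" by (rule gauss_bd_frac_form(1)[OF A \<alpha> l])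
  have c: "c > 0" unfolding c_def using \<alpha> by (intro subord_const_pos) (simp add: add_pos_nonneg)
  have fs: "integrable lborel (f y)" "(\<integral>s. f y s \<partial>lborel) = c * (sdiff (heat t) x y * riesz_ker \<alpha> y)"
    "(\<integral>s. \<bar>f y s\<bar> \<partial>lborel) = c * \<bar>sdiff (heat t) x y * riesz_ker \<alpha> y\<bar>" for y
  proof -
    show "integrable lborel (f y)"
      unfolding f_def[abs_def] by (cases "y = 0") (auto simp: sdiff_def intro!: integrable_mult_right heat_subordination(2)[OF \<alpha>(1)])
    show "(\<integral>s. f y s \<partial>lborel) = c * (sdiff (heat t) x y * riesz_ker \<alpha> y)"
    proof (cases "y = 0")
      case False
      show ?thesis unfolding f_def c_def by (subst integral_mult_right_zero, subst heat_subordination(1)[OF \<alpha>(1) False]) (simp only: mult_ac)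
    qed (simp add: f_def sdiff_def)
    show "(\<integral>s. \<bar>f y s\<bar> \<partial>lborel) = c * \<bar>sdiff (heat t) x y * riesz_ker \<alpha> y\<bar>"
    proof (cases "y = 0")
      case False
      have "\<bar>f y s\<bar> = \<bar>sdiff (heat t) x y\<bar> * (indicator {0<..} s * (s powr (- 1 - \<alpha> / 2) * heat s y))" for s
        unfolding f_def by (simp add: abs_mult)
      then have "(\<integral>s. \<bar>f y s\<bar> \<partial>lborel) = \<bar>sdiff (heat t) x y\<bar> * (c * riesz_ker \<alpha> y)"
        unfolding c_def by (simp only: integral_mult_right_zero heat_subordination(1)[OF \<alpha>(1) False])
      then show ?thesis by (simp add: abs_mult)
    qed (simp add: f_def sdiff_def)
  qed
  have fm: "(\<lambda>(y, s). f y s) \<in> borel_measurable (lborel \<Otimes>\<^sub>M lborel)"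
    unfolding f_def by measurable
  have gi: "integrable lborel (\<lambda>y. c * \<bar>sdiff (heat t) x y * riesz_ker \<alpha> y\<bar>)"
    using i0 by (intro integrable_mult_right integrable_abs)
  note F = lborel_Fubini_dominated[OF fm fs(1) _ gi]
  have fx: "(\<integral>y. f y s \<partial>lborel) = 2 * \<mu> * ?w s" for s
  proof (cases "s > 0")
    case True
    have m: "(\<lambda>y. heat t (x + y) * heat s y) \<in> borel_measurable borel" by measurable
    have e: "heat t (x + (0 - y)) * heat s (0 - y) = heat t (x - y) * heat s y" for y :: "real^'n" by (simp add: heat_def)
    have i1: "integrable lborel (\<lambda>y::real^'n. heat t (x + y) * heat s y)" and I1: "(\<integral>y. heat t (x + y) * heat s y \<partial>lborel) = \<mu> * heat (t + s) x"
      unfolding \<mu>_def by (rule heat_conv[OF t True])+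
    have i2: "integrable lborel (\<lambda>y::real^'n. heat t (x - y) * heat s y)" and I2: "(\<integral>y. heat t (x - y) * heat s y \<partial>lborel) = \<mu> * heat (t + s) x"
      using i1 I1 integrable_lborel_sub[OF m, of 0, unfolded e] integral_lborel_sub[OF m, of 0, unfolded e] by auto
    have i3: "integrable lborel (\<lambda>y::real^'n. 2 * heat t x * heat s y)"
      using integrable_heat[OF True, where 'n='n] by (rule integrable_mult_right)
    have "(\<integral>y. sdiff (heat t) x y * heat s y \<partial>lborel) = (\<integral>y. 2 * heat t x * heat s y - heat t (x + y) * heat s y - heat t (x - y) * heat s y \<partial>lborel)"
      by (simp add: sdiff_def algebra_simps)
    also have "\<dots> = 2 * heat t x * \<mu> - \<mu> * heat (t + s) x - \<mu> * heat (t + s) x"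
      using i1 i2 i3 I1 I2 integral_heat[OF True, where 'n='n] by (simp add: \<mu>_def)
    finally have "(\<integral>y. sdiff (heat t) x y * heat s y \<partial>lborel) = 2 * \<mu> * (heat t x - heat (t + s) x)" by (simp add: algebra_simps)
    moreover have "(\<integral>y. f y s \<partial>lborel) = s powr (- 1 - \<alpha> / 2) * (\<integral>y. sdiff (heat t) x y * heat s y \<partial>lborel)"
    proof -
      have "f y s = s powr (- 1 - \<alpha> / 2) * (sdiff (heat t) x y * heat s y)" for y using True by (simp add: f_def)
      then show ?thesis by simp
    qed
    ultimately show ?thesis using True by simp
  qed (simp add: f_def)
  have \<mu>: "\<mu> > 0" unfolding \<mu>_def by (rule heat_mass_pos)
  have F1: "(\<integral>y. (\<integral>s. f y s \<partial>lborel) \<partial>lborel) = (\<integral>s. (\<integral>y. f y s \<partial>lborel) \<partial>lborel)"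
    and F4: "integrable lborel (\<lambda>s. \<integral>y. f y s \<partial>lborel)" using F(1,4) fs(3) by auto
  have "(\<integral>y. (\<integral>s. f y s \<partial>lborel) \<partial>lborel) = c * frac_form \<alpha> (heat t) x"
    unfolding fs(2) frac_form_def by simp
  then show "c * frac_form \<alpha> (heat t) x = 2 * \<mu> * (\<integral>s. ?w s \<partial>lborel)"
    unfolding F1 fx by simp
  show iw: "integrable lborel ?w" using F4 \<mu> unfolding fx by (simp add: integrable_mult_right_iff)
  have fm': "(\<lambda>(y, s). \<bar>f y s\<bar>) \<in> borel_measurable (lborel \<Otimes>\<^sub>M lborel)"
    using fm by measurable
  have G1: "(\<integral>y. (\<integral>s. \<bar>f y s\<bar> \<partial>lborel) \<partial>lborel) = (\<integral>s. (\<integral>y. \<bar>f y s\<bar> \<partial>lborel) \<partial>lborel)"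
    and G4: "integrable lborel (\<lambda>s. \<integral>y. \<bar>f y s\<bar> \<partial>lborel)"
    using lborel_Fubini_dominated[OF fm' integrable_abs[OF fs(1)] _ gi] fs(3) by auto
  have "2 * \<mu> * (\<integral>s. \<bar>?w s\<bar> \<partial>lborel) = (\<integral>s. \<bar>\<integral>y. f y s \<partial>lborel\<bar> \<partial>lborel)"
    unfolding fx using \<mu> by (simp add: abs_mult[of "2 * \<mu>"])
  also have "\<dots> \<le> (\<integral>s. (\<integral>y. \<bar>f y s\<bar> \<partial>lborel) \<partial>lborel)"
    by (rule integral_mono[OF integrable_abs[OF F4] G4]) (rule integral_abs_bound)
  also have "\<dots> = c * (\<integral>y. \<bar>sdiff (heat t) x y * riesz_ker \<alpha> y\<bar> \<partial>lborel)"
    unfolding G1[symmetric] fs(3) by simp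
  finally show "2 * \<mu> * (\<integral>s. \<bar>?w s\<bar> \<partial>lborel) \<le> c * (\<integral>y. \<bar>sdiff (heat t) x y * riesz_ker \<alpha> y\<bar> \<partial>lborel)" .
qed

text \<open>The spatial operator of order \<open>\<alpha>\<close> becomes an operator of order
  \<open>\<alpha> / 2\<close> in time: up to a factor, the right-hand side is the Marchaud
  derivative of \<open>U\<close> looking towards larger times.\<close>

lemma heat_average_subordination:
  fixes u :: "real^'n::finite \<Rightarrow> real"
  assumes \<alpha>: "0 < \<alpha>" "\<alpha> < 2" and um [measurable]: "u \<in> borel_measurable borel"
    and W: "integrable lborel (weighted (real CARD('n) + \<alpha>) u)" and t: "t > 0"
  defines "c \<equiv> subord_const (\<alpha> / 2 + real CARD('n) / 2)"
  defines "\<mu> \<equiv> heat_mass TYPE('n)"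
  defines "U \<equiv> (\<lambda>t. \<integral>x. u x * heat t x \<partial>lborel)"
  shows "c * (\<integral>x. u x * frac_form \<alpha> (heat t) x \<partial>lborel) =
      2 * \<mu> * (\<integral>s. indicator {0<..} s * (s powr (- 1 - \<alpha> / 2) * (U t - U (t + s))) \<partial>lborel)"
    and "integrable lborel (\<lambda>s. indicator {0<..} s * (s powr (- 1 - \<alpha> / 2) * (U t - U (t + s))))"
    and "integrable lborel (\<lambda>x. u x * heat t x)"
proof -
  let ?b = "real CARD('n) + \<alpha>"
  have iu: "integrable lborel (\<lambda>x. u x * heat t x)" if t: "t > 0" for t
  proof -
    obtain l A where l: "l > 0" and A: "gauss_bd l A (heat t :: real^'n \<Rightarrow> real)"
      using heat_gauss_bd[OF t, where 'n='n] by blast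
    obtain C where C: "C > 0" "\<And>x::real^'n. exp (- l * (norm x)\<^sup>2) \<le> C * (1 + norm x) powr (- ?b)"
      using gaussian_le_weight[OF l, where 'n='n] by blast
    show ?thesis
    proof (rule Bochner_Integration.integrable_bound[OF integrable_mult_right[OF W, of "A * C"]])
      show "AE x in lborel. norm (u x * heat t x) \<le> norm (A * C * weighted ?b u x)"
      proof (rule AE_I2)
        fix x :: "real^'n"
        have A0: "A \<ge> 0" using A by (simp add: gauss_bd_def)
        have "\<bar>heat t x\<bar> \<le> A * exp (- l * (norm x)\<^sup>2)" using A unfolding gauss_bd_def by blast
        also have "\<dots> \<le> A * (C * (1 + norm x) powr (- ?b))" using A0 C(2) by (intro mult_left_mono) auto
        finally have "\<bar>u x\<bar> * \<bar>heat t x\<bar> \<le> \<bar>u x\<bar> * (A * (C * (1 + norm x) powr (- ?b)))" by (rule mult_left_mono) simp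
        then show "norm (u x * heat t x) \<le> norm (A * C * weighted ?b u x)" using A0 C(1) by (simp add: abs_mult mult_ac)
      qed
    qed measurable
  qed
  show "integrable lborel (\<lambda>x. u x * heat t x)" using t by (rule iu)
  let ?w = "\<lambda>x s. indicator {0<..} s * (s powr (- 1 - \<alpha> / 2) * (heat t x - heat (t + s) x))"
  note S = frac_form_heat_subordination[OF \<alpha> t, where 'n='n, folded c_def \<mu>_def]
  have \<mu>: "\<mu> > 0" unfolding \<mu>_def by (rule heat_mass_pos)
  have c: "c > 0" unfolding c_def using \<alpha> by (intro subord_const_pos) (simp add: add_pos_nonneg)
  obtain l A where l: "l > 0" and A: "gauss_bd l A (heat t :: real^'n \<Rightarrow> real)"
    using heat_gauss_bd[OF t, where 'n='n] by blast
  have A0: "A \<ge> 0" using A by (simp add: gauss_bd_def)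
  obtain C where C: "C > 0" "\<And>x::real^'n. (\<integral>y. maj \<alpha> l x y \<partial>lborel) \<le> C * (1 + norm x) powr (- ?b)"
    using integral_maj_le[OF \<alpha> l, where 'n='n] by blast
  define f where "f x s = u x * ?w x s" for x s
  have fi: "integrable lborel (f x)" for x unfolding f_def[abs_def] by (intro integrable_mult_right S(2))
  have fm: "(\<lambda>(x, s). f x s) \<in> borel_measurable (lborel \<Otimes>\<^sub>M lborel)"
    unfolding f_def heat_def by measurable
  have fd: "(\<integral>s. \<bar>f x s\<bar> \<partial>lborel) \<le> (c * A * C / (2 * \<mu>)) * weighted ?b u x" for x
  proof -
    have "2 * \<mu> * (\<integral>s. \<bar>?w x s\<bar> \<partial>lborel) \<le> c * (A * (C * (1 + norm x) powr (- ?b)))"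
      using S(3)[of x] gauss_bd_frac_form(2)[OF A \<alpha> l, of x] C(2)[of x] A0 c
      by (smt (verit, best) mult_left_mono)
    then have "(\<integral>s. \<bar>?w x s\<bar> \<partial>lborel) \<le> c * (A * (C * (1 + norm x) powr (- ?b))) / (2 * \<mu>)"
      using \<mu> by (simp add: pos_le_divide_eq mult.commute)
    then have "\<bar>u x\<bar> * (\<integral>s. \<bar>?w x s\<bar> \<partial>lborel) \<le> \<bar>u x\<bar> * (c * (A * (C * (1 + norm x) powr (- ?b))) / (2 * \<mu>))"
      by (rule mult_left_mono) simp
    moreover have "(\<integral>s. \<bar>f x s\<bar> \<partial>lborel) = \<bar>u x\<bar> * (\<integral>s. \<bar>?w x s\<bar> \<partial>lborel)"
      unfolding f_def by (simp only: abs_mult[of "u x"] integral_mult_right_zero)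
    ultimately show ?thesis by (simp add: mult_ac)
  qed
  note F = lborel_Fubini_dominated[OF fm fi fd integrable_mult_right[OF W]]
  have fx: "(\<integral>x. f x s \<partial>lborel) = indicator {0<..} s * (s powr (- 1 - \<alpha> / 2) * (U t - U (t + s)))" for s
  proof (cases "s > 0")
    case True
    have "f x s = s powr (- 1 - \<alpha> / 2) * (u x * heat t x - u x * heat (t + s) x)" for x using True by (simp add: f_def algebra_simps)
    then show ?thesis using True iu[OF t] iu[of "t + s"] t by (simp add: U_def)
  qed (simp add: f_def)
  show "integrable lborel (\<lambda>s. indicator {0<..} s * (s powr (- 1 - \<alpha> / 2) * (U t - U (t + s))))"
    using F(4) unfolding fx .
  have "c * (\<integral>x. u x * frac_form \<alpha> (heat t) x \<partial>lborel) = (\<integral>x. u x * (c * frac_form \<alpha> (heat t) x) \<partial>lborel)"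
    by (subst integral_mult_right_zero[symmetric]) (simp only: mult_ac)
  also have "\<dots> = (\<integral>x. 2 * \<mu> * (\<integral>s. f x s \<partial>lborel) \<partial>lborel)"
  proof -
    have "(\<integral>s. f x s \<partial>lborel) = u x * (\<integral>s. ?w x s \<partial>lborel)" for x
      unfolding f_def by (rule integral_mult_right_zero)
    then have "u x * (c * frac_form \<alpha> (heat t) x) = 2 * \<mu> * (\<integral>s. f x s \<partial>lborel)" for x
      unfolding S(1) by (simp only: mult_ac)
    then show ?thesis by (simp only:)
  qed
  also have "\<dots> = 2 * \<mu> * (\<integral>s. indicator {0<..} s * (s powr (- 1 - \<alpha> / 2) * (U t - U (t + s))) \<partial>lborel)"
    unfolding integral_mult_right_zero F(1) fx ..
  finally show "c * (\<integral>x. u x * frac_form \<alpha> (heat t) x \<partial>lborel) =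
      2 * \<mu> * (\<integral>s. indicator {0<..} s * (s powr (- 1 - \<alpha> / 2) * (U t - U (t + s))) \<partial>lborel)" .
qed

lemma heat_average_continuous:
  fixes u :: "real^'n::finite \<Rightarrow> real"
  assumes um [measurable]: "u \<in> borel_measurable borel"
    and W: "integrable lborel (weighted b u)" and iu: "\<And>t. t > 0 \<Longrightarrow> integrable lborel (\<lambda>x. u x * heat t x)" and t: "t > 0"
  shows "isCont (\<lambda>t. \<integral>x. u x * heat t x \<partial>lborel) t"
proof -
  obtain l A where l: "l > 0" and A: "\<And>s. \<bar>s - t\<bar> < t / 2 \<Longrightarrow> gauss_bd l A (heatD 1 s :: real^'n \<Rightarrow> real)"
    using heatD_gauss_bd_uniform[OF t, of 1, where 'n='n] by blast
  have A0: "A \<ge> 0" using A[of t] t by (simp add: gauss_bd_def)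
  obtain C where C: "C > 0" "\<And>x::real^'n. exp (- l * (norm x)\<^sup>2) \<le> C * (1 + norm x) powr (- b)"
    using gaussian_le_weight[OF l, where 'n='n] by blast
  have "((\<lambda>t. \<integral>x. u x * heat t x \<partial>lborel) has_real_derivative (\<integral>x. u x * (- heatD (Suc 0) t x) \<partial>lborel)) (at t)"
  proof (rule has_real_derivative_integral_dominated[where d = "t / 2" and F' = "\<lambda>t x. u x * (- heatD (Suc 0) t x)" and g = "\<lambda>x. A * C * weighted b u x"])
    fix s assume s: "\<bar>s - t\<bar> < t / 2"
    then have sp: "s > 0" using t unfolding abs_less_iff by linarith
    show "integrable lborel (\<lambda>x. u x * heat s x)" by (rule iu[OF sp])
    fix x
    show "((\<lambda>t. u x * heat t x) has_real_derivative u x * (- heatD (Suc 0) s x)) (at s)"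
      using heatD_DERIV_time[OF sp, of 0 x] unfolding heatD_0 by (rule DERIV_cmult)
    have "\<bar>heatD (Suc 0) s x\<bar> \<le> A * exp (- l * (norm x)\<^sup>2)" using A[OF s] unfolding gauss_bd_def One_nat_def by blast
    also have "\<dots> \<le> A * (C * (1 + norm x) powr (- b))" using A0 C(2) by (intro mult_left_mono) auto
    finally have "\<bar>u x\<bar> * \<bar>heatD (Suc 0) s x\<bar> \<le> \<bar>u x\<bar> * (A * (C * (1 + norm x) powr (- b)))" by (rule mult_left_mono) simp
    then show "\<bar>u x * (- heatD (Suc 0) s x)\<bar> \<le> A * C * weighted b u x" by (simp add: abs_mult mult_ac)
  qed (use t W in auto)
  then show ?thesis by (rule DERIV_isCont)
qed

subsection \<open>A one-sided fractional maximum principle\<close>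

lemma integrable_log_powr:
  fixes a :: real
  assumes a: "0 < a" "a < 1"
  shows "integrable lborel (\<lambda>s. indicator {0<..} s * (s powr (- 1 - a) * ln (1 + s)))"
proof (rule Bochner_Integration.integrable_bound)
  show "integrable lborel (\<lambda>s. indicator {0<..1} s * s powr (- a) + (2 powr (a / 2) / (a / 2)) * (indicator {1<..} s * s powr (- 1 - a / 2)))"
    using a by (intro Bochner_Integration.integrable_add integrable_mult_right integrable_powr_head integrable_powr_tail) auto
  show "AE s in lborel. norm (indicator {0<..} s * (s powr (- 1 - a) * ln (1 + s)))
      \<le> norm (indicator {0<..1} s * s powr (- a) + (2 powr (a / 2) / (a / 2)) * (indicator {1<..} s * s powr (- 1 - a / 2)))"
  proof (rule AE_I2)
    fix s :: real
    consider "s \<le> 0" | "0 < s" "s \<le> 1" | "s > 1" by linarith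
    then show "norm (indicator {0<..} s * (s powr (- 1 - a) * ln (1 + s)))
      \<le> norm (indicator {0<..1} s * s powr (- a) + (2 powr (a / 2) / (a / 2)) * (indicator {1<..} s * s powr (- 1 - a / 2)))"
    proof cases
      case 2
      have "s powr (- 1 - a) * ln (1 + s) \<le> s powr (- 1 - a) * s" using 2 ln_add_one_self_le_self[of s] by (intro mult_left_mono) auto
      also have "\<dots> = s powr (- a)" using 2 by (simp add: powr_diff powr_minus field_simps)
      finally show ?thesis using 2 by simp
    next
      case 3
      \<comment> \<open>Half of the decay exponent \<open>a\<close> pays for the logarithm.\<close>
      have "ln (1 + s) \<le> (1 + s) powr (a / 2) / (a / 2)" using 3 a by (intro ln_powr_bound) auto
      also have "\<dots> \<le> (2 * s) powr (a / 2) / (a / 2)" using 3 a by (intro divide_right_mono powr_mono2) auto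
      also have "\<dots> = 2 powr (a / 2) / (a / 2) * s powr (a / 2)" using 3 by (simp add: powr_mult)
      finally have "s powr (- 1 - a) * ln (1 + s) \<le> s powr (- 1 - a) * (2 powr (a / 2) / (a / 2) * s powr (a / 2))" by (rule mult_left_mono) simp
      also have "\<dots> = 2 powr (a / 2) / (a / 2) * (s powr (- 1 - a) * s powr (a / 2))" by simp
      also have "s powr (- 1 - a) * s powr (a / 2) = s powr (- 1 - a / 2)" unfolding powr_add[symmetric] by (rule arg_cong[where f = "\<lambda>e. s powr e"]) (simp add: field_simps)
      finally show ?thesis using 3 a by simp
    qed simp
  qed
qed measurable

text \<open>Comparison with \<open>ln (R / t)\<close>: its one-sided fractional derivative of order \<open>a\<close> is a multiple of
  \<open>t powr (- a)\<close>, and cutting it off at \<open>t = R\<close> only decreases that derivative.\<close>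

lemma one_sided_maximum_principle:
  fixes U :: "real \<Rightarrow> real"
  assumes a: "1 / 2 \<le> a" "a < 1" and cont: "\<And>t. t > 0 \<Longrightarrow> isCont U t" and U0: "\<And>t. U t \<ge> 0"
    and int: "\<And>t. t \<ge> 1 \<Longrightarrow> integrable lborel (\<lambda>s. indicator {0<..} s * (s powr (- 1 - a) * (U t - U (t + s))))"
    and low: "\<And>t. t \<ge> 1 \<Longrightarrow> \<kappa> * t powr (- (1 / 2)) \<le> (\<integral>s. indicator {0<..} s * (s powr (- 1 - a) * (U t - U (t + s))) \<partial>lborel)"
    and \<kappa>: "\<kappa> > 0"
  shows False
proof -
  define L where "L s = indicator {0<..} s * (s powr (- 1 - a) * ln (1 + s))" for s :: real
  define ca where "ca = (\<integral>s. L s \<partial>lborel)"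
  have iL: "integrable lborel L" unfolding L_def[abs_def] using a by (intro integrable_log_powr) auto
  have ca: "ca \<ge> 0" unfolding ca_def by (intro integral_nonneg_AE AE_I2) (auto simp: L_def indicator_def)
  \<comment> \<open>The comparison needs \<open>\<delta> * ca < \<kappa>\<close>; the added 1 makes
    this strict and avoids a division by zero.\<close>
  define \<delta> where "\<delta> = \<kappa> / (ca + 1)"
  have \<delta>: "\<delta> > 0" "\<delta> * ca < \<kappa>" using \<kappa> ca by (auto simp: \<delta>_def field_simps)
  have Llt: "integrable lborel (\<lambda>s. indicator {0<..} s * (s powr (- 1 - a) * ln (1 + s / t)))"
    "(\<integral>s. indicator {0<..} s * (s powr (- 1 - a) * ln (1 + s / t)) \<partial>lborel) = t powr (- a) * ca" if t: "t \<ge> 1" for t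
  proof -
    have eq: "indicator {0<..} s * (s powr (- 1 - a) * ln (1 + s / t)) = (t powr (- a) * (1 / t)) * L (0 + (1 / t) * s)" for s
    proof (cases "s > 0")
      case True
      have "(s / t) powr (- 1 - a) = s powr (- 1 - a) / t powr (- 1 - a)" using True t by (simp add: powr_divide)
      moreover have "t powr (- 1 - a) = t powr (- a) * (1 / t)" using t by (simp add: powr_diff powr_minus field_simps)
      ultimately show ?thesis using True t by (simp add: L_def)
    next
      case False
      then show ?thesis using t by (simp add: L_def zero_less_mult_iff divide_simps)
    qed
    have "integrable lborel (\<lambda>s. L (0 + (1 / t) * s))" using t by (intro lborel_integrable_real_affine iL) auto
    then show "integrable lborel (\<lambda>s. indicator {0<..} s * (s powr (- 1 - a) * ln (1 + s / t)))"
      unfolding eq by (rule integrable_mult_right)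
    have "ca = \<bar>1 / t\<bar> *\<^sub>R (\<integral>s. L (0 + (1 / t) * s) \<partial>lborel)"
      unfolding ca_def using t by (intro lborel_integral_real_affine) auto
    then show "(\<integral>s. indicator {0<..} s * (s powr (- 1 - a) * ln (1 + s / t)) \<partial>lborel) = t powr (- a) * ca"
      unfolding eq using t by (subst integral_mult_right_zero) simp
  qed
  have bound: "\<delta> * ln R \<le> U 1" if R: "R > 1" for R
  proof (rule ccontr)
    assume neg: "\<not> \<delta> * ln R \<le> U 1"
    define h where "h t = U t - \<delta> * ln (R / t)" for t
    have "continuous_on {1..R} h" unfolding h_def
    proof (intro continuous_intros)
      show "continuous_on {1..R} U" using cont by (intro continuous_at_imp_continuous_on) auto
    qed (use R in auto)
    then obtain t0 where t0: "t0 \<in> {1..R}" and min: "\<And>t. t \<in> {1..R} \<Longrightarrow> h t0 \<le> h t"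
      using continuous_attains_inf[of "{1..R}" h] R by auto
    have "h t0 \<le> h 1" using R by (intro min) auto
    then have h0: "h t0 < 0" using neg by (simp add: h_def)
    \<comment> \<open>Up to \<open>R\<close> this is minimality of \<open>h\<close> at
      \<open>t0\<close>. Beyond \<open>R\<close>, \<open>h t0 < 0\<close> puts \<open>U t0\<close>
      below \<open>\<delta> * ln (R / t0)\<close>, while \<open>U (t0 + s)\<close> is nonnegative
      and \<open>ln (R / (t0 + s))\<close> is not positive.\<close>
    have le: "U t0 - U (t0 + s) \<le> \<delta> * ln (1 + s / t0)" if s: "s > 0" for s
    proof -
      have eq: "ln (1 + s / t0) = ln (R / t0) - ln (R / (t0 + s))"
      proof -
        have "1 + s / t0 = (R / t0) / (R / (t0 + s))" using t0 s R by (simp add: field_simps)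
        then show ?thesis using t0 s R by (simp only: ln_div) (simp add: ln_div)
      qed
      show ?thesis
      proof (cases "t0 + s \<le> R")
        case True
        then have "h t0 \<le> h (t0 + s)" using t0 s by (intro min) auto
        then show ?thesis unfolding eq by (simp add: h_def algebra_simps)
      next
        case False
        have "ln (R / (t0 + s)) \<le> 0" using False t0 R s by simp
        then have "\<delta> * ln (R / (t0 + s)) \<le> 0" using \<delta>(1) by (simp add: mult_nonneg_nonpos)
        then show ?thesis using h0 U0[of "t0 + s"] unfolding eq by (simp add: h_def algebra_simps)
      qed
    qed
    have t1: "t0 \<ge> 1" using t0 by simp
    have "\<kappa> * t0 powr (- (1 / 2)) \<le> (\<integral>s. indicator {0<..} s * (s powr (- 1 - a) * (U t0 - U (t0 + s))) \<partial>lborel)" by (rule low[OF t1])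
    also have "\<dots> \<le> (\<integral>s. \<delta> * (indicator {0<..} s * (s powr (- 1 - a) * ln (1 + s / t0))) \<partial>lborel)"
    proof (rule integral_mono[OF int[OF t1] integrable_mult_right[OF Llt(1)[OF t1]]])
      fix s :: real
      show "indicator {0<..} s * (s powr (- 1 - a) * (U t0 - U (t0 + s))) \<le> \<delta> * (indicator {0<..} s * (s powr (- 1 - a) * ln (1 + s / t0)))"
      proof (cases "s > 0")
        case True
        have "s powr (- 1 - a) * (U t0 - U (t0 + s)) \<le> s powr (- 1 - a) * (\<delta> * ln (1 + s / t0))"
          by (intro mult_left_mono le True) simp
        then show ?thesis using True by (simp add: mult_ac)
      qed simp
    qed
    also have "\<dots> = (\<delta> * ca) * t0 powr (- a)" using Llt(2)[OF t1] by simp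
    \<comment> \<open>The place where \<open>a \<ge> 1/2\<close> and \<open>t0 \<ge> 1\<close>
      enter.\<close>
    also have "\<dots> \<le> (\<delta> * ca) * t0 powr (- (1 / 2))"
      using \<delta>(1) ca a t1 by (intro mult_left_mono powr_mono) auto
    finally have "\<kappa> * t0 powr (- (1 / 2)) \<le> (\<delta> * ca) * t0 powr (- (1 / 2))" .
    moreover have "t0 powr (- (1 / 2)) > 0" using t1 by simp
    ultimately have "\<kappa> \<le> \<delta> * ca" by (simp only: mult_le_cancel_right_pos)
    then show False using \<delta>(2) by simp
  qed
  \<comment> \<open>Chosen so that \<open>\<delta> * ln R\<close> equals
    \<open>U 1 + 1\<close>.\<close>
  define R where "R = exp ((U 1 + 1) / \<delta>)"
  have "R > 1" unfolding R_def using U0[of 1] \<delta>(1) by simp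
  from bound[OF this] show False using \<delta>(1) by (simp add: R_def)
qed

subsection \<open>The Liouville theorem\<close>

lemma L_space_weighted:
  fixes u :: "real^'n::finite \<Rightarrow> real"
  assumes u: "u \<in> L_space \<alpha>" and um [measurable]: "u \<in> borel_measurable borel" and \<alpha>: "\<alpha> > 0"
  shows "integrable lborel (weighted (real CARD('n) + \<alpha>) u)"
proof -
  let ?b = "real CARD('n) + \<alpha>"
  have i: "integrable lborel (\<lambda>x. \<bar>u x\<bar> / (1 + norm x powr ?b))" using u by (simp add: L_space_def)
  show ?thesis
  proof (rule Bochner_Integration.integrable_bound[OF integrable_mult_right[OF i, of 2]])
    show "AE x in lborel. norm (weighted ?b u x) \<le> norm (2 * (\<bar>u x\<bar> / (1 + norm x powr ?b)))"
    proof (rule AE_I2)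
      fix x :: "real^'n"
      have p: "(1 + norm x) powr ?b > 0" by (smt (verit) norm_ge_zero powr_gt_zero)
      have q: "1 + norm x powr ?b > 0" by (simp add: add_pos_nonneg)
      have "norm x powr ?b \<le> (1 + norm x) powr ?b" using \<alpha> by (intro powr_mono2) auto
      moreover have "1 \<le> (1 + norm x) powr ?b" using \<alpha> by (intro ge_one_powr_ge_zero) auto
      ultimately have "1 + norm x powr ?b \<le> 2 * (1 + norm x) powr ?b" by simp
      then have "1 / (1 + norm x) powr ?b \<le> 2 / (1 + norm x powr ?b)" using p q by (simp add: field_simps)
      then have "(1 + norm x) powr (- ?b) \<le> 2 / (1 + norm x powr ?b)" by (simp only: powr_minus_divide)
      then have "\<bar>u x\<bar> * (1 + norm x) powr (- ?b) \<le> \<bar>u x\<bar> * (2 / (1 + norm x powr ?b))" by (rule mult_left_mono) simp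
      then show "norm (weighted ?b u x) \<le> norm (2 * (\<bar>u x\<bar> / (1 + norm x powr ?b)))" using q by (simp add: mult_ac)
    qed
  qed measurable
qed

text \<open>Either \<open>u\<close> is smaller than a decaying power, or \<open>u \<le> u powr p\<close> up to the inverse of that power.\<close>

lemma convolution_weighted:
  fixes u :: "real^'n::finite \<Rightarrow> real"
  assumes cu: "continuous_on UNIV u" and u0: "\<And>x. u x \<ge> 0" and p: "p \<ge> 1" and \<sigma>: "\<sigma> < real CARD('n)"
    and i: "integrable lborel (convolution_integrand \<sigma> p u 0)"
  shows "integrable lborel (weighted (real CARD('n)) u)"
proof -
  let ?n = "real CARD('n)"
  have [measurable]: "u \<in> borel_measurable borel" using cu by (rule borel_measurable_continuous_onI)
  \<comment> \<open>For negative \<open>\<sigma>\<close> the factor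
    \<open>norm x powr (- \<sigma>)\<close> is at least 1 outside the unit ball, so the exponent 0
    can stand in for \<open>\<sigma>\<close>.\<close>
  define s where "s = max \<sigma> 0"
  have s: "s \<ge> 0" "s \<ge> \<sigma>" "s < ?n" using \<sigma> by (auto simp: s_def)
  \<comment> \<open>Positive, so \<open>(1 + norm x) powr (- (n + e))\<close> is integrable, and
    small enough that \<open>e * (p - 1) - n \<le> - s\<close>.\<close>
  define e where "e = (?n - s) / p"
  have e: "e > 0" "e * p \<le> ?n - s" using s p by (auto simp: e_def)
  obtain M where M: "M \<ge> 0" "\<And>x. norm x \<le> 1 \<Longrightarrow> \<bar>u x\<bar> \<le> M" using continuous_bounded_on_cball[OF cu, of 1] by blast
  let ?R = "\<lambda>x. M * indicator (cball 0 1) x + ((1 + norm x) powr (- (?n + e)) + convolution_integrand \<sigma> p u 0 x)"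
  show ?thesis
  proof (rule Bochner_Integration.integrable_bound)
    show "integrable lborel ?R"
      using emeasure_bounded_finite[of "cball (0::real^'n) 1"] e i
      by (intro Bochner_Integration.integrable_add integrable_mult_right integrable_weight) (auto simp: integrable_indicator_iff)
    show "AE x in lborel. norm (weighted ?n u x) \<le> norm (?R x)"
    proof (rule AE_I2)
      fix x :: "real^'n"
      have c0: "convolution_integrand \<sigma> p u 0 x \<ge> 0" by (simp add: convolution_integrand_def)
      have w1: "(1 + norm x) powr (- ?n) \<le> 1" using powr_mono[of "- ?n" 0 "1 + norm x"] by (simp add: add_nonneg_eq_0_iff)
      have x1: "1 + norm x > 0" by (simp add: add_pos_nonneg)
      have "weighted ?n u x \<le> ?R x"
      proof (cases "norm x \<le> 1")
        case True
        have "\<bar>u x\<bar> * (1 + norm x) powr (- ?n) \<le> M * 1" using M True w1 by (intro mult_mono) auto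
        then show ?thesis using True c0 by (simp add: add_increasing2)
      next
        case False
        show ?thesis
        proof (cases "u x \<le> (1 + norm x) powr (- e)")
          case True
          have "\<bar>u x\<bar> * (1 + norm x) powr (- ?n) \<le> (1 + norm x) powr (- e) * (1 + norm x) powr (- ?n)"
            using True u0[of x] by (intro mult_right_mono) auto
          also have "\<dots> = (1 + norm x) powr (- (?n + e))" by (simp add: powr_add[symmetric] add.commute)
          finally show ?thesis using False c0 by simp
        next
          case big: False
          have up: "u x > 0" using big powr_ge_zero[of "1 + norm x" "- e"] by linarith
          have "1 \<le> u x * (1 + norm x) powr e"
          proof -
            have "(1 + norm x) powr (- e) * (1 + norm x) powr e \<le> u x * (1 + norm x) powr e" using big by (intro mult_right_mono) auto
            then show ?thesis using x1 by (simp add: powr_add[symmetric])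
          qed
          \<comment> \<open>Since \<open>p - 1 \<ge> 0\<close>, the lower bound on \<open>u\<close>
            survives raising to this power; multiplication by \<open>u x\<close> then produces
            \<open>u x powr p\<close>.\<close>
          then have "1 \<le> (u x * (1 + norm x) powr e) powr (p - 1)" using p by (intro ge_one_powr_ge_zero) auto
          then have "u x * 1 \<le> u x * (u x powr (p - 1) * (1 + norm x) powr (e * (p - 1)))"
            using up by (intro mult_left_mono) (auto simp: powr_mult powr_powr)
          also have "\<dots> = u x powr p * (1 + norm x) powr (e * (p - 1))" using up by (simp add: powr_diff)
          finally have 1: "u x \<le> u x powr p * (1 + norm x) powr (e * (p - 1))" by simp
          have "\<bar>u x\<bar> * (1 + norm x) powr (- ?n) \<le> u x powr p * (1 + norm x) powr (e * (p - 1)) * (1 + norm x) powr (- ?n)"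
            using 1 up by (intro mult_right_mono) auto
          also have "\<dots> = u x powr p * (1 + norm x) powr (e * (p - 1) - ?n)" by (simp add: powr_add[symmetric] mult.assoc)
          also have "\<dots> \<le> u x powr p * norm x powr (- \<sigma>)"
          proof (rule mult_left_mono)
            have "(1 + norm x) powr (e * (p - 1) - ?n) \<le> (1 + norm x) powr (- s)"
              using e by (intro powr_mono) (auto simp: algebra_simps)
            also have "\<dots> \<le> norm x powr (- s)" using s False by (intro powr_mono2') auto
            also have "\<dots> \<le> norm x powr (- \<sigma>)" using s False by (intro powr_mono) auto
            finally show "(1 + norm x) powr (e * (p - 1) - ?n) \<le> norm x powr (- \<sigma>)" .
          qed simp
          also have "\<dots> = convolution_integrand \<sigma> p u 0 x"
            using up unfolding convolution_integrand_def by (simp add: powr_minus_divide)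
          finally show ?thesis using False by (simp add: add_increasing)
        qed
      qed
      then show "norm (weighted ?n u x) \<le> norm (?R x)" by simp
    qed
  qed measurable
qed

text \<open>If \<open>u x > 0\<close>, the convolution vanishes at \<open>x\<close>, so
  \<open>u\<close> is zero almost everywhere. By continuity the set where \<open>u\<close> is
  positive is open, and an open null set is empty.\<close>

lemma riesz_convolution_zero:
  fixes u :: "real^'n::finite \<Rightarrow> real"
  assumes cu: "continuous_on UNIV u" and u0: "\<And>x. u x \<ge> 0"
    and i: "\<And>x. integrable lborel (convolution_integrand \<sigma> p u x)"
    and z: "\<And>x. riesz_convolution \<sigma> p u x * u x powr q = 0"
  shows "u x = 0"
proof (rule ccontr)
  assume x: "u x \<noteq> 0"
  then have up: "u x > 0" using u0[of x] by simp
  then have "riesz_convolution \<sigma> p u x = 0" using z[of x] by simp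
  then have "AE y in lborel. convolution_integrand \<sigma> p u x y = 0"
    unfolding riesz_convolution_def using i[of x]
    by (subst (asm) integral_nonneg_eq_0_iff_AE) (auto simp: convolution_integrand_def)
  moreover have "AE y in lborel. y \<noteq> x" by (rule AE_lborel_singleton)
  ultimately have ae: "AE y in lborel. u y = 0"
    by eventually_elim (auto simp: convolution_integrand_def)
  have "open {y. u y > 0}" using cu by (intro open_Collect_less continuous_intros) auto
  moreover have "AE y in lborel. y \<notin> {y. u y > 0}" using ae by eventually_elim simp
  then have "{y. u y > 0} \<in> null_sets lborel"
    using \<open>open {y. u y > 0}\<close> by (subst (asm) AE_iff_null_sets[symmetric]) auto
  then have "negligible {y. u y > 0}" by (simp add: negligible_iff_null_sets null_sets_completionI)
  ultimately have "{y. u y > 0} = {}" using open_not_negligible by blast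
  then show False using up by blast
qed

text \<open>Applied with \<open>M = m + 1\<close>. Here the index of \<open>A\<close> counts all
  Laplacians, so \<open>A 0\<close> is the plain heat average of \<open>u\<close>, and reaching it
  already forces \<open>M < n / 2\<close>.\<close>

lemma polyharmonic_Liouville:
  fixes u f :: "real^'n::finite \<Rightarrow> real"
  assumes u: "u \<in> C_k (2 * M)" and W: "integrable lborel (weighted (real CARD('n)) u)"
    and eq: "(neg_laplacian ^^ M) u = f" and f0: "\<And>x. f x \<ge> 0" and M: "real CARD('n) / 2 \<le> real M"
  shows "f x = 0"
proof (rule ccontr)
  assume "f x \<noteq> 0"
  then have fx: "f x > 0" using f0[of x] by simp
  let ?n = "real CARD('n)"
  have cu: "continuous_on UNIV u" using u by (rule C_k_continuous)
  have um [measurable]: "u \<in> borel_measurable borel" using cu by (rule borel_measurable_continuous_onI)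
  have cf: "continuous_on UNIV f"
    using neg_laplacian_power_C_k[of u 0 M] u unfolding eq by (simp add: C_k_0)
  interpret kernel_family heatD ?n u by (rule heatD_kernel_family[OF um W])
  obtain c where c: "c > 0" and low: "\<And>t F M L. t \<ge> 1 \<Longrightarrow> gtest (1 / (4 * t)) M F (heat t) \<Longrightarrow> (\<And>k x. 0 \<le> F k x) \<Longrightarrow>
     (\<lambda>k. \<integral>x. F k x * f x \<partial>lborel) \<longlonglongrightarrow> L \<Longrightarrow> c * t powr (- (?n / 2)) \<le> L"
    using heat_test_lower_bound[OF cf f0 fx] by blast
  have "c * t powr (- (?n / 2)) \<le> A M t" if t: "t \<ge> 1" for t
  proof -
    let ?l = "1 / (4 * t)"
    have t0: "t > 0" and l: "?l > 0" using t by auto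
    obtain F where F: "gtest ?l (2 + 2 * M) F (heat t :: real^'n \<Rightarrow> real)" "\<And>k x. 0 \<le> F k x" using heat_gtest[OF t0] by blast
    define \<psi> where "\<psi> k = (neg_laplacian ^^ M) (F k)" for k
    have g: "gtest ?l 2 \<psi> (heatD M t)" unfolding \<psi>_def using heatD_gtest[OF t0 F(1)] .
    have "(\<integral>x. F k x * f x \<partial>lborel) = (\<integral>x. u x * \<psi> k x \<partial>lborel)" for k
    proof -
      have "(\<integral>x. F k x * (neg_laplacian ^^ M) u x \<partial>lborel) = (\<integral>x. (neg_laplacian ^^ M) (F k) x * u x \<partial>lborel)"
      proof (rule neg_laplacian_power_self_adjoint[OF _ u])
        show "F k \<in> C_k (2 * M)" using gtest_C_k(1)[OF F(1)] by (rule C_k_mono) simp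
        show "F k x = 0" if "norm x > real k" for x using gtest_support[OF F(1) l that] .
      qed
      then show ?thesis unfolding eq \<psi>_def by (simp only: mult.commute)
    qed
    moreover have "(\<lambda>k. \<integral>x. u x * \<psi> k x \<partial>lborel) \<longlonglongrightarrow> A M t"
    proof -
      obtain B where B: "B \<ge> 0" "\<And>x k. \<bar>\<psi> k x\<bar> \<le> B * exp (- (?l / 2) * (norm x)\<^sup>2)" using gtest_bound[OF g l] by blast
      obtain C where C: "C > 0" "\<And>x::real^'n. exp (- (?l / 2) * (norm x)\<^sup>2) \<le> C * (1 + norm x) powr (- ?n)"
        using gaussian_le_weight[of "?l / 2", where 'n='n] l by (metis half_gt_zero)
      have \<psi>m [measurable]: "\<psi> k \<in> borel_measurable borel" for k
        using gtest_continuous[OF g] by (intro borel_measurable_continuous_onI) blast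
      show ?thesis unfolding A_def
      proof (rule integral_dominated_convergence[where w = "\<lambda>x. B * C * weighted ?n u x"])
        show "AE x in lborel. (\<lambda>k. u x * \<psi> k x) \<longlonglongrightarrow> u x * heatD M t x"
          by (intro AE_I2 tendsto_intros gtest_tendsto[OF g l])
        show "AE x in lborel. norm (u x * \<psi> k x) \<le> B * C * weighted ?n u x" for k
        proof (rule AE_I2)
          fix x
          have "\<bar>\<psi> k x\<bar> \<le> B * (C * (1 + norm x) powr (- ?n))"
            using B(2)[of k x] mult_left_mono[OF C(2)[of x] B(1)] by linarith
          then have "\<bar>u x\<bar> * \<bar>\<psi> k x\<bar> \<le> \<bar>u x\<bar> * (B * (C * (1 + norm x) powr (- ?n)))" by (rule mult_left_mono) simp
          then show "norm (u x * \<psi> k x) \<le> B * C * weighted ?n u x" by (simp add: abs_mult mult_ac)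
        qed
      qed (use W in auto)
    qed
    ultimately show ?thesis using low[OF t F] by simp
  qed
  then have "real M < ?n / 2 \<and> (\<exists>c>0. \<forall>t\<ge>1. A 0 t \<ge> c * t powr (real M - ?n / 2))"
    using c A_DERIV A_tendsto_0 by (intro power_lower_bound_chain[where c = c]) auto
  with M show False by simp
qed

text \<open>The integrations in \<open>t\<close> exhaust the \<open>m\<close> Laplacians and stop at
  \<open>A 0\<close>, which still contains the fractional operator. Removing that one is the task of
  subordination and the one-sided maximum principle.\<close>

lemma fractional_Liouville:
  fixes u f :: "real^'n::finite \<Rightarrow> real"
  assumes \<alpha>: "0 < \<alpha>" "\<alpha> < 2" and m: "m \<ge> 1" and \<epsilon>: "\<epsilon> > 0" "frac \<alpha> + \<epsilon> \<le> 1"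
    and u: "u \<in> C_Hoelder_loc (2 * m + nat \<lfloor>\<alpha>\<rfloor>) (frac \<alpha> + \<epsilon>)" and L: "u \<in> L_space \<alpha>"
    and u0: "\<And>x. u x \<ge> 0"
    and eq: "(neg_laplacian ^^ m) (frac_laplacian \<alpha> u) = f" and f0: "\<And>x. f x \<ge> 0"
    and s: "real CARD('n) / 2 \<le> real m + \<alpha> / 2"
  shows "f x = 0"
proof (rule ccontr)
  assume "f x \<noteq> 0"
  then have fx: "f x > 0" using f0[of x] by simp
  let ?n = "real CARD('n)"
  have u2m: "u \<in> C_k (2 * m)" using u by (auto simp: C_Hoelder_loc_def intro: C_k_mono)
  have u2: "u \<in> C_k 2" using u2m m by (auto intro: C_k_mono)
  have um [measurable]: "u \<in> borel_measurable borel"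
    by (rule borel_measurable_continuous_onI[OF C_k_continuous[OF u2]])
  have W: "integrable lborel (weighted (?n + \<alpha>) u)" by (rule L_space_weighted[OF L um \<alpha>(1)])
  define C where "C = frac_const \<alpha> TYPE('n) / 2"
  \<comment> \<open>Were the integral in \<open>frac_const\<close> divergent, its default value
    would make \<open>C\<close> zero. That \<open>C\<close> is positive is deduced further down from
    \<open>B 0 1 > 0\<close>.\<close>
  have C: "C \<ge> 0" unfolding C_def frac_const_def by (simp add: integral_nonneg_AE)
  have v: "frac_laplacian \<alpha> u = (\<lambda>x. C * frac_form \<alpha> u x)"
    unfolding C_def by (rule ext, rule frac_laplacian_eq_frac_form[OF \<alpha> u2 W])
  have vC: "(\<lambda>x. C * frac_form \<alpha> u x) \<in> C_k (2 * m)"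
    using m by (intro C_k_cmult frac_form_C_k[OF \<alpha> \<epsilon> _ u W]) auto
  have cf: "continuous_on UNIV f"
    using neg_laplacian_power_C_k[of _ 0 m, simplified, OF vC] eq unfolding v by (simp add: C_k_0)
  interpret kernel_family "\<lambda>j t. frac_form \<alpha> (heatD j t)" "?n + \<alpha>" u
    by (rule frac_form_heatD_kernel_family[OF \<alpha> um W])
  obtain c where c: "c > 0" and low: "\<And>t F M L. t \<ge> 1 \<Longrightarrow> gtest (1 / (4 * t)) M F (heat t) \<Longrightarrow> (\<And>k x. 0 \<le> F k x) \<Longrightarrow>
     (\<lambda>k. \<integral>x. F k x * f x \<partial>lborel) \<longlonglongrightarrow> L \<Longrightarrow> c * t powr (- (?n / 2)) \<le> L"
    using heat_test_lower_bound[OF cf f0 fx] by blast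
  define B where "B j t = C * A j t" for j t
  have "c * t powr (- (?n / 2)) \<le> B m t" if t: "t \<ge> 1" for t
  proof -
    let ?l = "1 / (4 * t)"
    have t0: "t > 0" and l: "?l > 0" and l4: "?l / 4 > 0" using t by auto
    obtain F where F: "gtest ?l (2 + 2 * m) F (heat t :: real^'n \<Rightarrow> real)" "\<And>k x. 0 \<le> F k x" using heat_gtest[OF t0] by blast
    define \<psi> where "\<psi> k = (neg_laplacian ^^ m) (F k)" for k
    have g: "gtest ?l 2 \<psi> (heatD m t)" unfolding \<psi>_def using heatD_gtest[OF t0 F(1)] .
    obtain D where D: "\<And>k. gauss_bd (?l / 4) D (\<psi> k)" using gtest_gauss_bd[OF g l] by blast
    have "(\<integral>x. F k x * f x \<partial>lborel) = C * (\<integral>x. u x * frac_form \<alpha> (\<psi> k) x \<partial>lborel)" for k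
    proof -
      have "(\<integral>x. F k x * (neg_laplacian ^^ m) (\<lambda>x. C * frac_form \<alpha> u x) x \<partial>lborel) = (\<integral>x. (neg_laplacian ^^ m) (F k) x * (C * frac_form \<alpha> u x) \<partial>lborel)"
      proof (rule neg_laplacian_power_self_adjoint[OF _ vC])
        show "F k \<in> C_k (2 * m)" using gtest_C_k(1)[OF F(1)] by (rule C_k_mono) simp
        show "F k x = 0" if "norm x > real k" for x using gtest_support[OF F(1) l that] .
      qed
      also have "\<dots> = C * (\<integral>x. \<psi> k x * frac_form \<alpha> u x \<partial>lborel)"
        unfolding \<psi>_def by (subst integral_mult_right_zero[symmetric]) (simp only: mult_ac)
      also have "(\<integral>x. \<psi> k x * frac_form \<alpha> u x \<partial>lborel) = (\<integral>x. u x * frac_form \<alpha> (\<psi> k) x \<partial>lborel)"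
      proof (rule frac_form_pairing[OF \<alpha> u2 W D l4])
        show "continuous_on UNIV (\<psi> k)" using gtest_continuous[OF g] by blast
        show "\<psi> k x = 0" if "norm x > real k" for x using gtest_support[OF g l that] .
      qed
      finally show ?thesis using eq unfolding v by simp
    qed
    moreover have "(\<lambda>k. C * (\<integral>x. u x * frac_form \<alpha> (\<psi> k) x \<partial>lborel)) \<longlonglongrightarrow> B m t"
      unfolding B_def A_def by (intro tendsto_intros frac_form_tendsto[OF g l \<alpha> um W])
    ultimately show ?thesis using low[OF t F] by simp
  qed
  moreover have "(B j has_real_derivative - B (Suc j) t) (at t)" if "t \<ge> 1" for j t
    using DERIV_cmult[OF A_DERIV[of t j], of C] that by (simp add: B_def[abs_def])
  moreover have "(B j \<longlongrightarrow> 0) at_top" for j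
    using tendsto_mult_left[OF A_tendsto_0[of j], of C] by (simp add: B_def[abs_def])
  ultimately have "real m < ?n / 2 \<and> (\<exists>c>0. \<forall>t\<ge>1. B 0 t \<ge> c * t powr (real m - ?n / 2))"
    using c by (intro power_lower_bound_chain[where c = c]) auto
  then obtain k where mn: "real m < ?n / 2" and k: "k > 0" "\<And>t. t \<ge> 1 \<Longrightarrow> B 0 t \<ge> k * t powr (real m - ?n / 2)" by blast
  \<comment> \<open>\<open>m < n/2 \<le> m + \<alpha>/2 < m + 1\<close> leaves a single integer
    \<open>n\<close>; the middle inequality then also gives \<open>\<alpha> \<ge> 1\<close>.\<close>
  have n: "CARD('n) = 2 * m + 1" using mn s \<alpha> by linarith
  have a: "1 / 2 \<le> \<alpha> / 2" "\<alpha> / 2 < 1" using s \<alpha> unfolding n by auto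
  have e: "real m - ?n / 2 = - (1 / 2)" unfolding n by (simp add: field_simps)
  define U where "U t = (\<integral>x. u x * heat t x \<partial>lborel)" for t
  define d where "d = subord_const (\<alpha> / 2 + ?n / 2)"
  define \<mu> where "\<mu> = heat_mass TYPE('n)"
  have d: "d > 0" unfolding d_def using \<alpha> by (intro subord_const_pos) (simp add: add_pos_nonneg)
  have \<mu>: "\<mu> > 0" unfolding \<mu>_def by (rule heat_mass_pos)
  note S = heat_average_subordination[OF \<alpha> um W, folded U_def d_def \<mu>_def]
  \<comment> \<open>As \<open>B 0\<close> is \<open>C\<close> times \<open>A 0\<close>, this
    excludes \<open>C = 0\<close>.\<close>
  have Bpos: "B 0 1 > 0" using k(2)[of 1] k(1) by simp
  then have Cpos: "C > 0" using C by (cases "C = 0") (auto simp: B_def)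
  show False
  proof (rule one_sided_maximum_principle[OF a])
    show "isCont U t" if "t > 0" for t
      unfolding U_def[abs_def] using S(3) by (intro heat_average_continuous[OF um W] that) (simp add: U_def)
    show "U t \<ge> 0" for t unfolding U_def using u0 by (intro integral_nonneg_AE AE_I2 mult_nonneg_nonneg) auto
    fix t :: real assume t: "t \<ge> 1"
    then have t0: "t > 0" by simp
    let ?I = "\<integral>s. indicator {0<..} s * (s powr (- 1 - \<alpha> / 2) * (U t - U (t + s))) \<partial>lborel"
    show "integrable lborel (\<lambda>s. indicator {0<..} s * (s powr (- 1 - \<alpha> / 2) * (U t - U (t + s))))" by (rule S(2)[OF t0])
    have "d * A 0 t = 2 * \<mu> * ?I" unfolding A_def heatD_0 by (rule S(1)[OF t0])
    moreover have "C * A 0 t \<ge> k * t powr (- (1 / 2))" using k(2)[OF t] unfolding e B_def .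
    then have "d * (C * A 0 t) \<ge> d * (k * t powr (- (1 / 2)))" using d by (intro mult_left_mono) auto
    ultimately have "d * (k * t powr (- (1 / 2))) \<le> C * (2 * \<mu> * ?I)" by (simp add: mult.left_commute)
    then show "(d * k / (2 * C * \<mu>)) * t powr (- (1 / 2)) \<le> ?I" using Cpos \<mu> by (simp add: field_simps)
  next
    show "d * k / (2 * C * \<mu>) > 0" using d k(1) Cpos \<mu> by simp
  qed
qed

theorem theorem1p8:
  fixes u :: "real^'n::finite \<Rightarrow> real"
    and m :: nat and \<alpha> s \<sigma> p q :: real
  assumes "CARD('n) \<ge> 3"
    and "m \<ge> 1"
    and "0 < \<alpha>" and "\<alpha> \<le> 2"
    and "s = real m + \<alpha> / 2"
    and "real CARD('n) / 2 \<le> s"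
    and "\<sigma> < real CARD('n)"
    and "0 < q"
    and "0 < p" and "\<alpha> = 2 \<Longrightarrow> 1 \<le> p"
    and "\<And>x. u x \<ge> 0"
    and "classical_solution m \<alpha> \<sigma> p q u"
  shows "\<forall>x. u x = 0"
proof -
  have sol: "u \<in> solution_space m \<alpha>" and conv: "\<And>x. integrable lborel (convolution_integrand \<sigma> p u x)"
    and eq: "\<And>x. higher_frac_laplacian m \<alpha> u x = riesz_convolution \<sigma> p u x * u x powr q"
    using assms(12) by (auto simp: classical_solution_def)
  define f where "f x = riesz_convolution \<sigma> p u x * u x powr q" for x
  have f0: "f x \<ge> 0" for x
    unfolding f_def riesz_convolution_def
    by (intro mult_nonneg_nonneg integral_nonneg_AE AE_I2) (auto simp: convolution_integrand_def)
  have ef: "(neg_laplacian ^^ m) (frac_laplacian \<alpha> u) = f"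
    using eq by (auto simp: higher_frac_laplacian_def f_def)
  have "continuous_on UNIV u \<and> (\<forall>x. f x = 0)"
  proof (cases "\<alpha> = 2")
    case True
    \<comment> \<open>For \<open>\<alpha> = 2\<close> the innermost operator is one more negative
      Laplacian, so the total power is \<open>Suc m = s\<close> and \<open>2 * m + 2\<close>
      derivatives are at hand.\<close>
    have u: "u \<in> C_k (2 * Suc m)" using sol True by (simp add: solution_space_def)
    have cu: "continuous_on UNIV u" using u by (rule C_k_continuous)
    have W: "integrable lborel (weighted (real CARD('n)) u)"
      using convolution_weighted[OF cu assms(11) assms(10)[OF True] assms(7) conv] .
    have "(neg_laplacian ^^ Suc m) u = f"
      using ef True by (simp add: frac_laplacian_def funpow_swap1)
    from polyharmonic_Liouville[OF u W this f0] assms(5,6) True cu show ?thesis by simp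
  next
    case False
    then have \<alpha>: "0 < \<alpha>" "\<alpha> < 2" using assms by auto
    from sol False obtain \<epsilon> where \<epsilon>: "\<epsilon> > 0" "frac \<alpha> + \<epsilon> \<le> 1" and L: "u \<in> L_space \<alpha>"
      and u: "u \<in> C_Hoelder_loc (2 * m + nat \<lfloor>\<alpha>\<rfloor>) (frac \<alpha> + \<epsilon>)" by (auto simp: solution_space_def)
    have "continuous_on UNIV u" using u by (auto simp: C_Hoelder_loc_def intro: C_k_continuous)
    moreover have "f x = 0" for x
      by (rule fractional_Liouville[OF \<alpha> assms(2) \<epsilon> u L assms(11) ef f0]) (use assms(5,6) in simp)
    ultimately show ?thesis by blast
  qed
  then show ?thesis
    using riesz_convolution_zero[OF _ assms(11) conv, of q] unfolding f_def by blast
qed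

end
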